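(* Let $n\ge2$. The split $\imath$quantum group $\mathbf U^\imath=\mathbf U^\imath(\mathfrak{sl}_n)$ satisfies the condition (IC): for every word $w$ one has $B_w=\sum_{g\in\mathcal G(\mathbf U^\imath),\,g\preceq w}c_{g,w}B_g$ with all $c_{g,w}\in\mathbb Z[q,q^{-1}]$. Hence it affords a canonical basis, i.e. there is a unique basis $\{C_g\mid g\in\mathcal G(\mathbf U^\imath)\}$ of $\mathbf U^\imath$ such that for each $g\in\mathcal G(\mathbf U^\imath)$: $\overline{C_g}=C_g$, and $C_g=B_{[g]}+\sum_{w\in\mathcal G(\mathbf U^\imath),\,w\prec g}p_{g,w}B_{[w]}$ with $p_{g,w}\in q\mathbb Z[q]$.
   Context: Algebra. Let $\mathfrak g=\mathfrak{sl}_n$ with simple roots $\alpha_1,\dots,\alpha_{n-1}$ numbered in the standard way along the Dynkin diagram, $(\alpha_i,\alpha_i)=2$, $(\alpha_i,\alpha_{i\pm1})=-1$, all other $(\alpha_i,\alpha_j)=0$. Let $q\in\mathbb C$ be transcendental over $\mathbb{Q}$ (equivalently, an indeterminate). $U_q(\mathfrak{sl}_n)$ is the usual quantum group over $\mathbb Q(q)$ with generators $E_i,F_i,K_i^{\pm1}$, with $K_iE_jK_i^{-1}=q^{(\alpha_i,\alpha_j)}E_j$, $K_iF_jK_i^{-1}=q^{-(\alpha_i,\alpha_j)}F_j$, $E_iF_j-F_jE_i=\delta_{ij}\frac{K_i-K_i^{-1}}{q-q^{-1}}$, and the quantum Serre relations. $\mathbf U^\imath$ is the $\mathbb{Q}(q)$-subalgebra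 generated by $B_i=F_i+q^{-1}E_iK_i^{-1}$ ($1\le i\le n-1$). Equivalently, it is generated by $B_1,\dots,B_{n-1}$ subject to $B_iB_j=B_jB_i$ if $|i-j|\ge2$, and $B_i^2B_j-(q+q^{-1})B_iB_jB_i+B_jB_i^2=B_j$ if $|i-j|=1$. The bar involution $\overline{\,\cdot\,}$ is the unique $\mathbb Q$-algebra automorphism of $\mathbf U^\imath$ with $\overline{B_i}=B_i$, $\overline q=q^{-1}$. Words. Let $T(V)$ be the free associative $\mathbb Q(q)$-algebra on letters $v_1,\dots,v_{n-1}$. For a word $w=v_{i_1}\cdots v_{i_k}$ put $\ell(w)=k$, $|w|=\alpha_{i_1}+\cdots+\alpha_{i_k}$, $B_w=B_{i_1}\cdots B_{i_k}$ ($B_\emptyset=1$), extended linearly to $B_x$ for $x\in T(V)$. The order $<$ is lexicographic with $v_1<\cdots<v_{n-1}$, a proper prefix being smaller; $x\prec y$ means $\ell(x)<\ell(y)$, or $\ell(x)=\ell(y)$ and $x>y$. A nonempty word is Lyndon if it is a letter or is $<$ each of its proper nonempty suffixes. Every word factors uniquely as $w=l_1\cdots l_m$ with $l_i$ Lyndon and $l_1\ge\cdots\ge l_m$. A word $g$ is $\mathbf U^\imath$-good if $B_g$ is not a $\mathbb Q(q)$-linear combination of the $B_w$ with $w\prec g$; the empty word is counted as good. $\mathcal G(\mathbf U^\imath)$ is the set of good words; $\{B_g\mid g\in\mathcal G(\mathbf U^\imath)\}$ is a basis of $\mathbf U^\imath$. Bracketing. Extend bilinearly $[x,y]_{q^{-1}}=xy-q^{-(|x|,|y|)}yx$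 for words $x,y$. For a Lyndon word $l$ put $[l]=l$ if $l$ is a letter; otherwise write $l=l_1l_2$ with $l_1$ the longest proper Lyndon prefix of $l$ and put $[l]=[[l_1],[l_2]]_{q^{-1}}$. For a word $w$ with its unique factorization $w=l_1\cdots l_m$ into Lyndon words $l_1\ge\cdots\ge l_m$, put $[w]=[l_1]\cdots[l_m]$ ($[\emptyset]=1$). *)

theory Defs
  imports
    "HOL-Library.Poly_Mapping"
    "HOL-Library.FuncSet"
    "HOL-Computational_Algebra.Polynomial"
    "HOL-Computational_Algebra.Fraction_Field"
    "HOL-Algebra.QuotRing"
    "HOL-Algebra.Generated_Rings"
begin

section \<open>The ground field \<open>\<rat>(q)\<close>\<close>

type_synonym rat_q = "rat poly fract"

definition qq :: rat_q where
  "qq = Fract [:0, 1:] 1"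

definition Z_q :: "rat_q set" where
  "Z_q = range (\<lambda>p :: int poly. poly (map_poly of_int p) qq)"

definition Z_q_qinv :: "rat_q set" where
  "Z_q_qinv = {x / qq ^ k | x k. x \<in> Z_q}"

definition q_Z_q :: "rat_q set" where
  "q_Z_q = {qq * x | x. x \<in> Z_q}"


section \<open>Free algebras\<close>

text \<open>
  Words form the free monoid under concatenation, written additively so that
  \<open>'a list \<Rightarrow>\<^sub>0 rat_q\<close> with the convolution product of \<^theory>\<open>HOL-Library.Poly_Mapping\<close>
  is the free associative \<open>\<rat>(q)\<close>-algebra on the letters of type \<open>'a\<close>.
\<close>

instantiation list :: (type) monoid_add
begin

definition zero_list :: "'a list" where "zero_list = []"

definition plus_list :: "'a list \<Rightarrow> 'a list \<Rightarrow> 'a list" where "plus_list = (@)"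

instance by standard (simp_all add: zero_list_def plus_list_def)

end

type_synonym 'a free = "'a list \<Rightarrow>\<^sub>0 rat_q"

definition letter :: "'a \<Rightarrow> 'a free" where
  "letter a = Poly_Mapping.single [a] 1"

definition const :: "rat_q \<Rightarrow> 'a free" where
  "const c = Poly_Mapping.single [] c"

text \<open>The free algebra on a given set \<open>A\<close> of letters.\<close>

definition free_algebra :: "'a set \<Rightarrow> 'a free ring" where
  "free_algebra A =
     \<lparr>carrier = {x. \<forall>w \<in> Poly_Mapping.keys x. set w \<subseteq> A},
      mult = (*), one = 1, zero = 0, add = (+)\<rparr>"


section \<open>The quantum group \<open>U\<^sub>q(sl\<^sub>n)\<close>\<close>

text \<open>The form \<open>(\<alpha>\<^sub>i, \<alpha>\<^sub>j)\<close> on simple roots.\<close>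

definition root_form :: "nat \<Rightarrow> nat \<Rightarrow> int" where
  "root_form i j = (if i = j then 2 else if i = j + 1 \<or> j = i + 1 then -1 else 0)"

datatype generator = GenE nat | GenF nat | GenK nat | GenKinv nat

definition generators :: "nat \<Rightarrow> generator set" where
  "generators n = (\<Union>i \<in> {1..n-1}. {GenE i, GenF i, GenK i, GenKinv i})"

definition serre :: "'a free \<Rightarrow> 'a free \<Rightarrow> 'a free" where
  "serre x y = x * x * y - const (qq + inverse qq) * (x * y * x) + y * x * x"

definition Uq_relations :: "nat \<Rightarrow> generator free set" where
  "Uq_relations n =
     (let E = (\<lambda>i. letter (GenE i)); F = (\<lambda>i. letter (GenF i));
          K = (\<lambda>i. letter (GenK i)); K' = (\<lambda>i. letter (GenKinv i)); I = {1..n-1}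
      in {K i * K' i - 1 | i. i \<in> I} \<union> {K' i * K i - 1 | i. i \<in> I}
       \<union> {K i * K j - K j * K i | i j. i \<in> I \<and> j \<in> I}
       \<union> {K i * E j * K' i - const (qq powi root_form i j) * E j | i j. i \<in> I \<and> j \<in> I}
       \<union> {K i * F j * K' i - const (qq powi (- root_form i j)) * F j | i j. i \<in> I \<and> j \<in> I}
       \<union> {E i * F j - F j * E i
            - (if i = j then const (inverse (qq - inverse qq)) * (K i - K' i) else 0)
          | i j. i \<in> I \<and> j \<in> I}
       \<union> {E i * E j - E j * E i | i j. i \<in> I \<and> j \<in> I \<and> root_form i j = 0}
       \<union> {F i * F j - F j * F i | i j. i \<in> I \<and> j \<in> I \<and> root_form i j = 0}
       \<union> {serre (E i) (E j) | i j. i \<in> I \<and> j \<in> I \<and> root_form i j = -1}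
       \<union> {serre (F i) (F j) | i j. i \<in> I \<and> j \<in> I \<and> root_form i j = -1})"

definition Uq_ideal :: "nat \<Rightarrow> generator free set" where
  "Uq_ideal n = Idl\<^bsub>free_algebra (generators n)\<^esub> (Uq_relations n)"

definition Uq_class :: "nat \<Rightarrow> generator free \<Rightarrow> generator free set" where
  "Uq_class n x = Uq_ideal n +>\<^bsub>free_algebra (generators n)\<^esub> x"

text \<open>
  The quotient ring, as a record that also carries scalar multiplication by \<open>\<rat>(q)\<close>.
\<close>

definition Uq :: "nat \<Rightarrow> (rat_q, generator free set) module" where
  "Uq n =
     (let Q = free_algebra (generators n) Quot Uq_ideal n
      in ring.extend Q (module.fields (\<lambda>c X. Uq_class n (const c) \<otimes>\<^bsub>Q\<^esub> X)))"


section \<open>The \<open>\<iota>\<close>quantum group\<close>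

definition B_gen :: "nat \<Rightarrow> nat \<Rightarrow> generator free set" where
  "B_gen n i =
     Uq_class n (letter (GenF i) + const (inverse qq) * letter (GenE i) * letter (GenKinv i))"

text \<open>
  A \<open>\<rat>(q)\<close>-subalgebra is a subring containing the scalars.
\<close>

definition Ui :: "nat \<Rightarrow> generator free set set" where
  "Ui n = generate_ring (Uq n) (range (\<lambda>c. c \<odot>\<^bsub>Uq n\<^esub> \<one>\<^bsub>Uq n\<^esub>) \<union> B_gen n ` {1..n-1})"

text \<open>
  Ring homomorphisms between \<open>\<rat>\<close>-algebras are automatically \<open>\<rat>\<close>-linear. Extensionality
  makes the description unique as a HOL function.
\<close>

definition bar :: "nat \<Rightarrow> generator free set \<Rightarrow> generator free set" where
  "bar n = (THE \<psi>.
     \<psi> \<in> ring_iso ((Uq n)\<lparr>carrier := Ui n\<rparr>) ((Uq n)\<lparr>carrier := Ui n\<rparr>) \<and>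
     \<psi> \<in> extensional (Ui n) \<and>
     (\<forall>i \<in> {1..n-1}. \<psi> (B_gen n i) = B_gen n i) \<and>
     \<psi> (qq \<odot>\<^bsub>Uq n\<^esub> \<one>\<^bsub>Uq n\<^esub>) = inverse qq \<odot>\<^bsub>Uq n\<^esub> \<one>\<^bsub>Uq n\<^esub>)"

text \<open>
  \<open>b\<close> restricted to \<open>I\<close> is a basis of the subspace \<open>V\<close> of \<open>M\<close>: every element of \<open>V\<close> is a
  finite linear combination in exactly one way.
\<close>

definition is_basis :: "(rat_q, 'b) module \<Rightarrow> 'b set \<Rightarrow> 'i set \<Rightarrow> ('i \<Rightarrow> 'b) \<Rightarrow> bool" where
  "is_basis M V I b \<longleftrightarrow>
     (\<forall>i \<in> I. b i \<in> V) \<and>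
     (\<forall>x \<in> V. \<exists>!c :: 'i \<Rightarrow>\<^sub>0 rat_q. Poly_Mapping.keys c \<subseteq> I \<and>
        x = (\<Oplus>\<^bsub>M\<^esub>i \<in> Poly_Mapping.keys c. Poly_Mapping.lookup c i \<odot>\<^bsub>M\<^esub> b i))"


section \<open>Words\<close>

text \<open>The letter \<open>v\<^sub>i\<close> is represented by the number \<open>i\<close>.\<close>

type_synonym word = "nat list"

definition words :: "nat \<Rightarrow> word set" where
  "words n = lists {1..n-1}"

definition B_word :: "nat \<Rightarrow> word \<Rightarrow> generator free set" where
  "B_word n w = foldr (\<lambda>i X. B_gen n i \<otimes>\<^bsub>Uq n\<^esub> X) w \<one>\<^bsub>Uq n\<^esub>"

definition B_lin :: "nat \<Rightarrow> nat free \<Rightarrow> generator free set" where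
  "B_lin n x =
     (\<Oplus>\<^bsub>Uq n\<^esub>w \<in> Poly_Mapping.keys x. Poly_Mapping.lookup x w \<odot>\<^bsub>Uq n\<^esub> B_word n w)"

text \<open>\<open>lexord\<close> makes a proper prefix smaller.\<close>

definition lex_less :: "word \<Rightarrow> word \<Rightarrow> bool" where
  "lex_less x y \<longleftrightarrow> (x, y) \<in> lexord less_than"

text \<open>Among words of equal length the lexicographically larger one comes first.\<close>

definition prec :: "word \<Rightarrow> word \<Rightarrow> bool" where
  "prec x y \<longleftrightarrow> length x < length y \<or> (length x = length y \<and> lex_less y x)"

abbreviation prec_eq :: "word \<Rightarrow> word \<Rightarrow> bool" where
  "prec_eq x y \<equiv> prec x y \<or> x = y"

definition lyndon :: "word \<Rightarrow> bool" where
  "lyndon w \<longleftrightarrow> w \<noteq> [] \<and> (\<forall>u v. w = u @ v \<and> u \<noteq> [] \<and> v \<noteq> [] \<longrightarrow> lex_less w v)"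

definition lyndon_factors :: "word \<Rightarrow> word list" where
  "lyndon_factors w = (THE ls. concat ls = w \<and> (\<forall>l \<in> set ls. lyndon l) \<and>
     sorted_wrt (\<lambda>x y. x = y \<or> lex_less y x) ls)"

definition good :: "nat \<Rightarrow> word set" where
  "good n = {g \<in> words n. g = [] \<or>
     \<not> (\<exists>c :: word \<Rightarrow> rat_q.
          B_word n g = (\<Oplus>\<^bsub>Uq n\<^esub>w \<in> {w \<in> words n. prec w g}. c w \<odot>\<^bsub>Uq n\<^esub> B_word n w))}"


section \<open>Bracketing\<close>

text \<open>The form \<open>(|u|, |v|)\<close> on weights of words.\<close>

definition weight_form :: "word \<Rightarrow> word \<Rightarrow> int" where
  "weight_form u v = (\<Sum>i \<leftarrow> u. \<Sum>j \<leftarrow> v. root_form i j)"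

definition qbracket :: "nat free \<Rightarrow> nat free \<Rightarrow> nat free" where
  "qbracket x y =
     (\<Sum>u \<in> Poly_Mapping.keys x. \<Sum>v \<in> Poly_Mapping.keys y.
        const (Poly_Mapping.lookup x u * Poly_Mapping.lookup y v) *
        (Poly_Mapping.single (u @ v) 1
         - const (qq powi (- weight_form u v)) * Poly_Mapping.single (v @ u) 1))"

text \<open>Length of the longest proper Lyndon prefix; meaningful for words of length at least 2.\<close>

definition split_length :: "word \<Rightarrow> nat" where
  "split_length l = Max {k. 0 < k \<and> k < length l \<and> lyndon (take k l)}"

lemma split_length_bounds:
  assumes "1 < length l"
  shows "0 < split_length l" "split_length l < length l"
proof -
  let ?S = "{k. 0 < k \<and> k < length l \<and> lyndon (take k l)}"
  from assms obtain a m where l: "l = a # m" by (cases l) auto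
  have "lyndon (take 1 l)" by (auto simp: l lyndon_def Cons_eq_append_conv)
  with assms have "1 \<in> ?S" by simp
  moreover have "finite ?S" by simp
  ultimately have "Max ?S \<in> ?S" by (intro Max_in) auto
  then show "0 < split_length l" "split_length l < length l"
    by (auto simp: split_length_def)
qed

text \<open>Only the values on Lyndon words matter.\<close>

function lyndon_bracket :: "word \<Rightarrow> nat free" where
  "lyndon_bracket l =
     (if length l \<le> 1 then Poly_Mapping.single l 1
      else qbracket (lyndon_bracket (take (split_length l) l))
                    (lyndon_bracket (drop (split_length l) l)))"
  by auto
termination
  by (relation "measure length")
    (use split_length_bounds in \<open>auto simp: not_le intro!: diff_less intro: less_trans\<close>)

declare lyndon_bracket.simps [simp del]

definition bracket :: "word \<Rightarrow> nat free" where
  "bracket w = prod_list (map lyndon_bracket (lyndon_factors w))"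

definition B_bracket :: "nat \<Rightarrow> word \<Rightarrow> generator free set" where
  "B_bracket n w = B_lin n (bracket w)"

end

theory Submission
  imports Defs
begin

text \<open>
  Call a word normal if it is a product of intervals \<open>i (i+1) \<dots> (j-1)\<close> in weakly decreasing
  lexicographic order. Intervals are Lyndon words, so this product is the Lyndon factorization of
  the word. The core of the proof is that the good words are exactly the normal words, and that
  rewriting an arbitrary word into normal ones only needs coefficients in \<open>\<int>[q, q\<^sup>-\<^sup>1]\<close>.

  Spanning. A word that is not normal contains one of three patterns: \<open>a k\<close> with \<open>k \<ge> a + 2\<close>, an
  interval of length at least two that starts in \<open>a\<close> and is followed by \<open>a + 1\<close>, or an interval
  followed by the same interval prolonged by one letter. The first is reduced by commuting the two
  letters. The second is a Serre relation or follows from an overlap of two Serre relations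
  (\<open>serre_overlap\<close>). The third is the Serre relation between the root vector of an interval and
  the next generator (\<open>serre_root_vector\<close>). In each of these relations the pattern is the largest word with respect
  to \<open>prec\<close> and has coefficient 1, and all other coefficients are Laurent polynomials over \<open>\<int>\<close>;
  hence the rewriting stays integral (\<open>normal_span\<close>).

  Independence. A word \<open>h\<close> that is a product of \<open>m\<close> intervals is detected by one matrix entry in
  the \<open>m\<close>-th tensor power of the vector representation: the entry that raises the \<open>k\<close>-th tensor
  factor exactly along the \<open>k\<close>-th interval. A word \<open>g\<close> that is not longer than \<open>h\<close> has a nonzero
  entry there only if it is a shuffle of the intervals of \<open>h\<close>. The lexicographically largest
  shuffle of a decreasing product of intervals is the product itself, so such a \<open>g\<close> never precedes
  \<open>h\<close>. Nothing cancels, because all the matrix entries are nonnegative in the ordered field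
  \<open>\<rat>(q)\<close>, where \<open>q\<close> exceeds every rational number (\<open>normal_word_separated\<close>).

  Bar involution. The assignment \<open>E\<^sub>i \<mapsto> q\<^sup>-\<^sup>1 F\<^sub>i K\<^sub>i\<close>, \<open>F\<^sub>i \<mapsto> q\<^sup>-\<^sup>1 E\<^sub>i K\<^sub>i\<^sup>-\<^sup>1\<close>, \<open>K\<^sub>i \<mapsto> K\<^sub>i\<close>, \<open>q \<mapsto> q\<^sup>-\<^sup>1\<close>
  respects all relations of the quantum group and fixes every \<open>B\<^sub>i\<close>. Its restriction is the bar
  involution, which therefore acts on the coefficients with respect to the good words
  (\<open>bar_val\<close>).

  Canonical basis. The elements \<open>B\<close> of bracketed good words are unitriangular over
  \<open>\<int>[q, q\<^sup>-\<^sup>1]\<close> with respect to the bar invariant basis of the \<open>B\<close> of good words. Existence of the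
  canonical basis follows by splitting each coefficient into a bar invariant part and a part in
  \<open>q\<int>[q]\<close>, uniqueness because \<open>0\<close> is the only bar invariant element of \<open>q\<int>[q]\<close>.
\<close>

alias single = Poly_Mapping.single
alias keys = Poly_Mapping.keys
alias lookup = Poly_Mapping.lookup

section \<open>Scalars\<close>

definition at_scalar :: "rat_q \<Rightarrow> rat poly \<Rightarrow> rat_q" where
  "at_scalar v p = poly (map_poly of_rat p) v"

lemma at_scalar_0 [simp]: "at_scalar v 0 = 0"
  by (simp add: at_scalar_def)

lemma at_scalar_1 [simp]: "at_scalar v 1 = 1"
  by (simp add: at_scalar_def map_poly_1)

lemma at_scalar_pCons [simp]: "at_scalar v (pCons a p) = of_rat a + v * at_scalar v p"
  by (simp add: at_scalar_def map_poly_pCons)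

lemma at_scalar_add: "at_scalar v (p + r) = at_scalar v p + at_scalar v r"
  by (induction p r rule: poly_induct2) (simp_all add: of_rat_add algebra_simps)

lemma at_scalar_smult: "at_scalar v (Polynomial.smult c p) = of_rat c * at_scalar v p"
  by (induction p) (simp_all add: of_rat_mult algebra_simps)

lemma at_scalar_mult: "at_scalar v (p * r) = at_scalar v p * at_scalar v r"
  by (induction p) (simp_all add: at_scalar_add at_scalar_smult algebra_simps)

lemma Fract_const_poly: "Fract [:r:] 1 = (of_rat r :: rat_q)"
proof -
  have of_nat: "Fract [:rat_of_nat k:] 1 = (of_nat k :: rat_q)" for k
  proof (induction k)
    case (Suc k)
    have "Fract [:rat_of_nat (Suc k):] 1 = (Fract [:rat_of_nat k:] 1 + Fract 1 1 :: rat_q)"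
      by (simp add: one_pCons add.commute)
    then show ?case using Suc by (simp add: One_fract_def)
  qed (simp add: Zero_fract_def)
  have of_int: "Fract [:rat_of_int k:] 1 = (of_int k :: rat_q)" for k
  proof (cases k rule: int_cases2)
    case (nonneg m) then show ?thesis using of_nat[of m] by simp
  next
    case (nonpos m)
    have "Fract [:- rat_of_nat m:] 1 = - (Fract [:rat_of_nat m:] 1 :: rat_q)" by simp
    then show ?thesis using nonpos of_nat[of m] by simp
  qed
  obtain a b where r: "r = Rat.Fract a b" "b > 0" by (cases r) auto
  have "Fract [:r:] 1 * Fract [:rat_of_int b:] 1 = (Fract [:rat_of_int a:] 1 :: rat_q)"
    using r by (simp add: Fract_of_int_quotient)
  then have "Fract [:r:] 1 = (of_int a / of_int b :: rat_q)"
    using r(2) by (simp add: of_int field_simps)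
  then show ?thesis using r by (simp add: of_rat_rat)
qed

lemma Fract_eq_at_scalar: "Fract p 1 = at_scalar qq p"
proof (induction p)
  case (pCons a p)
  have "Fract (pCons a p) 1 = (Fract [:a:] 1 + qq * Fract p 1 :: rat_q)"
    by (simp add: qq_def)
  then show ?case using pCons by (simp add: Fract_const_poly)
qed (simp add: Zero_fract_def)

lemma at_scalar_qq_eq_iff: "at_scalar qq p = at_scalar qq r \<longleftrightarrow> p = r"
  by (simp flip: Fract_eq_at_scalar add: eq_fract)

lemma qq_nonzero [simp]: "qq \<noteq> 0"
  by (simp add: qq_def eq_fract Zero_fract_def)

text \<open>
  \<open>q\<^sup>-\<^sup>1\<close> is transcendental as well: multiplying a value at \<open>q\<^sup>-\<^sup>1\<close> by a power of \<open>q\<close> gives the value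
  of the reflected polynomial at \<open>q\<close>. So substituting \<open>q\<^sup>-\<^sup>1\<close> extends to fractions.
\<close>

lemma at_scalar_inverse: "qq ^ degree p * at_scalar (inverse qq) p = at_scalar qq (reflect_poly p)"
proof -
  have reflect: "map_poly of_rat (reflect_poly p) = reflect_poly (map_poly of_rat p :: rat_q poly)"
    by (rule poly_eqI) (simp add: coeff_reflect_poly coeff_map_poly degree_map_poly)
  show ?thesis
    by (simp add: at_scalar_def reflect poly_reflect_poly_nz degree_map_poly)
qed

lemma at_scalar_inverse_nonzero: "p \<noteq> 0 \<Longrightarrow> at_scalar (inverse qq) p \<noteq> 0"
  using at_scalar_inverse[of p] at_scalar_qq_eq_iff[of "reflect_poly p" 0] by auto

lemma qq_gt_1: "1 < qq"
  by (simp add: qq_def One_fract_def less_fract pos_poly_def less_poly_def one_pCons)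

lemma qq_pos [simp]: "0 < qq"
  using less_trans[OF zero_less_one qq_gt_1] .

lemma qq_minus_inverse_nonzero: "qq - inverse qq \<noteq> 0"
  using qq_gt_1 by (smt (verit) eq_iff_diff_eq_0 inverse_less_1_iff less_imp_not_eq order_less_trans)

lemma qq_plus_inverse_nonzero: "qq + inverse qq \<noteq> 0"
  using qq_pos positive_imp_inverse_positive[OF qq_pos] by (metis add_pos_pos less_irrefl)

definition qbar :: "rat_q \<Rightarrow> rat_q" where
  "qbar x = (let (a, b) = SOME (a, b). b \<noteq> 0 \<and> x = Fract a b
             in at_scalar (inverse qq) a / at_scalar (inverse qq) b)"

lemma qbar_Fract:
  assumes "b \<noteq> 0"
  shows "qbar (Fract a b) = at_scalar (inverse qq) a / at_scalar (inverse qq) b"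
proof -
  obtain c d where cd: "(SOME (c, d). d \<noteq> 0 \<and> Fract a b = Fract c d) = (c, d)"
    by (meson surj_pair)
  have "\<exists>p. case p of (c, d) \<Rightarrow> d \<noteq> 0 \<and> Fract a b = Fract c d"
    using assms by auto
  from someI_ex[OF this] have "d \<noteq> 0" "Fract a b = Fract c d" by (auto simp: cd)
  then have "a * d = c * b" using assms by (simp add: eq_fract)
  then have "at_scalar (inverse qq) a * at_scalar (inverse qq) d
    = at_scalar (inverse qq) c * at_scalar (inverse qq) b"
    by (simp flip: at_scalar_mult)
  then show ?thesis
    using at_scalar_inverse_nonzero[OF \<open>b \<noteq> 0\<close>] at_scalar_inverse_nonzero[OF \<open>d \<noteq> 0\<close>]
    by (simp add: qbar_def cd field_simps)
qed

lemma qbar_add: "qbar (x + y) = qbar x + qbar y"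
proof -
  obtain a b c d where "x = Fract a b" "b \<noteq> 0" "y = Fract c d" "d \<noteq> 0"
    by (metis Fract_cases)
  then show ?thesis
    by (simp add: qbar_Fract at_scalar_inverse_nonzero at_scalar_mult at_scalar_add
        add_frac_eq mult.commute)
qed

lemma qbar_mult: "qbar (x * y) = qbar x * qbar y"
proof -
  obtain a b c d where "x = Fract a b" "b \<noteq> 0" "y = Fract c d" "d \<noteq> 0"
    by (metis Fract_cases)
  then show ?thesis by (simp add: qbar_Fract at_scalar_mult)
qed

lemma qbar_0 [simp]: "qbar 0 = 0"
  by (simp add: Zero_fract_def qbar_Fract)

lemma qbar_1 [simp]: "qbar 1 = 1"
  by (simp add: One_fract_def qbar_Fract)

lemma qbar_qq [simp]: "qbar qq = inverse qq"
  by (simp add: qq_def qbar_Fract)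

lemma qbar_minus: "qbar (- x) = - qbar x"
  using qbar_add[of x "- x"] by (simp add: eq_neg_iff_add_eq_0 add.commute)

lemma qbar_diff: "qbar (x - y) = qbar x - qbar y"
  using qbar_add[of x "- y"] by (simp add: qbar_minus)

lemma qbar_inverse: "qbar (inverse x) = inverse (qbar x)"
proof (cases "x = 0")
  case False
  then have "qbar x * qbar (inverse x) = 1" by (simp flip: qbar_mult)
  then show ?thesis by (metis inverse_unique)
qed simp

lemma qbar_at_scalar: "qbar (at_scalar qq p) = at_scalar (inverse qq) p"
  by (simp flip: Fract_eq_at_scalar add: qbar_Fract)

text \<open>
  \<open>\<rat>(q)\<close> is generated by \<open>q\<close> as a field; a ring homomorphism out of it is determined by the image
  of \<open>q\<close>.
\<close>

lemma rat_q_induct [case_names one qq diff mult inverse]: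
  assumes one: "P 1" and qq: "P qq"
    and diff: "\<And>x y. P x \<Longrightarrow> P y \<Longrightarrow> P (x - y)"
    and mult: "\<And>x y. P x \<Longrightarrow> P y \<Longrightarrow> P (x * y)"
    and inverse: "\<And>x. P x \<Longrightarrow> P (inverse x)"
  shows "P (x :: rat_q)"
proof -
  have zero: "P 0" using diff[OF one one] by simp
  have add: "P (x + y)" if "P x" "P y" for x y
    using diff[OF that(1) diff[OF zero that(2)]] by simp
  have of_nat: "P (of_nat k)" for k
    by (induction k) (simp_all add: zero one add)
  have of_int: "P (of_int k)" for k
    using of_nat diff[OF zero of_nat] by (cases k rule: int_cases2) (metis of_int_of_nat_eq diff_0 of_int_minus)+
  have of_rat: "P (of_rat r)" for r
  proof -
    obtain a b where "r = Rat.Fract a b" "b > 0" by (cases r) auto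
    then show ?thesis
      using mult[OF of_int[of a] inverse[OF of_int[of b]]] by (simp add: of_rat_rat divide_inverse)
  qed
  have at: "P (at_scalar qq p)" for p
    by (induction p) (simp_all add: zero add mult of_rat qq)
  obtain a b where "x = Fract a b" "b \<noteq> 0" by (cases x) auto
  moreover from this have "x = Fract a 1 * inverse (Fract b 1)" by simp
  ultimately show ?thesis
    using mult[OF at[of a] inverse[OF at[of b]]] by (simp add: Fract_eq_at_scalar)
qed

lemma qbar_qbar [simp]: "qbar (qbar x) = x"
  by (induction x rule: rat_q_induct) (simp_all add: qbar_diff qbar_mult qbar_inverse)

lemma qbar_of_int [simp]: "qbar (of_int k) = of_int k"
proof -
  have "qbar (of_nat m) = of_nat m" for m
    by (induction m) (simp_all add: qbar_add)
  then show ?thesis by (cases k rule: int_cases2) (simp_all add: qbar_minus)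
qed

lemma qbar_power: "qbar (x ^ k) = qbar x ^ k"
  by (induction k) (simp_all add: qbar_mult)

lemma qbar_sum: "qbar (sum f S) = (\<Sum>x\<in>S. qbar (f x))"
  by (induction S rule: infinite_finite_induct) (simp_all add: qbar_add)


lemma Z_q_add: "x \<in> Z_q \<Longrightarrow> y \<in> Z_q \<Longrightarrow> x + y \<in> Z_q"
proof -
  have hom: "map_poly of_int (p + r) = (map_poly of_int p + map_poly of_int r :: rat_q poly)" for p r
    by (rule poly_eqI) (simp add: coeff_map_poly)
  assume "x \<in> Z_q" "y \<in> Z_q"
  then show ?thesis by (auto simp: Z_q_def simp flip: poly_add hom)
qed

lemma Z_q_minus: "x \<in> Z_q \<Longrightarrow> - x \<in> Z_q"
proof -
  have hom: "map_poly of_int (- p) = (- map_poly of_int p :: rat_q poly)" for p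
    by (rule poly_eqI) (simp add: coeff_map_poly)
  assume "x \<in> Z_q"
  then show ?thesis by (auto simp: Z_q_def simp flip: poly_minus hom)
qed

lemma Z_q_mult: "x \<in> Z_q \<Longrightarrow> y \<in> Z_q \<Longrightarrow> x * y \<in> Z_q"
proof -
  have hom: "map_poly of_int (p * r) = (map_poly of_int p * map_poly of_int r :: rat_q poly)" for p r
    by (rule poly_eqI) (simp add: coeff_map_poly coeff_mult)
  assume "x \<in> Z_q" "y \<in> Z_q"
  then show ?thesis by (auto simp: Z_q_def simp flip: poly_mult hom)
qed

lemma Z_q_of_int: "of_int k \<in> Z_q"
  unfolding Z_q_def by (rule range_eqI[of _ _ "[:k:]"]) (simp add: map_poly_pCons)

lemma Z_q_qq: "qq \<in> Z_q"
  unfolding Z_q_def by (rule range_eqI[of _ _ "[:0, 1:]"]) (simp add: map_poly_pCons)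

lemma Z_q_power: "qq ^ k \<in> Z_q"
  using Z_q_of_int[of 1] by (induction k) (simp_all add: Z_q_mult Z_q_qq)

lemma Z_q_induct [consumes 1, case_names zero step]:
  assumes "x \<in> Z_q" and "P 0" and "\<And>k x. x \<in> Z_q \<Longrightarrow> P x \<Longrightarrow> P (of_int k + qq * x)"
  shows "P x"
proof -
  have "P (poly (map_poly of_int p) qq)" for p
    by (induction p) (auto simp: map_poly_pCons Z_q_def intro!: assms)
  with assms(1) show ?thesis by (auto simp: Z_q_def)
qed

lemma laurentI: "x \<in> Z_q \<Longrightarrow> x / qq ^ k \<in> Z_q_qinv"
  by (auto simp: Z_q_qinv_def)

lemma laurent_add: "x \<in> Z_q_qinv \<Longrightarrow> y \<in> Z_q_qinv \<Longrightarrow> x + y \<in> Z_q_qinv"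
proof -
  assume "x \<in> Z_q_qinv" "y \<in> Z_q_qinv"
  then obtain a k b l where "x = a / qq ^ k" "a \<in> Z_q" "y = b / qq ^ l" "b \<in> Z_q"
    by (auto simp: Z_q_qinv_def)
  then have "x + y = (a * qq ^ l + b * qq ^ k) / qq ^ (k + l)"
    "a * qq ^ l + b * qq ^ k \<in> Z_q"
    by (auto simp: field_simps power_add intro!: Z_q_add Z_q_mult Z_q_power)
  then show ?thesis using laurentI by metis
qed

lemma laurent_minus: "x \<in> Z_q_qinv \<Longrightarrow> - x \<in> Z_q_qinv"
  using Z_q_minus laurentI by (fastforce simp: Z_q_qinv_def simp flip: minus_divide_left)

lemma laurent_mult: "x \<in> Z_q_qinv \<Longrightarrow> y \<in> Z_q_qinv \<Longrightarrow> x * y \<in> Z_q_qinv"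
proof -
  assume "x \<in> Z_q_qinv" "y \<in> Z_q_qinv"
  then obtain a k b l where "x = a / qq ^ k" "a \<in> Z_q" "y = b / qq ^ l" "b \<in> Z_q"
    by (auto simp: Z_q_qinv_def)
  then have "x * y = (a * b) / qq ^ (k + l)" "a * b \<in> Z_q"
    by (auto simp: power_add intro: Z_q_mult)
  then show ?thesis using laurentI by metis
qed

lemma Z_q_laurent: "x \<in> Z_q \<Longrightarrow> x \<in> Z_q_qinv"
  using laurentI[of x 0] by simp

lemma laurent_of_int: "of_int k \<in> Z_q_qinv"
  by (simp add: Z_q_laurent Z_q_of_int)

lemma laurent_0 [simp]: "0 \<in> Z_q_qinv"
  using laurent_of_int[of 0] by simp

lemma laurent_1 [simp]: "1 \<in> Z_q_qinv"
  using laurent_of_int[of 1] by simp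

lemma laurent_qq [simp]: "qq \<in> Z_q_qinv"
  by (simp add: Z_q_laurent Z_q_qq)

lemma laurent_inverse_qq [simp]: "inverse qq \<in> Z_q_qinv"
  using laurentI[of 1 1] Z_q_of_int[of 1] by (simp add: divide_inverse)

lemma laurent_powi [simp]: "qq powi k \<in> Z_q_qinv"
proof -
  have "x ^ m \<in> Z_q_qinv" if "x \<in> Z_q_qinv" for x m
    by (induction m) (simp_all add: laurent_mult that)
  then show ?thesis by (simp add: power_int_def)
qed

lemma q_Z_q_add: "x \<in> q_Z_q \<Longrightarrow> y \<in> q_Z_q \<Longrightarrow> x + y \<in> q_Z_q"
  by (auto simp: q_Z_q_def simp flip: distrib_left intro: Z_q_add)

lemma q_Z_q_minus: "x \<in> q_Z_q \<Longrightarrow> - x \<in> q_Z_q"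
  by (auto simp: q_Z_q_def simp flip: mult_minus_right intro: Z_q_minus)

lemma q_Z_q_0 [simp]: "0 \<in> q_Z_q"
  using Z_q_of_int[of 0] by (auto simp: q_Z_q_def)

lemma q_Z_q_Z_q: "x \<in> q_Z_q \<Longrightarrow> x \<in> Z_q"
  by (auto simp: q_Z_q_def intro: Z_q_mult Z_q_qq)

lemma q_Z_q_mult: "x \<in> q_Z_q \<Longrightarrow> y \<in> Z_q \<Longrightarrow> x * y \<in> q_Z_q"
  using Z_q_mult by (fastforce simp: q_Z_q_def mult.assoc)

lemma q_Z_q_sum: "(\<And>x. x \<in> S \<Longrightarrow> f x \<in> q_Z_q) \<Longrightarrow> sum f S \<in> q_Z_q"
  by (induction S rule: infinite_finite_induct) (simp_all add: q_Z_q_add)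

text \<open>
  If \<open>p\<close> is a polynomial of degree \<open>d\<close> without constant term and \<open>p(q) = p(q\<^sup>-\<^sup>1)\<close>, then \<open>q\<^sup>d p(q)\<close> is
  the reflection of \<open>p\<close>. The first has degree \<open>2 d\<close> and the second at most
  \<open>d\<close>, while \<open>d > 0\<close> unless \<open>p = 0\<close>.
\<close>

lemma q_Z_q_qbar_fixed:
  assumes "x \<in> q_Z_q" "qbar x = x"
  shows "x = 0"
proof (rule ccontr)
  assume nonzero: "x \<noteq> 0"
  obtain f :: "int poly" where x: "x = qq * poly (map_poly of_int f) qq"
    using assms(1) by (auto simp: q_Z_q_def Z_q_def)
  define p :: "rat poly" where "p = pCons 0 (map_poly of_int f)"
  have "map_poly of_rat (map_poly of_int f) = (map_poly of_int f :: rat_q poly)"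
    by (rule poly_eqI) (simp add: coeff_map_poly)
  then have x_p: "x = at_scalar qq p" by (simp add: x p_def at_scalar_def map_poly_pCons)
  have "qq ^ degree p * at_scalar qq p = at_scalar qq (reflect_poly p)"
    using assms(2) at_scalar_inverse[of p] by (simp add: x_p qbar_at_scalar)
  moreover have "at_scalar qq (Polynomial.monom 1 k) = qq ^ k" for k
    by (induction k) (simp_all add: monom_0 monom_Suc)
  ultimately have "Polynomial.monom 1 (degree p) * p = reflect_poly p"
    by (metis at_scalar_mult at_scalar_qq_eq_iff)
  moreover have "p \<noteq> 0" using nonzero x_p by auto
  ultimately have "2 * degree p \<le> degree p"
    using degree_reflect_poly_le[of p] degree_mult_eq[of "Polynomial.monom 1 (degree p)" p]
    by (simp add: degree_monom_eq)
  moreover have "degree p \<noteq> 0" using \<open>p \<noteq> 0\<close> by (auto simp: p_def)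
  ultimately show False by simp
qed

text \<open>Each \<open>q\<^sup>-\<^sup>k\<close> with \<open>k > 0\<close> is \<open>(q\<^sup>-\<^sup>k + q\<^sup>k) - q\<^sup>k\<close>.\<close>

lemma laurent_decompose:
  assumes "x \<in> Z_q_qinv"
  obtains s p where "x = s + p" "s \<in> Z_q_qinv" "qbar s = s" "p \<in> q_Z_q"
proof -
  have "\<exists>s p. y / qq ^ k = s + p \<and> s \<in> Z_q_qinv \<and> qbar s = s \<and> p \<in> q_Z_q" if "y \<in> Z_q" for y k
    using that
  proof (induction y arbitrary: k rule: Z_q_induct)
    case zero
    show ?case by (intro exI[of _ 0]) simp
  next
    case (step c y)
    show ?case
    proof (cases k)
      case 0
      then show ?thesis
        using step.hyps by (intro exI[of _ "of_int c"] exI[of _ "qq * y"])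
          (auto simp: laurent_of_int q_Z_q_def)
    next
      case (Suc m)
      obtain s p where sp: "y / qq ^ m = s + p" "s \<in> Z_q_qinv" "qbar s = s" "p \<in> q_Z_q"
        using step.IH by metis
      let ?s = "of_int c * (inverse qq ^ k + qq ^ k)" and ?p = "of_int (- c) * qq ^ k"
      have "(of_int c + qq * y) / qq ^ k = (?s + s) + (?p + p)"
        using sp(1) by (simp add: Suc field_simps)
      moreover have "?s \<in> Z_q_qinv"
        using laurent_powi[of "int k"] laurent_powi[of "- int k"]
        by (intro laurent_mult laurent_add laurent_of_int) (auto simp: power_int_minus power_inverse)
      moreover have "qbar ?s = ?s"
        by (simp add: qbar_mult qbar_add qbar_power qbar_inverse)
      moreover have "?p \<in> q_Z_q"
      proof -
        have "?p = qq * (of_int (- c) * qq ^ m)" by (simp add: Suc)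
        then show ?thesis unfolding q_Z_q_def using Z_q_mult Z_q_of_int Z_q_power by blast
      qed
      ultimately have "(of_int c + qq * y) / qq ^ k = (?s + s) + (?p + p) \<and> ?s + s \<in> Z_q_qinv
          \<and> qbar (?s + s) = ?s + s \<and> ?p + p \<in> q_Z_q"
        using sp q_Z_q_add[of ?p p] by (simp add: laurent_add qbar_add)
      then show ?thesis by blast
    qed
  qed
  then show ?thesis using assms that by (fastforce simp: Z_q_qinv_def)
qed


section \<open>Algebras over the scalars and evaluation of free algebras\<close>

text \<open>
  The calculations take place in algebras over \<open>\<rat>(q)\<close> that are types. The product of the quantum
  groups over all \<open>n\<close> is such a type, and a calculation in one of them is carried out in the product
  and then projected.
\<close>

class qalg = ring + monoid_mult +
  fixes scq :: "rat_q \<Rightarrow> 'a \<Rightarrow> 'a" (infixr "*\<^sub>q" 75)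
  assumes scq_add_right: "c *\<^sub>q (x + y) = c *\<^sub>q x + c *\<^sub>q y"
    and scq_add_left: "(c + d) *\<^sub>q x = c *\<^sub>q x + d *\<^sub>q x"
    and scq_scq: "c *\<^sub>q d *\<^sub>q x = (c * d) *\<^sub>q x"
    and scq_1 [simp]: "1 *\<^sub>q x = x"
    and scq_mult_left: "(c *\<^sub>q x) * y = c *\<^sub>q (x * y)"
    and scq_mult_right: "x * (c *\<^sub>q y) = c *\<^sub>q (x * y)"
begin

lemma scq_0_left [simp]: "0 *\<^sub>q x = 0"
  using scq_add_left[of 0 0 x] by simp

lemma scq_0_right [simp]: "c *\<^sub>q 0 = 0"
  using scq_add_right[of c 0 0] by simp

lemma scq_minus_right: "c *\<^sub>q (- x) = - (c *\<^sub>q x)"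
  using scq_add_right[of c x "- x"] by (simp add: eq_neg_iff_add_eq_0 add.commute)

lemma scq_minus_left: "(- c) *\<^sub>q x = - (c *\<^sub>q x)"
  using scq_add_left[of c "- c" x] by (simp add: eq_neg_iff_add_eq_0 add.commute)

lemma scq_diff_right: "c *\<^sub>q (x - y) = c *\<^sub>q x - c *\<^sub>q y"
  using scq_add_right[of c x "- y"] by (simp add: scq_minus_right)

lemma scq_diff_left: "(c - d) *\<^sub>q x = c *\<^sub>q x - d *\<^sub>q x"
  using scq_add_left[of c "- d" x] by (simp add: scq_minus_left)

lemma scq_cancel: "c \<noteq> 0 \<Longrightarrow> c *\<^sub>q x = c *\<^sub>q y \<Longrightarrow> x = y"
  by (metis left_inverse scq_1 scq_scq)

lemmas scq_simps = scq_add_right scq_add_left scq_scq scq_mult_left scq_mult_right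
  scq_minus_right scq_minus_left scq_diff_right scq_diff_left

end

text \<open>
  Evaluation in an algebra is needed both linearly and semilinearly with respect to
  \<open>q \<mapsto> q\<^sup>-\<^sup>1\<close>, so the scalars are twisted by an endomorphism.
\<close>

locale scalar_endo =
  fixes \<sigma> :: "rat_q \<Rightarrow> rat_q"
  assumes endo_add: "\<sigma> (x + y) = \<sigma> x + \<sigma> y"
    and endo_mult: "\<sigma> (x * y) = \<sigma> x * \<sigma> y"
    and endo_1: "\<sigma> 1 = 1"
begin

lemma endo_0: "\<sigma> 0 = 0"
  using endo_add[of 0 0] by simp

lemma endo_minus: "\<sigma> (- x) = - \<sigma> x"
  using endo_add[of x "- x"] by (simp add: endo_0 eq_neg_iff_add_eq_0 add.commute)

lemma endo_diff: "\<sigma> (x - y) = \<sigma> x - \<sigma> y"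
  using endo_add[of x "- y"] by (simp add: endo_minus)

lemma endo_inverse: "\<sigma> (inverse x) = inverse (\<sigma> x)"
proof (cases "x = 0")
  case False
  then have "\<sigma> x * \<sigma> (inverse x) = 1" by (simp flip: endo_mult add: endo_1)
  then show ?thesis by (metis inverse_unique)
qed (simp add: endo_0)

lemma endo_powi: "\<sigma> (x powi k) = \<sigma> x powi k"
proof -
  have "\<sigma> (y ^ m) = \<sigma> y ^ m" for y m
    by (induction m) (simp_all add: endo_1 endo_mult)
  then show ?thesis by (simp add: power_int_def endo_inverse)
qed

end

interpretation scalar_id: scalar_endo "\<lambda>x. x"
  by standard simp_all

interpretation scalar_bar: scalar_endo qbar
  by standard (simp_all add: qbar_add qbar_mult)


definition ev :: "(rat_q \<Rightarrow> rat_q) \<Rightarrow> ('a \<Rightarrow> 'b::qalg) \<Rightarrow> 'a free \<Rightarrow> 'b" where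
  "ev \<sigma> f x = (\<Sum>w\<in>keys x. \<sigma> (lookup x w) *\<^sub>q prod_list (map f w))"

lemma poly_mapping_sum_single:
  "(\<Sum>w\<in>keys x. single w (lookup x w)) = x"
  by (rule poly_mapping_eqI)
    (auto simp: lookup_sum lookup_single when_def in_keys_iff sum.delta)

context scalar_endo
begin

lemma ev_superset:
  assumes "finite S" "keys x \<subseteq> S"
  shows "ev \<sigma> f x = (\<Sum>w\<in>S. \<sigma> (lookup x w) *\<^sub>q prod_list (map f w))"
  unfolding ev_def using assms
  by (intro sum.mono_neutral_left) (auto simp: in_keys_iff endo_0)

lemma ev_0 [simp]: "ev \<sigma> f 0 = 0"
  by (simp add: ev_def)

lemma ev_single: "ev \<sigma> f (single w c) = \<sigma> c *\<^sub>q prod_list (map f w)"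
  by (cases "c = 0") (simp_all add: ev_def endo_0)

lemma ev_add: "ev \<sigma> f (x + y) = ev \<sigma> f x + ev \<sigma> f y"
proof -
  let ?S = "keys x \<union> keys y"
  have "keys (x + y) \<subseteq> ?S" by (rule keys_add)
  then show ?thesis
    by (simp add: ev_superset[of ?S] lookup_add endo_add scq_add_left sum.distrib)
qed

lemma ev_sum: "ev \<sigma> f (sum g S) = (\<Sum>x\<in>S. ev \<sigma> f (g x))"
  by (induction S rule: infinite_finite_induct) (simp_all add: ev_add)

lemma ev_minus: "ev \<sigma> f (- x) = - ev \<sigma> f x"
  using ev_add[of f x "- x"] by (simp add: eq_neg_iff_add_eq_0 add.commute)

lemma ev_diff: "ev \<sigma> f (x - y) = ev \<sigma> f x - ev \<sigma> f y"
  using ev_add[of f x "- y"] by (simp add: ev_minus)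

lemma ev_mult: "ev \<sigma> f (x * y) = ev \<sigma> f x * ev \<sigma> f y"
proof -
  let ?s = "\<lambda>x w. single w (lookup x w)"
  have "ev \<sigma> f (?s x u * ?s y v) = ev \<sigma> f (?s x u) * ev \<sigma> f (?s y v)" for u v
    by (simp add: mult_single ev_single endo_mult scq_simps plus_list_def mult.commute)
  then have "ev \<sigma> f (sum (?s x) (keys x) * sum (?s y) (keys y))
    = ev \<sigma> f (sum (?s x) (keys x)) * ev \<sigma> f (sum (?s y) (keys y))"
    by (simp add: sum_product ev_sum)
  then show ?thesis by (simp add: poly_mapping_sum_single)
qed

lemma ev_letter [simp]: "ev \<sigma> f (letter a) = f a"
  by (simp add: letter_def ev_single endo_1)

lemma ev_const: "ev \<sigma> f (const c) = \<sigma> c *\<^sub>q 1"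
  by (simp add: const_def ev_single)

lemma ev_1 [simp]: "ev \<sigma> f 1 = 1"
  using ev_const[of f 1] by (simp add: const_def endo_1 flip: zero_list_def)

lemma ev_prod_list: "ev \<sigma> f (prod_list xs) = prod_list (map (ev \<sigma> f) xs)"
  by (induction xs) (simp_all add: ev_mult)

lemma ev_const_mult: "ev \<sigma> f (const c * x) = \<sigma> c *\<^sub>q ev \<sigma> f x"
  by (simp add: ev_mult ev_const scq_mult_left)

lemmas ev_simps = ev_add ev_diff ev_minus ev_mult ev_const_mult ev_const

end

lemma lookup_const_mult: "lookup (const c * x) w = c * lookup x w"
  by (simp add: const_def flip: zero_list_def mult_map_scale_conv_mult) (simp add: Poly_Mapping.map.rep_eq when_def)

lemma keys_const_mult: "keys (const c * x) \<subseteq> keys x"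
  by (auto simp: in_keys_iff lookup_const_mult)

lemma single_eq_const_mult: "single w c = const c * single w 1"
  by (simp add: const_def mult_single plus_list_def)

lemma const_mult_commute: "x * const c = const c * (x :: 'a free)"
proof -
  have "single w d * const c = const c * single w d" for w :: "'a list" and d
    by (simp add: const_def mult_single plus_list_def mult.commute)
  then have "sum (\<lambda>w. single w (lookup x w)) S * const c
    = const c * sum (\<lambda>w. single w (lookup x w)) S" for S
    by (simp add: sum_distrib_left sum_distrib_right)
  from this[of "keys x"] show ?thesis by (simp add: poly_mapping_sum_single)
qed

lemma single_Nil: "single [] 1 = (1 :: 'a free)"
  by (simp flip: zero_list_def)

lemma const_simps:
  "const (a + b) = const a + (const b :: 'a free)" "const (a - b) = const a - (const b :: 'a free)"
  "const (a * b) = const a * (const b :: 'a free)" "const 0 = (0 :: 'a free)" "const 1 = (1 :: 'a free)"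
  by (simp_all add: const_def single_add single_diff mult_single plus_list_def single_Nil)

text \<open>
  The linear extension of a family: \<open>comb c x\<close> replaces every index \<open>i\<close> in \<open>x\<close> by the element \<open>c i\<close>
  of the free algebra.
\<close>

definition comb :: "('i \<Rightarrow> 'a free) \<Rightarrow> ('i \<Rightarrow>\<^sub>0 rat_q) \<Rightarrow> 'a free" where
  "comb c x = (\<Sum>i\<in>keys x. const (lookup x i) * c i)"

lemma comb_superset:
  "finite S \<Longrightarrow> keys x \<subseteq> S \<Longrightarrow> comb c x = (\<Sum>i\<in>S. const (lookup x i) * c i)"
  unfolding comb_def by (rule sum.mono_neutral_left) (auto simp: in_keys_iff const_simps)

lemma comb_add: "comb c (x + y) = comb c x + comb c y"
  using keys_add[of x y]
  by (simp add: comb_superset[of "keys x \<union> keys y"] lookup_add const_simps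
      distrib_right sum.distrib)

lemma comb_0 [simp]: "comb c 0 = 0"
  by (simp add: comb_def)

lemma comb_diff: "comb c (x - y) = comb c x - comb c y"
  using comb_add[of c "x - y" y] by simp

lemma comb_sum: "comb c (sum f S) = (\<Sum>i\<in>S. comb c (f i))"
  by (induction S rule: infinite_finite_induct) (simp_all add: comb_add)

lemma comb_single: "comb c (single i a) = const a * c i"
  by (cases "a = 0") (simp_all add: comb_def const_simps)

lemma comb_const_mult:
  fixes x :: "'a free"
  shows "comb c (const a * x) = const a * comb c x"
  using keys_const_mult[of a x]
  by (simp add: comb_superset[of "keys x"] lookup_const_mult const_simps
      sum_distrib_left mult.assoc)

lemma comb_words: "comb (\<lambda>w. single w 1) x = x"
  by (simp add: comb_def poly_mapping_sum_single flip: single_eq_const_mult)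

lemma comb_comb:
  fixes d :: "'i \<Rightarrow> 'a free"
  shows "comb c (comb d x) = comb (\<lambda>i. comb c (d i)) x"
  by (simp add: comb_def[of _ x] comb_sum comb_const_mult)

lemma comb_cong: "(\<And>i. i \<in> keys x \<Longrightarrow> c i = d i) \<Longrightarrow> comb c x = comb d x"
  by (simp add: comb_def)

lemma ev_comb: "ev (\<lambda>x. x) f (comb c x) =
    (\<Sum>i\<in>keys x. lookup x i *\<^sub>q ev (\<lambda>x. x) f (c i))"
  by (simp add: comb_def scalar_id.ev_sum scalar_id.ev_const_mult)


section \<open>Words and leading terms\<close>

lemma lex_less_irrefl [simp]: "\<not> lex_less x x"
  by (simp add: lex_less_def lexord_irreflexive irrefl_less_than)

lemma lex_less_trans: "lex_less x y \<Longrightarrow> lex_less y z \<Longrightarrow> lex_less x z"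
  unfolding lex_less_def by (erule (1) lexord_trans) (auto simp: trans_def)

lemma lex_less_linear: "lex_less x y \<or> x = y \<or> lex_less y x"
  unfolding lex_less_def by (rule lexord_linear) auto

lemma lex_less_append_left [simp]: "lex_less (u @ x) (u @ y) \<longleftrightarrow> lex_less x y"
  unfolding lex_less_def by (induction u) (auto)

lemma lex_less_append_right: "lex_less x y \<Longrightarrow> length y \<le> length x \<Longrightarrow> lex_less (x @ u) (y @ v)"
  unfolding lex_less_def by (rule lexord_sufI)

lemma lex_less_Cons [simp]: "lex_less (a # x) (b # y) \<longleftrightarrow> a < b \<or> a = b \<and> lex_less x y"
  by (simp add: lex_less_def)

lemma lex_less_Nil [simp]: "\<not> lex_less x []" "lex_less [] x \<longleftrightarrow> x \<noteq> []"
  by (auto simp: lex_less_def neq_Nil_conv)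

lemma prec_irrefl [simp]: "\<not> prec x x"
  by (simp add: prec_def)

lemma prec_trans: "prec x y \<Longrightarrow> prec y z \<Longrightarrow> prec x z"
  by (auto simp: prec_def dest: lex_less_trans)

lemma prec_linear: "prec x y \<or> x = y \<or> prec y x"
  using lex_less_linear[of x y] by (auto simp: prec_def)

lemma prec_append_left: "prec x y \<Longrightarrow> prec (u @ x) (u @ y)"
  by (auto simp: prec_def)

lemma prec_append_right: "prec x y \<Longrightarrow> prec (x @ u) (y @ u)"
  by (auto simp: prec_def intro: lex_less_append_right)

lemma words_append [simp]: "u @ v \<in> words n \<longleftrightarrow> u \<in> words n \<and> v \<in> words n"
  by (auto simp: words_def)

lemma words_Nil [simp]: "[] \<in> words n"
  by (simp add: words_def)

lemma words_Cons [simp]: "a # v \<in> words n \<longleftrightarrow> 1 \<le> a \<and> a < n \<and> v \<in> words n"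
  by (auto simp: words_def)

definition below :: "nat \<Rightarrow> word \<Rightarrow> word set" where
  "below n w = {u \<in> words n. prec u w}"

lemma finite_below [simp]: "finite (below n w)"
proof (rule finite_subset)
  show "below n w \<subseteq> {u. set u \<subseteq> {1..n-1} \<and> length u \<le> length w}"
    by (auto simp: below_def words_def prec_def in_lists_conv_set)
qed (simp add: finite_lists_length_le)

text \<open>Only finitely many words over the alphabet precede a given word.\<close>

lemma prec_induct [consumes 1, case_names less]:
  assumes "w \<in> words n"
    and "\<And>w. w \<in> words n \<Longrightarrow> (\<And>u. u \<in> words n \<Longrightarrow> prec u w \<Longrightarrow> P u) \<Longrightarrow> P w"
  shows "P w"
  using assms(1)
proof (induction "card (below n w)" arbitrary: w rule: less_induct)
  case less
  show ?case
  proof (rule assms(2)[OF less.prems])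
    fix u assume u: "u \<in> words n" "prec u w"
    then have "below n u \<subseteq> below n w" "u \<in> below n w" "u \<notin> below n u"
      by (auto simp: below_def intro: prec_trans)
    then have "below n u \<subset> below n w" by blast
    then show "P u" using less.hyps u by (simp add: psubset_card_mono)
  qed
qed

text \<open>The \<open>\<int>[q, q\<^sup>-\<^sup>1]\<close>-span of a set of words.\<close>

definition intspan :: "'a list set \<Rightarrow> 'a free set" where
  "intspan S = {x. \<forall>u\<in>keys x. u \<in> S \<and> lookup x u \<in> Z_q_qinv}"

lemma intspan_lookup: "x \<in> intspan S \<Longrightarrow> lookup x u \<in> Z_q_qinv"
  by (cases "u \<in> keys x") (auto simp: intspan_def in_keys_iff)

lemma intspan_keys: "x \<in> intspan S \<Longrightarrow> keys x \<subseteq> S"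
  by (auto simp: intspan_def)

lemma intspanI:
  "keys x \<subseteq> S \<Longrightarrow> (\<And>u. lookup x u \<in> Z_q_qinv) \<Longrightarrow> x \<in> intspan S"
  by (auto simp: intspan_def)

lemma intspan_mono: "x \<in> intspan S \<Longrightarrow> S \<subseteq> T \<Longrightarrow> x \<in> intspan T"
  by (auto simp: intspan_def)

lemma intspan_0 [simp]: "0 \<in> intspan S"
  by (simp add: intspan_def)

lemma intspan_single: "w \<in> S \<Longrightarrow> c \<in> Z_q_qinv \<Longrightarrow> single w c \<in> intspan S"
  by (simp add: intspan_def lookup_single when_def)

lemma intspan_add: "x \<in> intspan S \<Longrightarrow> y \<in> intspan S \<Longrightarrow> x + y \<in> intspan S"
  using keys_add[of x y] intspan_keys[of x S] intspan_keys[of y S]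
  by (intro intspanI) (auto simp: lookup_add intro!: laurent_add intspan_lookup)

lemma intspan_minus: "x \<in> intspan S \<Longrightarrow> - x \<in> intspan S"
  by (auto simp: intspan_def laurent_minus)

lemma intspan_diff: "x \<in> intspan S \<Longrightarrow> y \<in> intspan S \<Longrightarrow> x - y \<in> intspan S"
  using intspan_add[of x S "- y"] intspan_minus[of y S] by simp

lemma intspan_const_mult: "x \<in> intspan S \<Longrightarrow> c \<in> Z_q_qinv \<Longrightarrow> const c * x \<in> intspan S"
  using keys_const_mult[of c x]
  by (auto simp: intspan_def lookup_const_mult intro: laurent_mult)

lemma intspan_sum: "(\<And>i. i \<in> I \<Longrightarrow> f i \<in> intspan S) \<Longrightarrow> sum f I \<in> intspan S"
  by (induction I rule: infinite_finite_induct) (simp_all add: intspan_add)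

lemma intspan_mult:
  assumes "x \<in> intspan S" "y \<in> intspan T" "\<And>u v. u \<in> S \<Longrightarrow> v \<in> T \<Longrightarrow> u @ v \<in> R"
  shows "x * y \<in> intspan R"
proof -
  let ?s = "\<lambda>x w. single w (lookup x w)"
  have "sum (?s x) (keys x) * sum (?s y) (keys y) \<in> intspan R"
    using assms intspan_keys[OF assms(1)] intspan_keys[OF assms(2)]
    by (auto simp: sum_product mult_single plus_list_def
        intro!: intspan_sum intspan_single laurent_mult intspan_lookup)
  then show ?thesis by (simp add: poly_mapping_sum_single)
qed

lemma intspan_comb:
  assumes "x \<in> intspan S" "\<And>i. i \<in> S \<Longrightarrow> c i \<in> intspan T"
  shows "comb c x \<in> intspan T"
  unfolding comb_def using intspan_keys[OF assms(1)] assms(2)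
  by (intro intspan_sum intspan_const_mult intspan_lookup[OF assms(1)]) blast

definition leading :: "nat \<Rightarrow> word \<Rightarrow> nat free \<Rightarrow> bool" where
  "leading n w x \<longleftrightarrow> x - single w 1 \<in> intspan (below n w)"

lemma leading_single: "leading n w (single w 1)"
  by (simp add: leading_def)

lemma leading_below:
  assumes "leading n w x" "w \<in> words n" "prec w v"
  shows "x \<in> intspan (below n v)"
proof -
  have "x - single w 1 \<in> intspan (below n v)"
    using assms by (auto simp: leading_def below_def intro: prec_trans elim!: intspan_mono)
  moreover have "single w 1 \<in> intspan (below n v)"
    using assms by (intro intspan_single) (auto simp: below_def)
  ultimately show ?thesis using intspan_add by fastforce
qed

lemma leading_add: "leading n w x \<Longrightarrow> y \<in> intspan (below n w) \<Longrightarrow> leading n w (x + y)"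
  unfolding leading_def using intspan_add by (fastforce simp: algebra_simps)

lemma leading_diff: "leading n w x \<Longrightarrow> y \<in> intspan (below n w) \<Longrightarrow> leading n w (x - y)"
  using leading_add[of n w x "- y"] by (simp add: intspan_minus)

text \<open>The order on words is compatible with concatenation, so leading words multiply.\<close>

lemma leading_mult:
  assumes "leading n w x" "leading n v y" "w \<in> words n" "v \<in> words n"
  shows "leading n (w @ v) (x * y)"
proof -
  let ?w = "single w 1 :: nat free" and ?v = "single v 1 :: nat free"
  have eq: "x * y - single (w @ v) 1 = (x - ?w) * (y - ?v) + ?w * (y - ?v) + (x - ?w) * ?v"
    by (simp add: algebra_simps mult_single plus_list_def)
  have "?w \<in> intspan {w}" "?v \<in> intspan {v}" by (auto intro: intspan_single)
  then show ?thesis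
    unfolding leading_def eq
    using assms unfolding leading_def
    by (intro intspan_add; elim intspan_mult)
      (auto simp: below_def intro: prec_append_left prec_append_right
        prec_trans[OF prec_append_left prec_append_right])
qed

lemma intspan_below_append_left:
  assumes "x \<in> intspan (below n w)" "u \<in> words n"
  shows "single u 1 * x \<in> intspan (below n (u @ w))"
  by (rule intspan_mult[OF intspan_single[of u "{u}"] assms(1)])
    (use assms(2) in \<open>auto simp: below_def intro: prec_append_left\<close>)

lemma intspan_below_append_right:
  assumes "x \<in> intspan (below n w)" "u \<in> words n"
  shows "x * single u 1 \<in> intspan (below n (w @ u))"
  by (rule intspan_mult[OF assms(1) intspan_single[of u "{u}"]])
    (use assms(2) in \<open>auto simp: below_def intro: prec_append_right\<close>)


section \<open>Serre expressions\<close>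

text \<open>
  The quantum Serre expression; \<open>v\<close> stands for \<open>q\<close> or, after applying the bar involution to the
  scalars, for \<open>q\<^sup>-\<^sup>1\<close>.
\<close>

definition serre_q :: "rat_q \<Rightarrow> 'a::qalg \<Rightarrow> 'a \<Rightarrow> 'a" where
  "serre_q v x y = x * x * y - (v + inverse v) *\<^sub>q (x * y * x) + y * x * x"

lemma serre_q_inverse: "serre_q (inverse v) x y = serre_q v x y"
  by (simp add: serre_q_def add.commute)

lemma serre_q_scq: "serre_q v (c *\<^sub>q x) (d *\<^sub>q y) = (c * c * d) *\<^sub>q serre_q v x y"
  by (simp add: serre_q_def scq_simps algebra_simps)

text \<open>
  If \<open>x\<close>, \<open>x'\<close> and \<open>y\<close>, \<open>y'\<close> satisfy the Serre relation and the two pairs commute up to powers of \<open>v\<close>,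
  then the mixed terms of the Serre expression of the sums cancel, up to the defect \<open>w\<close>. With
  \<open>w = 0\<close> this shows that the coproduct respects the Serre relations. With \<open>x = F\<^sub>i\<close> and
  \<open>y = v\<^sup>-\<^sup>1 E\<^sub>i K\<^sub>i\<^sup>-\<^sup>1\<close> the defect comes from the commutator of \<open>E\<^sub>i\<close> and \<open>F\<^sub>i\<close> and produces the
  right hand side of the relation between the \<open>B\<^sub>i\<close>.
\<close>

lemma serre_q_sum:
  fixes x y x' y' w :: "'a::qalg"
  assumes v: "v \<noteq> 0"
    and yx: "y * x = (v * v) *\<^sub>q (x * y) + w"
    and yx': "y * x' = inverse v *\<^sub>q (x' * y)"
    and y'x: "y' * x = inverse v *\<^sub>q (x * y')"
    and serre: "serre_q v x x' = 0" "serre_q v y y' = 0"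
  shows "serre_q v (x + y) (x' + y') =
    w * x' - (inverse v * inverse v) *\<^sub>q (x' * w) + (y' * w - (inverse v * inverse v) *\<^sub>q (w * y'))"
proof -
  define u where "u = inverse v"
  have uv: "v * u = 1" "v * (u * c) = c" "u * v = 1" "u * (v * c) = c" for c
    using v by (simp_all add: u_def)
  have assoc: "y * (x * z) = (v * v) *\<^sub>q (x * (y * z)) + w * z"
    "y * (x' * z) = u *\<^sub>q (x' * (y * z))"
    "y' * (x * z) = u *\<^sub>q (x * (y' * z))" for z
    by (simp_all add: mult.assoc[symmetric] yx yx' y'x u_def distrib_right scq_mult_left)
  have split: "serre_q v (x + y) (x' + y') = serre_q v x x' + serre_q v y y'
    + (x * x * y' - (v + u) *\<^sub>q (x * y' * x) + y' * x * x)
    + (y * y * x' - (v + u) *\<^sub>q (y * x' * y) + x' * y * y)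
    + (x * y * x' + y * x * x' - (v + u) *\<^sub>q (x * x' * y + y * x' * x) + x' * x * y + x' * y * x)
    + (x * y * y' + y * x * y' - (v + u) *\<^sub>q (x * y' * y + y * y' * x) + y' * x * y + y' * y * x)"
    unfolding serre_q_def u_def[symmetric] by (simp add: algebra_simps scq_add_right)
  have "x * x * y' - (v + u) *\<^sub>q (x * y' * x) + y' * x * x = 0"
    by (simp add: mult.assoc assoc yx yx' y'x scq_simps algebra_simps uv flip: u_def)
  moreover have "y * y * x' - (v + u) *\<^sub>q (y * x' * y) + x' * y * y = 0"
    by (simp add: mult.assoc assoc yx yx' y'x scq_simps algebra_simps uv flip: u_def)
  moreover have "x * y * x' + y * x * x' - (v + u) *\<^sub>q (x * x' * y + y * x' * x) + x' * x * y + x' * y * x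
    = w * x' - (u * u) *\<^sub>q (x' * w)"
    by (simp add: mult.assoc assoc yx yx' y'x scq_simps algebra_simps uv flip: u_def)
  moreover have "x * y * y' + y * x * y' - (v + u) *\<^sub>q (x * y' * y + y * y' * x) + y' * x * y + y' * y * x
    = y' * w - (u * u) *\<^sub>q (w * y')"
    by (simp add: mult.assoc assoc yx yx' y'x scq_simps algebra_simps uv flip: u_def)
  ultimately show ?thesis using serre by (simp add: split u_def)
qed

text \<open>
  Group-like factors can be moved to the right out of a Serre expression, because all three terms
  pick up the same scalar.
\<close>

lemma serre_q_twist:
  fixes x x' k k' :: "'a::qalg"
  assumes kx: "k * x = a *\<^sub>q (x * k)" and kx': "k * x' = b *\<^sub>q (x' * k)"
    and k'x: "k' * x = b *\<^sub>q (x * k')" and kk': "k' * k = k * k'"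
  shows "serre_q v (x * k) (x' * k') = (a * b * b) *\<^sub>q (serre_q v x x' * (k * (k * k')))"
proof -
  have assoc: "k * (x * z) = a *\<^sub>q (x * (k * z))" "k * (x' * z) = b *\<^sub>q (x' * (k * z))"
    "k' * (x * z) = b *\<^sub>q (x * (k' * z))" "k' * (k * z) = k * (k' * z)" for z
    by (simp_all add: mult.assoc[symmetric] kx kx' k'x kk' scq_mult_left)
  show ?thesis
    by (simp add: serre_q_def mult.assoc assoc kx kx' k'x kk' scq_simps algebra_simps)
qed

text \<open>
  Multiplying each of the two Serre relations by the remaining letter on either side gives four
  relations. In their alternating sum all words containing \<open>b b\<close> cancel, and \<open>v + v\<^sup>-\<^sup>1\<close> times the
  identity is left.
\<close>

lemma serre_overlap:
  fixes a b c :: "'a::qalg"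
  assumes v: "v + inverse v \<noteq> 0"
    and ba: "serre_q v b a = a" and bc: "serre_q v b c = c" and ac: "a * c = c * a"
  shows "a * b * c * b = c * b * a * b + b * a * b * c - b * c * b * a"
proof -
  define t where "t = v + inverse v"
  have ac': "a * (c * z) = c * (a * z)" for z
    by (metis ac mult.assoc)
  have "t *\<^sub>q (a * b * c * b) - t *\<^sub>q (c * b * a * b + b * a * b * c - b * c * b * a)
    = (serre_q v b a - a) * c - a * (serre_q v b c - c) + c * (serre_q v b a - a) - (serre_q v b c - c) * a"
    unfolding serre_q_def t_def[symmetric]
    by (simp add: mult.assoc scq_simps algebra_simps ac ac')
  then have "t *\<^sub>q (a * b * c * b) = t *\<^sub>q (c * b * a * b + b * a * b * c - b * c * b * a)"
    by (simp add: ba bc)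
  then show ?thesis using v by (metis scq_cancel t_def)
qed

text \<open>
  The root vector \<open>e = a b - v b a\<close> satisfies with \<open>c\<close> the relation that \<open>b\<close> satisfies with \<open>c\<close>, up
  to a scalar. The factor \<open>m\<close> makes the statement iterable: the first generator may itself be a
  root vector.
\<close>

lemma serre_root_vector:
  fixes a b c :: "'a::qalg"
  assumes v: "v \<noteq> 0" "v + inverse v \<noteq> 0"
    and ab: "serre_q v a b = m *\<^sub>q b" and ba: "serre_q v b a = a"
    and bc: "serre_q v b c = c" and ac: "a * c = c * a"
  shows "serre_q v (a * b - v *\<^sub>q (b * a)) c = (- v * m) *\<^sub>q c"
proof -
  define u where "u = inverse v"
  define e where "e = a * b - v *\<^sub>q (b * a)"
  define g where "g = b * c - v *\<^sub>q (c * b)"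
  define h where "h = e * c - v *\<^sub>q (c * e)"
  have uv: "v * u = 1" "v * (u * x) = x" "u * v = 1" "u * (v * x) = x" for x
    using v by (simp_all add: u_def)
  have ac': "a * (c * z) = c * (a * z)" for z
    by (metis ac mult.assoc)
  have h: "h = a * g - v *\<^sub>q (g * a)"
    by (simp add: h_def e_def g_def mult.assoc scq_simps algebra_simps ac ac')
  have bg: "b * g - u *\<^sub>q (g * b) = c"
    using bc by (simp add: g_def serre_q_def mult.assoc scq_simps algebra_simps uv flip: u_def)
  have "a * h - u *\<^sub>q (h * a) = serre_q v a b * c - v *\<^sub>q (c * serre_q v a b)"
    by (simp add: h g_def serre_q_def mult.assoc scq_simps algebra_simps uv ac ac' flip: u_def)
  then have ah: "a * h - u *\<^sub>q (h * a) = m *\<^sub>q g"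
    by (simp add: ab g_def scq_simps mult.commute)
  \<comment> \<open>\<open>b\<close> commutes with the root vector \<open>h\<close> of \<open>a\<close>, \<open>b\<close>, \<open>c\<close>; this is the overlap identity.\<close>
  have "b * h - h * b = (v * v) *\<^sub>q (a * b * c * b - (c * b * a * b + b * a * b * c - b * c * b * a))
    - v *\<^sub>q ((serre_q v b a - a) * c - a * (serre_q v b c - c))"
    by (simp add: h g_def serre_q_def mult.assoc scq_simps algebra_simps uv ac ac' flip: u_def)
  then have bh: "b * h = h * b"
    using serre_overlap[OF v(2) ba bc ac] by (simp add: ba bc)
  have bh': "b * (h * x) = h * (b * x)" for x
    by (metis bh mult.assoc)
  have "serre_q v e c = e * h - u *\<^sub>q (h * e)"
    by (simp add: serre_q_def h_def mult.assoc scq_simps algebra_simps uv flip: u_def)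
  also have "\<dots> = (a * h - u *\<^sub>q (h * a)) * b - v *\<^sub>q (b * (a * h - u *\<^sub>q (h * a)))"
    by (simp add: e_def mult.assoc scq_simps algebra_simps uv bh bh')
  also have "\<dots> = (- v * m) *\<^sub>q (b * g - u *\<^sub>q (g * b))"
    by (simp add: ah scq_simps algebra_simps uv)
  finally show ?thesis by (simp add: bg e_def)
qed


section \<open>Actions of the quantum group\<close>

lemma root_form_commute: "root_form i j = root_form j i"
  by (auto simp: root_form_def)

text \<open>
  The defining relations of the quantum group, for a family of elements of an algebra.
\<close>

locale uq_action =
  fixes n :: nat and v :: rat_q and f :: "generator \<Rightarrow> 'a::qalg"
  assumes v: "v \<noteq> 0" "v - inverse v \<noteq> 0"
    and K_inv: "\<And>i. i \<in> {1..n-1} \<Longrightarrow> f (GenK i) * f (GenKinv i) = 1"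
      "\<And>i. i \<in> {1..n-1} \<Longrightarrow> f (GenKinv i) * f (GenK i) = 1"
    and K_K: "\<And>i j. i \<in> {1..n-1} \<Longrightarrow> j \<in> {1..n-1} \<Longrightarrow> f (GenK i) * f (GenK j) = f (GenK j) * f (GenK i)"
    and K_E_conj: "\<And>i j. i \<in> {1..n-1} \<Longrightarrow> j \<in> {1..n-1} \<Longrightarrow>
      f (GenK i) * f (GenE j) * f (GenKinv i) = v powi root_form i j *\<^sub>q f (GenE j)"
    and K_F_conj: "\<And>i j. i \<in> {1..n-1} \<Longrightarrow> j \<in> {1..n-1} \<Longrightarrow>
      f (GenK i) * f (GenF j) * f (GenKinv i) = v powi (- root_form i j) *\<^sub>q f (GenF j)"
    and E_F: "\<And>i j. i \<in> {1..n-1} \<Longrightarrow> j \<in> {1..n-1} \<Longrightarrow>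
      f (GenE i) * f (GenF j) - f (GenF j) * f (GenE i) =
      (if i = j then inverse (v - inverse v) *\<^sub>q (f (GenK i) - f (GenKinv i)) else 0)"
    and E_E: "\<And>i j. i \<in> {1..n-1} \<Longrightarrow> j \<in> {1..n-1} \<Longrightarrow> root_form i j = 0 \<Longrightarrow>
      f (GenE i) * f (GenE j) = f (GenE j) * f (GenE i)"
    and F_F: "\<And>i j. i \<in> {1..n-1} \<Longrightarrow> j \<in> {1..n-1} \<Longrightarrow> root_form i j = 0 \<Longrightarrow>
      f (GenF i) * f (GenF j) = f (GenF j) * f (GenF i)"
    and serre_E: "\<And>i j. i \<in> {1..n-1} \<Longrightarrow> j \<in> {1..n-1} \<Longrightarrow> root_form i j = -1 \<Longrightarrow>
      serre_q v (f (GenE i)) (f (GenE j)) = 0"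
    and serre_F: "\<And>i j. i \<in> {1..n-1} \<Longrightarrow> j \<in> {1..n-1} \<Longrightarrow> root_form i j = -1 \<Longrightarrow>
      serre_q v (f (GenF i)) (f (GenF j)) = 0"
begin

abbreviation "I \<equiv> {1..n-1}"
abbreviation "E i \<equiv> f (GenE i)"
abbreviation "F i \<equiv> f (GenF i)"
abbreviation "K i \<equiv> f (GenK i)"
abbreviation "K' i \<equiv> f (GenKinv i)"

lemma K_move:
  assumes i: "i \<in> I" and conj: "K i * x * K' i = c *\<^sub>q x" and c: "c \<noteq> 0"
  shows "K i * x = c *\<^sub>q (x * K i)" "K' i * x = inverse c *\<^sub>q (x * K' i)"
proof -
  have "K i * x * K' i * K i = K i * x"
    using i by (simp add: mult.assoc K_inv)
  then show "K i * x = c *\<^sub>q (x * K i)" by (simp add: conj scq_mult_left)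
  have "K' i * (K i * x * K' i) = x * K' i"
    using i by (simp add: mult.assoc[symmetric] K_inv)
  then have "x * K' i = c *\<^sub>q (K' i * x)"
    by (simp add: conj scq_mult_right)
  then show "K' i * x = inverse c *\<^sub>q (x * K' i)" using c by (simp add: scq_scq)
qed

lemma K_E: "i \<in> I \<Longrightarrow> j \<in> I \<Longrightarrow> K i * E j = v powi root_form i j *\<^sub>q (E j * K i)"
  and K'_E: "i \<in> I \<Longrightarrow> j \<in> I \<Longrightarrow> K' i * E j = v powi (- root_form i j) *\<^sub>q (E j * K' i)"
  and K_F: "i \<in> I \<Longrightarrow> j \<in> I \<Longrightarrow> K i * F j = v powi (- root_form i j) *\<^sub>q (F j * K i)"
  and K'_F: "i \<in> I \<Longrightarrow> j \<in> I \<Longrightarrow> K' i * F j = v powi root_form i j *\<^sub>q (F j * K' i)"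
  using K_move[OF _ K_E_conj[of i j]] K_move[OF _ K_F_conj[of i j]] v
  by (simp_all add: power_int_minus)

lemma K'_K: "i \<in> I \<Longrightarrow> j \<in> I \<Longrightarrow> K' i * K j = K j * K' i"
  by (metis K_K K_inv mult.assoc mult_1 mult_1_right)

lemma K'_K': "i \<in> I \<Longrightarrow> j \<in> I \<Longrightarrow> K' i * K' j = K' j * K' i"
  by (metis K'_K K_inv mult.assoc mult_1 mult_1_right)

lemma E_F_swap: "i \<in> I \<Longrightarrow> j \<in> I \<Longrightarrow> E i * F j =
    F j * E i + (if i = j then inverse (v - inverse v) *\<^sub>q (K i - K' i) else 0)"
  using E_F[of i j] by (simp add: algebra_simps)

lemma assoc_rules:
  assumes "i \<in> I" "j \<in> I"
  shows "K i * (E j * z) = v powi root_form i j *\<^sub>q (E j * (K i * z))"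
    "K' i * (E j * z) = v powi (- root_form i j) *\<^sub>q (E j * (K' i * z))"
    "K i * (F j * z) = v powi (- root_form i j) *\<^sub>q (F j * (K i * z))"
    "K' i * (F j * z) = v powi root_form i j *\<^sub>q (F j * (K' i * z))"
    "E i * (F j * z) = F j * (E i * z) + (if i = j then inverse (v - inverse v) *\<^sub>q (K i * z - K' i * z) else 0)"
    "K' i * (K j * z) = K j * (K' i * z)"
    "K i * (K' i * z) = z" "K' i * (K i * z) = z"
  using assms
  by (simp_all add: mult.assoc[symmetric] K_E K'_E K_F K'_F E_F_swap K'_K K_inv scq_mult_left distrib_right left_diff_distrib)

lemmas move_rules = K_E K'_E K_F K'_F E_F_swap K'_K K_inv assoc_rules

lemma v_cancel: "v * inverse v = 1" "v * (inverse v * c) = c"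
  "inverse v * v = 1" "inverse v * (v * c) = c"
  using v by simp_all


subsection \<open>The generators of the i-quantum group\<close>

definition B :: "nat \<Rightarrow> 'a" where
  "B i = F i + inverse v *\<^sub>q (E i * K' i)"

lemma B_commute:
  assumes "i \<in> I" "j \<in> I" "root_form i j = 0"
  shows "B i * B j = B j * B i"
proof -
  have ne: "i \<noteq> j" "j \<noteq> i" and sym: "root_form j i = 0"
    using assms(3) by (auto simp: root_form_def split: if_splits)
  have EK: "E i * (E j * z) = E j * (E i * z)" for z
    using E_E[OF assms] by (metis mult.assoc)
  show ?thesis
    using assms ne sym K'_K'[of i j]
    by (simp add: B_def mult.assoc move_rules F_F[OF assms] EK scq_simps algebra_simps)
qed

lemma B_serre:
  assumes i: "i \<in> I" and j: "j \<in> I" and ij: "root_form i j = -1"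
  shows "serre_q v (B i) (B j) = B j"
proof -
  have ne: "i \<noteq> j" "j \<noteq> i" and ji: "root_form j i = -1" and ii: "root_form i i = 2"
    using ij by (auto simp: root_form_def split: if_splits)
  define \<kappa> where "\<kappa> = inverse (v - inverse v)"
  \<comment> \<open>\<open>w\<close> is what the commutator of \<open>E\<^sub>i\<close> and \<open>F\<^sub>i\<close> contributes to \<open>Y i * F i\<close>.\<close>
  define c where "c = v * \<kappa>"
  define w where "w = c *\<^sub>q (1 - K' i * K' i)"
  define Y where "Y k = inverse v *\<^sub>q (E k * K' k)" for k
  have \<kappa>: "\<kappa> * v = 1 + \<kappa> * inverse v"
  proof -
    have "(v - inverse v) * \<kappa> = 1" using v by (simp add: \<kappa>_def)
    then show ?thesis by (simp add: algebra_simps)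
  qed
  have "c = 1 + c * (inverse v * inverse v)"
    using \<kappa> v by (simp add: c_def field_simps)
  then have c: "c *\<^sub>q x - (c * (inverse v * inverse v)) *\<^sub>q x = x" for x :: 'a
    by (metis add_diff_cancel_right' scq_1 scq_diff_left)
  have 1: "Y i * F i = (v * v) *\<^sub>q (F i * Y i) + w"
    using i ii by (simp add: Y_def w_def mult.assoc move_rules scq_simps algebra_simps c_def \<kappa>_def v_cancel
        power_int_add_1[OF disjI1] power2_eq_square)
  have 2: "Y i * F j = inverse v *\<^sub>q (F j * Y i)"
    using i j ij ne by (simp add: Y_def mult.assoc move_rules scq_simps)
  have 3: "Y j * F i = inverse v *\<^sub>q (F i * Y j)"
    using i j ji ne by (simp add: Y_def mult.assoc move_rules scq_simps)
  have "serre_q v (E i * K' i) (E j * K' j) = 0"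
    by (subst serre_q_twist[OF K'_E[OF i i] K'_E[OF i j]])
      (use i j ij ji in \<open>simp_all add: K'_E K'_K' serre_E\<close>)
  then have 4: "serre_q v (Y i) (Y j) = 0"
    by (simp add: Y_def serre_q_scq)
  have 5: "w * F j - (inverse v * inverse v) *\<^sub>q (F j * w) = c *\<^sub>q F j - (c * (inverse v * inverse v)) *\<^sub>q F j"
    using i j ij by (simp add: w_def mult.assoc move_rules scq_simps algebra_simps v_cancel)
  have KK: "K' j * (K' i * z) = K' i * (K' j * z)" for z
    using K'_K'[OF i j] by (metis mult.assoc)
  have 6: "Y j * w - (inverse v * inverse v) *\<^sub>q (w * Y j) = c *\<^sub>q Y j - (c * (inverse v * inverse v)) *\<^sub>q Y j"
    using i j ij by (simp add: Y_def w_def mult.assoc move_rules scq_simps algebra_simps v_cancel K'_K'[of j i] KK)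
  have "serre_q v (F i + Y i) (F j + Y j) = F j + Y j"
    using serre_q_sum[OF v(1) 1 2 3 serre_F[OF i j ij] 4] by (simp add: 5 6 c)
  then show ?thesis by (simp add: B_def Y_def)
qed


subsection \<open>The symmetry behind the bar involution\<close>

definition swap :: "generator \<Rightarrow> 'a" where
  "swap g = (case g of GenE i \<Rightarrow> inverse v *\<^sub>q (F i * K i) | GenF i \<Rightarrow> inverse v *\<^sub>q (E i * K' i)
     | GenK i \<Rightarrow> K i | GenKinv i \<Rightarrow> K' i)"

text \<open>
  The defining relations with \<open>v\<^sup>-\<^sup>1\<close> instead of \<open>v\<close> hold after this exchange of \<open>E\<close> and \<open>F\<close>. It
  exchanges the two summands of \<open>B\<^sub>i\<close> once the scalar \<open>v\<close> is also replaced by \<open>v\<^sup>-\<^sup>1\<close>.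
\<close>

lemma swap_action: "uq_action n (inverse v) swap"
proof
  show "inverse v \<noteq> 0" "inverse v - inverse (inverse v) \<noteq> 0"
    using v by auto
next
  fix i j assume i: "i \<in> I" and j: "j \<in> I"
  show "swap (GenK i) * swap (GenE j) * swap (GenKinv i) = inverse v powi root_form i j *\<^sub>q swap (GenE j)"
    using i j by (simp add: swap_def mult.assoc move_rules scq_simps power_int_minus power_int_inverse
        K_K[of i j] mult.commute)
  show "swap (GenK i) * swap (GenF j) * swap (GenKinv i) = inverse v powi (- root_form i j) *\<^sub>q swap (GenF j)"
    using i j by (simp add: swap_def mult.assoc move_rules scq_simps power_int_minus power_int_inverse
        K'_K'[of j i] mult.commute)
  show "swap (GenE i) * swap (GenF j) - swap (GenF j) * swap (GenE i) =
      (if i = j then inverse (inverse v - inverse (inverse v)) *\<^sub>q (swap (GenK i) - swap (GenKinv i)) else 0)"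
  proof (cases "i = j")
    case True
    have "inverse (inverse v - v) = - inverse (v - inverse v)"
      by (simp flip: inverse_minus_eq)
    then show ?thesis
      using j True by (simp add: swap_def mult.assoc move_rules scq_simps algebra_simps v_cancel
          root_form_def power2_eq_square)
  next
    case False
    then show ?thesis
      using i j root_form_commute[of i j]
      by (simp add: swap_def mult.assoc move_rules scq_simps K'_K)
  qed
next
  fix i j assume i: "i \<in> I" and j: "j \<in> I" and ij: "root_form i j = 0"
  have ji: "root_form j i = 0" using ij root_form_commute by metis
  have EE: "E i * (E j * z) = E j * (E i * z)" and FF: "F i * (F j * z) = F j * (F i * z)" for z
    using E_E[OF i j ij] F_F[OF i j ij] by (metis mult.assoc)+
  show "swap (GenE i) * swap (GenE j) = swap (GenE j) * swap (GenE i)"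
    using i j ij ji by (simp add: swap_def mult.assoc move_rules scq_simps FF K_K)
  show "swap (GenF i) * swap (GenF j) = swap (GenF j) * swap (GenF i)"
    using i j ij ji by (simp add: swap_def mult.assoc move_rules scq_simps EE K'_K'[of i j])
next
  fix i j assume i: "i \<in> I" and j: "j \<in> I" and ij: "root_form i j = -1"
  have ji: "root_form j i = -1" using ij root_form_commute by metis
  have "serre_q v (E i * K' i) (E j * K' j) = 0"
    by (subst serre_q_twist[OF K'_E[OF i i] K'_E[OF i j]])
      (use i j ij ji in \<open>simp_all add: K'_E K'_K' serre_E\<close>)
  then show "serre_q (inverse v) (swap (GenF i)) (swap (GenF j)) = 0"
    by (simp add: swap_def serre_q_scq serre_q_inverse)
  have "serre_q v (F i * K i) (F j * K j) = 0"
    by (subst serre_q_twist[OF K_F[OF i i] K_F[OF i j]])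
      (use i j ij ji in \<open>simp_all add: K_F K_K serre_F\<close>)
  then show "serre_q (inverse v) (swap (GenE i)) (swap (GenE j)) = 0"
    by (simp add: swap_def serre_q_scq serre_q_inverse)
qed (simp_all add: swap_def K_inv K_K)

end


subsection \<open>Coproduct\<close>

definition counit :: "generator \<Rightarrow> 'a::qalg" where
  "counit x = (case x of GenE i \<Rightarrow> 0 | GenF i \<Rightarrow> 0 | GenK i \<Rightarrow> 1 | GenKinv i \<Rightarrow> 1)"

lemma counit_action: "v \<noteq> 0 \<Longrightarrow> v - inverse v \<noteq> 0 \<Longrightarrow> uq_action n v counit"
  by standard (simp_all add: counit_def serre_q_def)

definition coprod :: "(generator \<Rightarrow> 'a::qalg) \<Rightarrow> (generator \<Rightarrow> 'a) \<Rightarrow> generator \<Rightarrow> 'a" where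
  "coprod f g x = (case x of
     GenE i \<Rightarrow> f (GenE i) + f (GenK i) * g (GenE i)
   | GenF i \<Rightarrow> f (GenF i) * g (GenKinv i) + g (GenF i)
   | GenK i \<Rightarrow> f (GenK i) * g (GenK i)
   | GenKinv i \<Rightarrow> f (GenKinv i) * g (GenKinv i))"

text \<open>
  The tensor product of two representations, phrased in a single algebra that contains both as
  commuting families.
\<close>

lemma coprod_action:
  assumes f: "uq_action n v f" and g: "uq_action n v g"
    and comm: "\<And>x y. g y * f x = f x * g y"
  shows "uq_action n v (coprod f g)"
proof -
  interpret f: uq_action n v f by (fact f)
  interpret g: uq_action n v g by (fact g)
  have comm': "g y * (f x * z) = f x * (g y * z)" for x y z
    by (metis comm mult.assoc)
  note [simp] = mult.assoc comm comm' scq_simps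
  have KK: "f (GenK i) * (f (GenK j) * z) = f (GenK j) * (f (GenK i) * z)"
    "g (GenKinv j) * (g (GenKinv i) * z) = g (GenKinv i) * (g (GenKinv j) * z)"
    if "i \<in> {1..n-1}" "j \<in> {1..n-1}" for i j z
    using f.K_K[OF that] g.K'_K'[OF that] by (metis mult.assoc)+
  have EE: "g (GenE i) * (g (GenE j) * z) = g (GenE j) * (g (GenE i) * z)"
    "f (GenE i) * (f (GenE j) * z) = f (GenE j) * (f (GenE i) * z)"
    "g (GenF i) * (g (GenF j) * z) = g (GenF j) * (g (GenF i) * z)"
    "f (GenF i) * (f (GenF j) * z) = f (GenF j) * (f (GenF i) * z)"
    if "i \<in> {1..n-1}" "j \<in> {1..n-1}" "root_form i j = 0" for i j z
    using g.E_E[OF that] f.E_E[OF that] g.F_F[OF that] f.F_F[OF that] by (metis mult.assoc)+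
  show ?thesis
  proof
    show "v \<noteq> 0" "v - inverse v \<noteq> 0" by (fact f.v)+
  next
    fix i j assume i: "i \<in> {1..n-1}" and j: "j \<in> {1..n-1}"
    show "coprod f g (GenK i) * coprod f g (GenK j) = coprod f g (GenK j) * coprod f g (GenK i)"
      using i j f.K_K[of i j] g.K_K[of i j] by (simp add: coprod_def) (simp flip: mult.assoc)
    show "coprod f g (GenK i) * coprod f g (GenE j) * coprod f g (GenKinv i)
      = v powi root_form i j *\<^sub>q coprod f g (GenE j)"
      using i j by (simp add: coprod_def KK(1)[OF i j] f.move_rules g.move_rules algebra_simps)
    show "coprod f g (GenK i) * coprod f g (GenF j) * coprod f g (GenKinv i)
      = v powi (- root_form i j) *\<^sub>q coprod f g (GenF j)"
      using i j by (simp add: coprod_def g.K'_K'[OF j i] KK(2)[OF i j] f.move_rules g.move_rules algebra_simps)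
    show "coprod f g (GenE i) * coprod f g (GenF j) - coprod f g (GenF j) * coprod f g (GenE i) =
      (if i = j then inverse (v - inverse v) *\<^sub>q (coprod f g (GenK i) - coprod f g (GenKinv i)) else 0)"
      using i j by (simp add: coprod_def f.move_rules g.move_rules algebra_simps root_form_commute[of i j])
  next
    fix i j assume i: "i \<in> {1..n-1}" and j: "j \<in> {1..n-1}" and ij: "root_form i j = 0"
    have ji: "root_form j i = 0" using ij root_form_commute by metis
    show "coprod f g (GenE i) * coprod f g (GenE j) = coprod f g (GenE j) * coprod f g (GenE i)"
      using i j ij ji by (simp add: coprod_def f.move_rules g.move_rules algebra_simps
          f.E_E[OF i j] g.E_E[OF i j] KK(1)[OF i j] EE)
    show "coprod f g (GenF i) * coprod f g (GenF j) = coprod f g (GenF j) * coprod f g (GenF i)"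
      using i j ij ji by (simp add: coprod_def f.move_rules g.move_rules algebra_simps
          f.F_F[OF i j] g.F_F[OF i j] g.K'_K'[OF i j] EE)
  next
    fix i j assume i: "i \<in> {1..n-1}" and j: "j \<in> {1..n-1}" and ij: "root_form i j = -1"
    have ji: "root_form j i = -1" and ii: "root_form i i = 2" using ij root_form_commute
      by (metis, simp add: root_form_def)
    have "serre_q v (g (GenE i) * f (GenK i)) (g (GenE j) * f (GenK j)) = 0"
      by (subst serre_q_twist[of _ _ 1 _ 1]) (use i j ij in \<open>simp_all add: f.K_K g.serre_E\<close>)
    then have "serre_q v (f (GenK i) * g (GenE i)) (f (GenK j) * g (GenE j)) = 0" by simp
    then show "serre_q v (coprod f g (GenE i)) (coprod f g (GenE j)) = 0"
      unfolding coprod_def generator.case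
      by (subst serre_q_sum[where w = 0])
        (use i j ij ji ii in \<open>simp_all add: f.v f.serre_E f.move_rules power_int_minus power2_eq_square\<close>)
    have "serre_q v (f (GenF i) * g (GenKinv i)) (f (GenF j) * g (GenKinv j)) = 0"
      by (subst serre_q_twist[of _ _ 1 _ 1]) (use i j ij in \<open>simp_all add: g.K'_K' f.serre_F\<close>)
    then have "serre_q v (g (GenF i) + f (GenF i) * g (GenKinv i)) (g (GenF j) + f (GenF j) * g (GenKinv j)) = 0"
      by (subst serre_q_sum[where w = 0])
        (use i j ij ji ii in \<open>simp_all add: f.v g.serre_F g.move_rules power_int_minus power2_eq_square\<close>)
    then show "serre_q v (coprod f g (GenF i)) (coprod f g (GenF j)) = 0"
      by (simp add: coprod_def add.commute)
  qed (simp_all add: coprod_def f.move_rules g.move_rules)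
qed


section \<open>Normal words span integrally\<close>

text \<open>A pair \<open>(i, j)\<close> stands for the interval \<open>i (i+1) \<dots> (j-1)\<close>.\<close>

definition interval_word :: "(nat \<times> nat) list \<Rightarrow> word" where
  "interval_word L = concat (map (\<lambda>(i, j). [i..<j]) L)"

text \<open>On intervals this is the lexicographic order of the corresponding words.\<close>

definition interval_ge :: "nat \<times> nat \<Rightarrow> nat \<times> nat \<Rightarrow> bool" where
  "interval_ge p r \<longleftrightarrow> fst r < fst p \<or> fst r = fst p \<and> snd r \<le> snd p"

definition normal_intervals :: "nat \<Rightarrow> (nat \<times> nat) list \<Rightarrow> bool" where
  "normal_intervals n L \<longleftrightarrow>
     (\<forall>(i, j) \<in> set L. 1 \<le> i \<and> i < j \<and> j \<le> n) \<and> sorted_wrt interval_ge L"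

definition normal_words :: "nat \<Rightarrow> word set" where
  "normal_words n = interval_word ` {L. normal_intervals n L}"

lemma interval_ge_trans: "interval_ge p r \<Longrightarrow> interval_ge r s \<Longrightarrow> interval_ge p s"
  by (auto simp: interval_ge_def)

lemma interval_word_simps [simp]:
  "interval_word [] = []"
  "interval_word ((i, j) # L) = [i..<j] @ interval_word L"
  "interval_word (L @ L') = interval_word L @ interval_word L'"
  by (simp_all add: interval_word_def)

lemma normal_intervals_Nil [simp]: "normal_intervals n []"
  by (simp add: normal_intervals_def)

lemma normal_intervals_Cons:
  "normal_intervals n ((i, j) # L) \<longleftrightarrow>
     1 \<le> i \<and> i < j \<and> j \<le> n \<and> normal_intervals n L \<and> (L = [] \<or> interval_ge (i, j) (hd L))"
  by (cases L) (auto simp: normal_intervals_def intro: interval_ge_trans)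

lemma words_upt [simp]: "1 \<le> i \<Longrightarrow> j \<le> n \<Longrightarrow> [i..<j] \<in> words n"
  by (auto simp: words_def)

lemma normal_in_words: "w \<in> normal_words n \<Longrightarrow> w \<in> words n"
proof -
  have "interval_word L \<in> words n" if "normal_intervals n L" for L
    using that by (induction L) (auto simp: normal_intervals_Cons)
  then show "w \<in> normal_words n \<Longrightarrow> w \<in> words n" by (auto simp: normal_words_def)
qed

lemma Nil_normal [simp]: "[] \<in> normal_words n"
  unfolding normal_words_def by (rule image_eqI[of _ _ "[]"]) auto

text \<open>The root vector of the interval from \<open>i\<close> to \<open>i + k\<close>.\<close>

fun root_vector :: "nat \<Rightarrow> nat \<Rightarrow> nat free" where
  "root_vector i 0 = letter i"
| "root_vector i (Suc k) = root_vector i k * letter (i + k + 1)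
     - const qq * (letter (i + k + 1) * root_vector i k)"

lemma leading_letter: "leading n [a] (letter a)"
  by (simp add: letter_def leading_single)

lemma leading_root_vector:
  assumes "1 \<le> i" "i + k < n"
  shows "leading n [i..<i + k + 1] (root_vector i k)"
  using assms(2)
proof (induction k)
  case (Suc k)
  let ?w = "[i..<i + k + 1]" and ?c = "i + k + 1"
  have IH: "leading n ?w (root_vector i k)" using Suc by simp
  have w: "?w \<in> words n" "[?c] \<in> words n" using assms Suc.prems by auto
  have "prec ([?c] @ ?w) (?w @ [?c])"
    by (simp add: prec_def upt_conv_Cons del: upt_Suc)
  then have "letter ?c * root_vector i k \<in> intspan (below n (?w @ [?c]))"
    using leading_below[OF leading_mult[OF leading_letter IH w(2,1)]] w by simp
  then have "leading n (?w @ [?c]) (root_vector i k * letter ?c - const qq * (letter ?c * root_vector i k))"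
    by (intro leading_diff leading_mult IH leading_letter w intspan_const_mult laurent_qq)
  then show ?case by simp
qed (simp add: leading_letter)

lemma serre_q_commute:
  fixes a b c :: "'a::qalg"
  assumes ac: "a * c = c * a"
  shows "serre_q v c (a * b - s *\<^sub>q (b * a)) = a * serre_q v c b - s *\<^sub>q (serre_q v c b * a)"
proof -
  have ac': "a * (c * z) = c * (a * z)" for z
    by (metis ac mult.assoc)
  show ?thesis
    by (simp add: serre_q_def mult.assoc scq_simps algebra_simps ac ac')
qed

locale iserre_algebra =
  fixes n :: nat and b :: "nat \<Rightarrow> 'a::qalg"
  assumes far_commute: "\<And>i j. i \<in> {1..n-1} \<Longrightarrow> j \<in> {1..n-1} \<Longrightarrow> root_form i j = 0 \<Longrightarrow> b i * b j = b j * b i"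
    and serre: "\<And>i j. i \<in> {1..n-1} \<Longrightarrow> j \<in> {1..n-1} \<Longrightarrow> root_form i j = -1 \<Longrightarrow> serre_q qq (b i) (b j) = b j"
begin

abbreviation \<Lambda> :: "nat free \<Rightarrow> 'a" where "\<Lambda> \<equiv> ev (\<lambda>x. x) b"

definition reducible :: "word \<Rightarrow> bool" where
  "reducible w \<longleftrightarrow> (\<exists>x\<in>intspan (below n w). \<Lambda> (single w 1) = \<Lambda> x)"

text \<open>
  A relation with leading coefficient 1 expresses its leading word by smaller ones integrally.
\<close>

lemma reducibleI:
  assumes "leading n w x" "\<Lambda> x = 0"
  shows "reducible w"
proof -
  have "single w 1 - x \<in> intspan (below n w)"
    using intspan_minus[OF assms(1)[unfolded leading_def]] by simp
  moreover have "\<Lambda> (single w 1) = \<Lambda> (single w 1 - x)"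
    by (simp add: scalar_id.ev_diff assms(2))
  ultimately show ?thesis by (auto simp: reducible_def)
qed

lemma reducible_append:
  assumes "reducible w" "u \<in> words n" "v \<in> words n"
  shows "reducible (u @ w @ v)"
proof -
  obtain x where x: "x \<in> intspan (below n w)" "\<Lambda> (single w 1) = \<Lambda> x"
    using assms(1) by (auto simp: reducible_def)
  let ?y = "single u 1 * (x * single v 1)"
  have "single (u @ w @ v) 1
    = single u 1 * (single w 1 * single v (1 :: rat_q))"
    by (simp add: mult_single plus_list_def)
  then have "\<Lambda> (single (u @ w @ v) 1) = \<Lambda> ?y"
    by (simp add: scalar_id.ev_mult x(2))
  moreover have "?y \<in> intspan (below n (u @ w @ v))"
    by (intro intspan_below_append_left intspan_below_append_right x assms)
  ultimately show ?thesis by (auto simp: reducible_def)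
qed

text \<open>
  The three statements are proved together by induction on the length of the interval: prolonging it
  by one letter needs the relations of the shorter root vector with that letter, and that it commutes
  with all later letters.
\<close>

lemma b_root_vector:
  assumes i: "1 \<le> i" and k: "i + k < n"
  shows root_vector_far: "i + k + 2 \<le> c \<Longrightarrow> c < n \<Longrightarrow>
      \<Lambda> (root_vector i k) * b c = b c * \<Lambda> (root_vector i k)"
    and root_vector_serre: "i + k + 1 < n \<Longrightarrow>
      serre_q qq (b (i + k + 1)) (\<Lambda> (root_vector i k)) = \<Lambda> (root_vector i k)"
    and serre_root_vector: "i + k + 1 < n \<Longrightarrow>
      \<exists>m\<in>Z_q_qinv. serre_q qq (\<Lambda> (root_vector i k)) (b (i + k + 1)) = m *\<^sub>q b (i + k + 1)"
  using k
proof (induction k arbitrary: c)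
  case 0
  {
    case 1 then show ?case using i by (simp add: far_commute root_form_def)
  next
    case 2 then show ?case using i serre[of "i + 1" i] by (simp add: root_form_def)
  next
    case 3 then show ?case using i serre[of i "i + 1"] by (intro bexI[of _ 1]) (simp_all add: root_form_def)
  }
next
  case (Suc k)
  define a where "a = \<Lambda> (root_vector i k)"
  have e: "\<Lambda> (root_vector i (Suc k)) = a * b (i + k + 1) - qq *\<^sub>q (b (i + k + 1) * a)"
    by (simp add: scalar_id.ev_simps scq_mult_left a_def)
  {
    case 1
    have "a * b c = b c * a" "b (i + k + 1) * b c = b c * b (i + k + 1)"
      using Suc.IH(1)[of c] 1 i by (simp_all add: a_def far_commute root_form_def)
    then have "a * (b c * z) = b c * (a * z)" "b (i + k + 1) * (b c * z) = b c * (b (i + k + 1) * z)"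
      "a * b c = b c * a" "b (i + k + 1) * b c = b c * b (i + k + 1)" for z
      by (metis mult.assoc)+
    then show ?case by (simp only: e left_diff_distrib right_diff_distrib scq_mult_left scq_mult_right mult.assoc)
  next
    case 2
    then have "serre_q qq (b (i + Suc k + 1)) (b (i + k + 1)) = b (i + k + 1)"
      using i by (intro serre) (auto simp: root_form_def)
    moreover have "a * b (i + Suc k + 1) = b (i + Suc k + 1) * a"
      using Suc.IH(1)[of "i + Suc k + 1"] 2 by (simp add: a_def)
    ultimately show ?case unfolding e by (subst serre_q_commute) simp_all
  next
    case 3
    obtain m where m: "m \<in> Z_q_qinv" "serre_q qq a (b (i + k + 1)) = m *\<^sub>q b (i + k + 1)"
      using Suc.IH(3) 3 by (auto simp: a_def)
    have "serre_q qq (b (i + k + 1)) a = a"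
      using Suc.IH(2) 3 by (simp add: a_def)
    moreover have "serre_q qq (b (i + k + 1)) (b (i + Suc k + 1)) = b (i + Suc k + 1)"
      using i 3 by (intro serre) (auto simp: root_form_def)
    moreover have "a * b (i + Suc k + 1) = b (i + Suc k + 1) * a"
      using Suc.IH(1)[of "i + Suc k + 1"] 3 by (simp add: a_def)
    ultimately have "serre_q qq (a * b (i + k + 1) - qq *\<^sub>q (b (i + k + 1) * a)) (b (i + Suc k + 1))
        = (- qq * m) *\<^sub>q b (i + Suc k + 1)"
      by (intro Submission.serre_root_vector m(2) qq_nonzero qq_plus_inverse_nonzero)
    moreover have "- qq * m \<in> Z_q_qinv"
      using laurent_mult[OF laurent_minus[OF laurent_qq] m(1)] .
    ultimately show ?case unfolding e by blast
  }
qed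

text \<open>
  Let \<open>e\<close> be the root vector of \<open>i \<dots> (j-1)\<close> and \<open>c = j\<close>. The word in question is the leading word
  of \<open>e e c\<close>. The leading words of the other terms \<open>e c e\<close> and \<open>c e e\<close> of the relation between \<open>e\<close>
  and \<open>c\<close> have \<open>c\<close> in a place where the word in question has the smaller letter \<open>i\<close>.
\<close>

lemma reducible_repeat:
  assumes "1 \<le> i" "i < j" "j < n"
  shows "reducible ([i..<j] @ [i..<j + 1])"
proof -
  obtain k where j: "j = i + k + 1" using assms(2) less_iff_Suc_add by auto
  let ?e = "root_vector i k" and ?c = "letter j" and ?w = "[i..<j]"
  let ?ww = "[i..<j] @ [i..<j + 1]"
  obtain m where m: "m \<in> Z_q_qinv" "serre_q qq (\<Lambda> ?e) (b j) = m *\<^sub>q b j"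
    using serre_root_vector[of i k] assms by (auto simp: j)
  let ?x = "?e * (?e * ?c) - const (qq + inverse qq) * (?e * (?c * ?e)) + ?c * (?e * ?e) - const m * ?c"
  have w: "?w \<in> words n" "[j] \<in> words n" using assms by auto
  have lead: "leading n ?w ?e" "leading n [j] ?c"
    using leading_root_vector[of i k n] assms by (simp_all add: j leading_letter del: upt_Suc)
  have upt: "[i..<j + 1] = [i..<j] @ [j]" using assms by simp
  have "leading n ?ww (?e * (?e * ?c))"
    unfolding upt using leading_mult[OF lead(1) leading_mult[OF lead w]] w by simp
  moreover have "?e * (?c * ?e) \<in> intspan (below n ?ww)"
    by (rule leading_below[OF leading_mult[OF lead(1) leading_mult[OF lead(2,1)]]])
      (use w assms in \<open>simp_all add: prec_def upt upt_conv_Cons del: upt_Suc\<close>)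
  moreover have "?c * (?e * ?e) \<in> intspan (below n ?ww)"
    by (rule leading_below[OF leading_mult[OF lead(2) leading_mult[OF lead(1,1)]]])
      (use w assms in \<open>simp_all add: prec_def upt upt_conv_Cons del: upt_Suc\<close>)
  moreover have "?c \<in> intspan (below n ?ww)"
    by (rule leading_below[OF lead(2)]) (use w assms in \<open>auto simp: prec_def upt simp del: upt_Suc\<close>)
  ultimately have "leading n ?ww ?x"
    by (intro leading_diff leading_add intspan_const_mult m laurent_add) simp_all
  moreover have "\<Lambda> ?x = 0"
    using m(2) by (simp add: scalar_id.ev_simps scq_mult_left serre_q_def mult.assoc)
  ultimately show ?thesis by (rule reducibleI)
qed

lemma \<Lambda>_single: "\<Lambda> (single w c) = c *\<^sub>q prod_list (map b w)"
  by (simp add: scalar_id.ev_single)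

lemma reducible_far:
  assumes "1 \<le> a" "a + 2 \<le> k" "k < n"
  shows "reducible [a, k]"
proof (rule reducibleI)
  show "leading n [a, k] (single [a, k] 1 - single [k, a] 1)"
    using assms by (intro leading_diff leading_single intspan_single) (auto simp: below_def prec_def)
  show "\<Lambda> (single [a, k] 1 - single [k, a] 1) = 0"
    using assms far_commute[of a k] by (simp add: scalar_id.ev_diff \<Lambda>_single root_form_def)
qed

lemma commute_interval:
  assumes "1 \<le> a" "a + 2 \<le> k" "l \<le> n"
  shows "prod_list (map b [k..<l]) * b a = b a * prod_list (map b [k..<l])"
  using assms(3)
proof (induction l)
  case (Suc l)
  show ?case
  proof (cases "k \<le> l")
    case True
    then have "b l * b a = b a * b l"
      using assms Suc.prems by (intro far_commute) (auto simp: root_form_def)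
    then show ?thesis
      using Suc True by simp (metis mult.assoc)
  qed simp
qed simp

text \<open>
  The letter \<open>a + 1\<close> commutes with the letters from \<open>a + 3\<close> on. Moving it to the left of them leaves
  \<open>a (a+1) (a+2) (a+1)\<close>, to which \<open>serre_overlap\<close> applies. For an interval of length two the word
  leads the Serre relation itself.
\<close>

lemma reducible_inner:
  assumes a: "1 \<le> a" "a + 1 < l" "l \<le> n"
  shows "reducible ([a..<l] @ [a + 1])"
proof (cases "l = a + 2")
  case True
  let ?c = "a + 1"
  let ?x = "single [a, ?c, ?c] 1 - const (qq + inverse qq) * single [?c, a, ?c] 1
    + single [?c, ?c, a] 1 - single [a] 1"
  have "leading n [a, ?c, ?c] ?x"
    using a True by (intro leading_diff leading_add leading_single intspan_const_mult intspan_single laurent_add)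
      (auto simp: below_def prec_def)
  moreover have "serre_q qq (b ?c) (b a) = b a"
    using a True by (intro serre) (auto simp: root_form_def)
  then have "\<Lambda> ?x = 0"
    by (simp add: scalar_id.ev_simps scq_mult_left \<Lambda>_single serre_q_def mult.assoc algebra_simps)
  moreover have "[a..<l] @ [a + 1] = [a, ?c, ?c]"
    using True by (simp add: upt_conv_Cons)
  ultimately show ?thesis using reducibleI by simp
next
  case False
  let ?b = "a + 1" and ?c = "a + 2" and ?u = "[a + 3..<l]"
  have l: "[a..<l] = a # ?b # ?c # ?u" "a + 3 \<le> l"
    using False a by (simp_all add: upt_conv_Cons numeral_3_eq_3)
  let ?s = "\<lambda>w. single w (1 :: rat_q)"
  let ?x = "?s ([a..<l] @ [?b]) - (?s ([?c, ?b, a, ?b] @ ?u) + ?s ([?b, a, ?b, ?c] @ ?u) - ?s ([?b, ?c, ?b, a] @ ?u))"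
  have u: "?u \<in> words n" using a by (auto simp: words_def)
  have "leading n ([a..<l] @ [?b]) ?x"
    using a l(2) u unfolding l(1)
    by (intro leading_diff leading_single intspan_add intspan_diff intspan_single)
      (auto simp: below_def prec_def simp del: upt_Suc)
  moreover have "\<Lambda> ?x = 0"
  proof -
    define P where "P = prod_list (map b ?u)"
    have P: "P * b (Suc a) = b (Suc a) * P"
      using commute_interval[of ?b "a + 3" l] a l(2) by (simp add: P_def)
    have "serre_q qq (b ?b) (b a) = b a" "serre_q qq (b ?b) (b ?c) = b ?c" "b a * b ?c = b ?c * b a"
      using a l(2) by (auto intro!: serre far_commute simp: root_form_def)
    then have "b a * b ?b * b ?c * b ?b
        = b ?c * b ?b * b a * b ?b + b ?b * b a * b ?b * b ?c - b ?b * b ?c * b ?b * b a"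
      by (rule serre_overlap[OF qq_plus_inverse_nonzero])
    then have "b a * b ?b * b ?c * b ?b * P
        = (b ?c * b ?b * b a * b ?b + b ?b * b a * b ?b * b ?c - b ?b * b ?c * b ?b * b a) * P"
      by (rule arg_cong)
    then show ?thesis
      unfolding l(1) by (simp add: scalar_id.ev_diff scalar_id.ev_add \<Lambda>_single P mult.assoc
          distrib_right left_diff_distrib flip: P_def del: upt_Suc)
  qed
  ultimately show ?thesis by (rule reducibleI)
qed

text \<open>
  Induction on the word, adding a letter \<open>a\<close> in front of a normal word whose first interval starts in
  \<open>k\<close>. Either \<open>a\<close> forms a new interval or prolongs the first one, and the result is normal, or one of
  the three patterns appears at the front.
\<close>

lemma normal_or_reducible: "w \<in> words n \<Longrightarrow> w \<in> normal_words n \<or> reducible w"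
proof (induction w)
  case (Cons a w)
  have a: "1 \<le> a" "a < n" and w: "w \<in> words n" using Cons.prems by auto
  have red_pre: "reducible (a # w)" if "reducible (a # u)" "w = u @ v" for u v
    using reducible_append[OF that(1), of "[]" v] that(2) w by simp
  show ?case
  proof (cases "reducible w")
    case True
    then show ?thesis using reducible_append[of w "[a]" "[]"] a by simp
  next
    case False
    then obtain L where L: "w = interval_word L" "normal_intervals n L"
      using Cons w by (auto simp: normal_words_def)
    show ?thesis
    proof (cases L)
      case Nil
      then have "a # w = interval_word [(a, a + 1)]" "normal_intervals n [(a, a + 1)]"
        using L a by (auto simp: normal_intervals_Cons)
      then show ?thesis unfolding normal_words_def by blast
    next
      case (Cons p L')
      obtain k l where p: "p = (k, l)" by force
      have kl: "1 \<le> k" "k < l" "l \<le> n" and L': "normal_intervals n L'" "L' = [] \<or> interval_ge (k, l) (hd L')"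
        using L Cons p by (auto simp: normal_intervals_Cons)
      have w_eq: "w = [k..<l] @ interval_word L'" using L Cons p by simp
      consider (extend) "k = a + 1" | (far) "k \<ge> a + 2" | (repeat) "k = a" "l > a + 1"
        | (new) "interval_ge (a, a + 1) (k, l)"
        using kl by (fastforce simp: interval_ge_def)
      then show ?thesis
      proof cases
        case far
        then show ?thesis
          using reducible_far[of a k] red_pre[of "[k]" "[k + 1..<l] @ interval_word L'"] a kl w_eq
          by (simp add: upt_conv_Cons)
      next
        case repeat
        then show ?thesis
          using reducible_repeat[of a "a + 1"] red_pre[of "[a, a + 1]" "[a + 2..<l] @ interval_word L'"] a kl w_eq
          by (simp add: upt_conv_Cons)
      next
        case new
        then have "a # w = interval_word ((a, a + 1) # L)" "normal_intervals n ((a, a + 1) # L)"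
          using L a Cons p by (auto simp: normal_intervals_Cons)
        then show ?thesis unfolding normal_words_def by blast
      next
        case extend
        have aw: "a # w = [a..<l] @ interval_word L'"
          using extend kl w_eq by (simp add: upt_conv_Cons)
        show ?thesis
        proof (cases "L' = [] \<or> interval_ge (a, l) (hd L')")
          case True
          then have "a # w = interval_word ((a, l) # L')" "normal_intervals n ((a, l) # L')"
            using L' a kl extend aw by (auto simp: normal_intervals_Cons)
          then show ?thesis unfolding normal_words_def by blast
        next
          case False
          then obtain k2 l2 L2 where L2: "L' = (k2, l2) # L2" by (metis list.exhaust surj_pair)
          have kl2: "1 \<le> k2" "k2 < l2" "l2 \<le> n" using L' L2 by (auto simp: normal_intervals_Cons)
          consider "k2 = a + 1" | "k2 = a" "l < l2"
            using False L'(2) L2 extend by (auto simp: interval_ge_def)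
          then show ?thesis
          proof cases
            case 1
            have "a # w = [] @ ([a..<l] @ [a + 1]) @ ([a + 2..<l2] @ interval_word L2)"
              using 1 kl2 L2 aw by (simp add: upt_conv_Cons)
            moreover have "reducible ([a..<l] @ [a + 1])"
              using a kl extend by (intro reducible_inner) auto
            ultimately show ?thesis
              using reducible_append[of "[a..<l] @ [a + 1]" "[]" "[a + 2..<l2] @ interval_word L2"]
                Cons.prems by (metis words_append)
          next
            case 2
            have "[a..<l2] = [a..<l + 1] @ [l + 1..<l2]"
              using 2 kl extend upt_add_eq_append[of a "l + 1" "l2 - (l + 1)"] by simp
            then have eq: "a # w = [] @ ([a..<l] @ [a..<l + 1]) @ ([l + 1..<l2] @ interval_word L2)"
              using 2 L2 aw by simp
            moreover have "reducible ([a..<l] @ [a..<l + 1])"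
              using a kl extend 2 kl2 by (intro reducible_repeat) auto
            ultimately show ?thesis
              using reducible_append[of "[a..<l] @ [a..<l + 1]" "[]" "[l + 1..<l2] @ interval_word L2"]
                Cons.prems by (metis words_append)
          qed
        qed
      qed
    qed
  qed
qed simp

text \<open>Replacing reducible words by smaller ones ends in normal words, by induction along \<open>prec\<close>.\<close>

lemma normal_span:
  assumes "w \<in> words n"
  shows "\<exists>x\<in>intspan {g \<in> normal_words n. prec_eq g w}. \<Lambda> (single w 1) = \<Lambda> x"
  using assms
proof (induction w rule: prec_induct)
  case (less w)
  show ?case
  proof (cases "w \<in> normal_words n")
    case True
    then show ?thesis by (intro bexI[of _ "single w 1"] intspan_single) auto
  next
    case False
    then obtain x where x: "x \<in> intspan (below n w)" "\<Lambda> (single w 1) = \<Lambda> x"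
      using normal_or_reducible[OF less.hyps] by (auto simp: reducible_def)
    have "\<forall>u\<in>below n w. \<exists>y\<in>intspan {g \<in> normal_words n. prec_eq g w}. \<Lambda> (single u 1) = \<Lambda> y"
    proof
      fix u assume u: "u \<in> below n w"
      then have u: "u \<in> words n" "prec u w" by (simp_all add: below_def)
      obtain y where y: "y \<in> intspan {g \<in> normal_words n. prec_eq g u}" "\<Lambda> (single u 1) = \<Lambda> y"
        using less.IH[OF u] by (elim bexE)
      have "{g \<in> normal_words n. prec_eq g u} \<subseteq> {g \<in> normal_words n. prec_eq g w}"
        using prec_trans[of _ u w] \<open>prec u w\<close> by auto
      from y(2) intspan_mono[OF y(1) this]
      show "\<exists>y\<in>intspan {g \<in> normal_words n. prec_eq g w}. \<Lambda> (single u 1) = \<Lambda> y"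
        by (rule bexI)
    qed
    from bchoice[OF this[unfolded Bex_def]] obtain y where "\<forall>u\<in>below n w.
        y u \<in> intspan {g \<in> normal_words n. prec_eq g w} \<and> \<Lambda> (single u 1) = \<Lambda> (y u)"
      by (elim exE)
    then have y: "\<And>u. u \<in> below n w \<Longrightarrow> y u \<in> intspan {g \<in> normal_words n. prec_eq g w}"
      "\<And>u. u \<in> below n w \<Longrightarrow> \<Lambda> (single u 1) = \<Lambda> (y u)"
      by simp_all
    have "\<Lambda> (single w 1) = \<Lambda> (comb (\<lambda>u. single u 1) x)"
      by (simp only: x(2) comb_words)
    also have "\<dots> = \<Lambda> (comb y x)"
      unfolding ev_comb using intspan_keys[OF x(1)] y(2)
      by (intro sum.cong arg_cong2[of _ _ _ _ scq] refl) blast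
    finally have "\<Lambda> (single w 1) = \<Lambda> (comb y x)" .
    moreover have "comb y x \<in> intspan {g \<in> normal_words n. prec_eq g w}"
      using x(1) y(1) by (rule intspan_comb)
    ultimately show ?thesis by (rule bexI)
  qed
qed

end


section \<open>A representation separating the normal words\<close>

text \<open>
  Linear operators on functions of configurations. A configuration assigns to the \<open>k\<close>-th tensor
  factor, a slot, the index of a basis vector. Configurations have infinitely many slots, so that
  all tensor powers live in one algebra of operators.
\<close>

typedef qop = "{T :: ((nat \<Rightarrow> nat) \<Rightarrow> rat_q) \<Rightarrow> ((nat \<Rightarrow> nat) \<Rightarrow> rat_q).
    \<forall>a x y. T (\<lambda>t. a * x t + y t) = (\<lambda>t. a * T x t + T y t)}"
  morphisms app Qop
  by (rule exI[of _ id]) simp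

lemma qop_eqI: "(\<And>x t. app S x t = app T x t) \<Longrightarrow> S = T"
  by (metis app_inject ext)

instantiation qop :: qalg
begin

definition zero_qop :: qop where "zero_qop = Qop (\<lambda>x t. 0)"
definition one_qop :: qop where "one_qop = Qop (\<lambda>x. x)"
definition plus_qop :: "qop \<Rightarrow> qop \<Rightarrow> qop" where "S + T = Qop (\<lambda>x t. app S x t + app T x t)"
definition minus_qop :: "qop \<Rightarrow> qop \<Rightarrow> qop" where "S - T = Qop (\<lambda>x t. app S x t - app T x t)"
definition uminus_qop :: "qop \<Rightarrow> qop" where "- T = Qop (\<lambda>x t. - app T x t)"
definition times_qop :: "qop \<Rightarrow> qop \<Rightarrow> qop" where "S * T = Qop (\<lambda>x. app S (app T x))"
definition scq_qop :: "rat_q \<Rightarrow> qop \<Rightarrow> qop" where "c *\<^sub>q T = Qop (\<lambda>x t. c * app T x t)"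

lemma app_linear: "app R (\<lambda>t. a * x t + y t) = (\<lambda>t. a * app R x t + app R y t)"
  using app[of R] by simp

lemma app_simps [simp]:
  "app 0 x t = 0" "app 1 x = x"
  "app (S + T) x t = app S x t + app T x t"
  "app (S - T) x t = app S x t - app T x t"
  "app (- T) x t = - app T x t"
  "app (S * T) x = app S (app T x)"
  "app (c *\<^sub>q T) x t = c * app T x t"
  unfolding zero_qop_def one_qop_def plus_qop_def minus_qop_def uminus_qop_def times_qop_def scq_qop_def
  by (subst Qop_inverse; simp add: app_linear; simp add: algebra_simps)+

instance
proof
  fix R S T :: qop and c :: rat_q
  have add: "app R (\<lambda>t. x t + y t) = (\<lambda>t. app R x t + app R y t)" for x y
    using app_linear[of R 1 x y] by simp
  have "app R (\<lambda>t. 0) = (\<lambda>t. 0)"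
    using app_linear[of R "-1" "\<lambda>t. 0" "\<lambda>t. 0"] by simp
  then have mult: "app R (\<lambda>t. a * x t) = (\<lambda>t. a * app R x t)" for a x
    using app_linear[of R a x "\<lambda>t. 0"] by simp
  have plus_fun: "app (S + T) x = (\<lambda>t. app S x t + app T x t)" for x
    by (rule ext) simp
  have scq_fun: "app (c *\<^sub>q S) x = (\<lambda>t. c * app S x t)" for x
    by (rule ext) simp
  show "R * (S + T) = R * S + R * T"
    by (rule qop_eqI) (simp add: add plus_fun)
  show "R * (c *\<^sub>q S) = c *\<^sub>q (R * S)"
    by (rule qop_eqI) (simp add: mult scq_fun)
qed (rule qop_eqI; simp add: algebra_simps)+

end

definition slot_weight :: "nat \<Rightarrow> nat \<Rightarrow> rat_q" where
  "slot_weight a i = (if a = i then qq else if a = i + 1 then inverse qq else 1)"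

lemma slot_weight_pos: "slot_weight a i > 0"
  by (simp add: slot_weight_def)

text \<open>
  The vector representation in slot \<open>k\<close>, acting on coefficient functions: \<open>E\<^sub>i\<close> sends the basis vector
  \<open>i + 1\<close> to \<open>i\<close>, so the new coefficient at \<open>t\<close> is the old one at \<open>t(k := i + 1)\<close>.
\<close>

definition slot_E :: "nat \<Rightarrow> nat \<Rightarrow> qop" where
  "slot_E k i = Qop (\<lambda>x t. if t k = i then x (t(k := i + 1)) else 0)"
definition slot_F :: "nat \<Rightarrow> nat \<Rightarrow> qop" where
  "slot_F k i = Qop (\<lambda>x t. if t k = i + 1 then x (t(k := i)) else 0)"
definition slot_K :: "nat \<Rightarrow> nat \<Rightarrow> qop" where
  "slot_K k i = Qop (\<lambda>x t. slot_weight (t k) i * x t)"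
definition slot_Kinv :: "nat \<Rightarrow> nat \<Rightarrow> qop" where
  "slot_Kinv k i = Qop (\<lambda>x t. inverse (slot_weight (t k) i) * x t)"

lemma slot_app:
  "app (slot_E k i) x t = (if t k = i then x (t(k := i + 1)) else 0)"
  "app (slot_F k i) x t = (if t k = i + 1 then x (t(k := i)) else 0)"
  "app (slot_K k i) x t = slot_weight (t k) i * x t"
  "app (slot_Kinv k i) x t = inverse (slot_weight (t k) i) * x t"
  unfolding slot_E_def slot_F_def slot_K_def slot_Kinv_def
  by (subst Qop_inverse; auto simp: algebra_simps)+

definition slot :: "nat \<Rightarrow> generator \<Rightarrow> qop" where
  "slot k g = (case g of GenE i \<Rightarrow> slot_E k i | GenF i \<Rightarrow> slot_F k i
     | GenK i \<Rightarrow> slot_K k i | GenKinv i \<Rightarrow> slot_Kinv k i)"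

lemma slot_weight_nonzero [simp]: "slot_weight a i \<noteq> 0"
  using slot_weight_pos[of a i] by simp

lemma fun_upd_same [simp]: "t k = a \<Longrightarrow> t(k := a) = t"
  by auto

lemma qq_neq_inverse [simp]: "qq \<noteq> inverse qq"
  using qq_minus_inverse_nonzero by simp

lemma slot_action: "uq_action n qq (slot k)"
proof
  fix i j :: nat
  show "qq \<noteq> 0" "qq - inverse qq \<noteq> 0" by (simp_all add: qq_minus_inverse_nonzero)
  show "slot k (GenK i) * slot k (GenKinv i) = 1" "slot k (GenKinv i) * slot k (GenK i) = 1"
    by (rule qop_eqI; simp add: slot_def slot_app)+
  show "slot k (GenK i) * slot k (GenK j) = slot k (GenK j) * slot k (GenK i)"
    by (rule qop_eqI) (simp add: slot_def slot_app)
  show "slot k (GenK i) * slot k (GenE j) * slot k (GenKinv i) = qq powi root_form i j *\<^sub>q slot k (GenE j)"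
    by (rule qop_eqI) (simp add: slot_def slot_app slot_weight_def root_form_def power2_eq_square)
  show "slot k (GenK i) * slot k (GenF j) * slot k (GenKinv i) = qq powi (- root_form i j) *\<^sub>q slot k (GenF j)"
    by (rule qop_eqI) (simp add: slot_def slot_app slot_weight_def root_form_def power2_eq_square power_int_minus)
  show "slot k (GenE i) * slot k (GenF j) - slot k (GenF j) * slot k (GenE i) =
      (if i = j then inverse (qq - inverse qq) *\<^sub>q (slot k (GenK i) - slot k (GenKinv i)) else 0)"
    using qq_minus_inverse_nonzero
    by (intro qop_eqI) (auto simp: slot_def slot_app slot_weight_def field_simps)
  show "slot k (GenE i) * slot k (GenE j) = slot k (GenE j) * slot k (GenE i)" 
    "slot k (GenF i) * slot k (GenF j) = slot k (GenF j) * slot k (GenF i)" if "root_form i j = 0"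
    using that by (intro qop_eqI; auto simp: slot_def slot_app root_form_def split: if_splits)+
  show "serre_q qq (slot k (GenE i)) (slot k (GenE j)) = 0"
    "serre_q qq (slot k (GenF i)) (slot k (GenF j)) = 0" if "root_form i j = -1"
    using that by (intro qop_eqI; auto simp: serre_q_def slot_def slot_app root_form_def split: if_splits)+
qed

lemma slot_commute: "k \<noteq> l \<Longrightarrow> slot k x * slot l y = slot l y * slot k x"
  by (rule qop_eqI) (auto simp: slot_def slot_app fun_upd_twist split: generator.splits)

primrec rep :: "nat \<Rightarrow> generator \<Rightarrow> qop" where
  "rep 0 = counit"
| "rep (Suc m) = coprod (rep m) (slot m)"

lemma rep_slot_commute: "m \<le> k \<Longrightarrow> slot k y * rep m x = rep m x * slot k y"
proof (induction m arbitrary: x)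
  case (Suc m)
  then have IH: "slot k y * rep m x = rep m x * slot k y"
    "slot k y * (rep m x * z) = rep m x * (slot k y * z)" for x z
    by (simp, metis Suc.IH Suc.prems Suc_leD mult.assoc)
  have "slot k y * slot m x = slot m x * slot k y"
    "slot k y * (slot m x * z) = slot m x * (slot k y * z)" for x z
    using slot_commute[of k m] Suc.prems by (simp, metis mult.assoc Suc_n_not_le_n)
  with IH show ?case by (auto simp: coprod_def algebra_simps split: generator.split)
qed (auto simp: counit_def split: generator.split)

lemma rep_action: "uq_action n qq (rep m)"
proof (induction m)
  case 0
  show ?case by (simp add: counit_action)
next
  case (Suc m)
  then show ?case using coprod_action[OF _ slot_action] by (simp add: rep_slot_commute)
qed

text \<open>
  The next lemmas record which matrix entries of the generators occur and that these are positive,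
  which rules out cancellation in products.
\<close>

lemma rep_K_diagonal:
  assumes "g = GenK i \<or> g = GenKinv i"
  shows "\<exists>c. (\<forall>t. c t > 0) \<and> (\<forall>x t. app (rep m g) x t = c t * x t)"
  using assms
proof (induction m arbitrary: g)
  case 0
  then show ?case by (intro exI[of _ "\<lambda>_. 1"]) (auto simp: counit_def)
next
  case (Suc m)
  obtain c where c: "\<And>t. c t > 0" "\<And>x t. app (rep m g) x t = c t * x t"
    using Suc by blast
  let ?d = "\<lambda>t. if g = GenK i then slot_weight (t m) i else inverse (slot_weight (t m) i)"
  have "app (rep (Suc m) g) x t = (c t * ?d t) * x t" for x t
    using Suc.prems c(2) by (auto simp: coprod_def slot_def slot_app)
  moreover have "c t * ?d t > 0" for t
    using c(1) slot_weight_pos by (simp add: positive_imp_inverse_positive)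
  ultimately show ?case by (intro exI[of _ "\<lambda>t. c t * ?d t"]) blast
qed

lemma rep_E_shape:
  "\<exists>c. (\<forall>k t. c k t > 0) \<and> (\<forall>x t. app (rep m (GenE i)) x t =
    (\<Sum>k<m. if t k = i then c k t * x (t(k := i + 1)) else 0))"
proof (induction m)
  case (Suc m)
  then obtain c where c: "\<And>k t. c k t > 0" "\<And>x t. app (rep m (GenE i)) x t =
    (\<Sum>k<m. if t k = i then c k t * x (t(k := i + 1)) else 0)" by blast
  obtain d where d: "\<And>t. d t > 0" "\<And>x t. app (rep m (GenK i)) x t = d t * x t"
    using rep_K_diagonal by blast
  have "app (rep (Suc m) (GenE i)) x t =
    (\<Sum>k<Suc m. if t k = i then (c(m := d)) k t * x (t(k := i + 1)) else 0)" for x t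
    using c(2) d(2) by (auto simp: coprod_def slot_def slot_app intro!: sum.cong)
  moreover have "(c(m := d)) k t > 0" for k t using c d by simp
  ultimately show ?case by blast
qed (auto simp: counit_def intro: exI[of _ "\<lambda>_ _. 1"])

lemma rep_F_shape:
  "\<exists>c. (\<forall>k t. c k t > 0) \<and> (\<forall>x t. app (rep m (GenF i)) x t =
    (\<Sum>k<m. if t k = i + 1 then c k t * x (t(k := i)) else 0))"
proof (induction m)
  case (Suc m)
  then obtain c where c: "\<And>k t. c k t > 0" "\<And>x t. app (rep m (GenF i)) x t =
    (\<Sum>k<m. if t k = i + 1 then c k t * x (t(k := i)) else 0)" by blast
  let ?d = "\<lambda>k t. if k = m then 1 else c k t * inverse (slot_weight (t m) i)"
  have "app (rep (Suc m) (GenF i)) x t =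
    (\<Sum>k<Suc m. if t k = i + 1 then ?d k t * x (t(k := i)) else 0)" for x t
    using c(2) by (auto simp: coprod_def slot_def slot_app intro!: sum.cong)
  moreover have "?d k t > 0" for k t
    using c slot_weight_pos by (simp add: positive_imp_inverse_positive)
  ultimately show ?case by (intro exI[of _ ?d]) blast
qed (auto simp: counit_def intro: exI[of _ "\<lambda>_ _. 1"])

definition rep_B :: "nat \<Rightarrow> nat \<Rightarrow> qop" where
  "rep_B m i = rep m (GenF i) + inverse qq *\<^sub>q (rep m (GenE i) * rep m (GenKinv i))"

lemma rep_B_shape:
  "\<exists>c. (\<forall>k t. c k t > 0) \<and> (\<forall>x t. app (rep_B m i) x t =
    (\<Sum>k<m. if t k = i then c k t * x (t(k := i + 1))
             else if t k = i + 1 then c k t * x (t(k := i)) else 0))"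
proof -
  obtain c where c: "\<And>k t. c k t > 0" "\<And>x t. app (rep m (GenE i)) x t =
    (\<Sum>k<m. if t k = i then c k t * x (t(k := i + 1)) else 0)" using rep_E_shape by blast
  obtain d where d: "\<And>k t. d k t > 0" "\<And>x t. app (rep m (GenF i)) x t =
    (\<Sum>k<m. if t k = i + 1 then d k t * x (t(k := i)) else 0)" using rep_F_shape by blast
  obtain e where e: "\<And>t. e t > 0" "\<And>x t. app (rep m (GenKinv i)) x t = e t * x t"
    using rep_K_diagonal by blast
  let ?c = "\<lambda>k t. if t k = i then inverse qq * c k t * e (t(k := i + 1)) else d k t"
  have "app (rep_B m i) x t = (\<Sum>k<m. if t k = i then ?c k t * x (t(k := i + 1))
             else if t k = i + 1 then ?c k t * x (t(k := i)) else 0)" for x t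
    by (auto simp: rep_B_def app_simps c d e sum_distrib_left algebra_simps
        simp flip: sum.distrib intro!: sum.cong)
  moreover have "?c k t > 0" for k t
    using c d e by (simp add: positive_imp_inverse_positive)
  ultimately show ?thesis by (intro exI[of _ ?c]) blast
qed


subsection \<open>Matrix entries of words\<close>

text \<open>
  \<open>reach m w t u\<close>: reading \<open>w\<close> from the left, each letter \<open>i\<close> moves one of the first \<open>m\<close> slots from
  \<open>i\<close> to \<open>i + 1\<close> or back, and this leads from \<open>t\<close> to \<open>u\<close>. The moves of \<open>climb\<close> are upwards only; a
  climb exhibits \<open>w\<close> as a shuffle of the intervals from \<open>t k\<close> to \<open>u k\<close>.
\<close>

primrec reach :: "nat \<Rightarrow> word \<Rightarrow> (nat \<Rightarrow> nat) \<Rightarrow> (nat \<Rightarrow> nat) \<Rightarrow> bool" where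
  "reach m [] t u \<longleftrightarrow> t = u"
| "reach m (i # w) t u \<longleftrightarrow> (\<exists>k<m. t k = i \<and> reach m w (t(k := i + 1)) u
      \<or> t k = i + 1 \<and> reach m w (t(k := i)) u)"

primrec climb :: "nat \<Rightarrow> word \<Rightarrow> (nat \<Rightarrow> nat) \<Rightarrow> (nat \<Rightarrow> nat) \<Rightarrow> bool" where
  "climb m [] t u \<longleftrightarrow> t = u"
| "climb m (i # w) t u \<longleftrightarrow> (\<exists>k<m. t k = i \<and> climb m w (t(k := i + 1)) u)"

text \<open>The coefficient at \<open>t\<close> of the image of the basis vector \<open>u\<close> under the word \<open>w\<close>.\<close>

definition entry :: "nat \<Rightarrow> word \<Rightarrow> (nat \<Rightarrow> nat) \<Rightarrow> (nat \<Rightarrow> nat) \<Rightarrow> rat_q" where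
  "entry m w t u = app (prod_list (map (rep_B m) w)) (\<lambda>s. if s = u then 1 else 0) t"

lemma sum_pos_iff_ex:
  fixes f :: "nat \<Rightarrow> 'b::linordered_field"
  assumes "\<And>k. f k \<ge> 0"
  shows "(\<Sum>k<m. f k) > 0 \<longleftrightarrow> (\<exists>k<m. f k > 0)"
proof -
  have "(\<Sum>k<m. f k) = 0 \<longleftrightarrow> (\<forall>k<m. f k = 0)"
    using assms by (subst sum_nonneg_eq_0_iff) auto
  moreover have "(\<Sum>k<m. f k) \<ge> 0" using assms by (simp add: sum_nonneg)
  ultimately show ?thesis using assms by (metis less_le)
qed

lemma entry_sign: "entry m w t u \<ge> 0 \<and> (entry m w t u > 0 \<longleftrightarrow> reach m w t u)"
proof (induction w arbitrary: t)
  case (Cons i w)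
  obtain c where c: "\<And>k t. c k t > 0" "\<And>x t. app (rep_B m i) x t =
    (\<Sum>k<m. if t k = i then c k t * x (t(k := i + 1))
             else if t k = i + 1 then c k t * x (t(k := i)) else 0)" using rep_B_shape by blast
  let ?s = "\<lambda>k. if t k = i then c k t * entry m w (t(k := i + 1)) u
             else if t k = i + 1 then c k t * entry m w (t(k := i)) u else 0"
  have entry: "entry m (i # w) t u = (\<Sum>k<m. ?s k)"
    by (simp add: entry_def app_simps c(2) cong: if_cong)
  have s: "?s k \<ge> 0" for k
    using Cons.IH c(1) by (simp add: less_imp_le)
  have "(\<Sum>k<m. ?s k) > 0 \<longleftrightarrow> (\<exists>k<m. ?s k > 0)"
    by (rule sum_pos_iff_ex) (rule s)
  moreover have "?s k > 0 \<longleftrightarrow> t k = i \<and> reach m w (t(k := i + 1)) u \<or> t k = i + 1 \<and> reach m w (t(k := i)) u" for k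
    using Cons.IH mult_less_cancel_left_pos[OF c(1), of _ _ 0] by (simp del: fun_upd_apply)
  ultimately show ?case
    unfolding entry using s by (auto intro: sum_nonneg)
qed (auto simp: entry_def app_simps)

lemma climb_reach: "climb m w t u \<Longrightarrow> reach m w t u"
  by (induction w arbitrary: t) auto

lemma sum_fun_upd:
  fixes t :: "nat \<Rightarrow> nat"
  shows "k < m \<Longrightarrow> (\<Sum>l<m. (t(k := a)) l) + t k = (\<Sum>l<m. t l) + a"
proof -
  assume k: "k < m"
  have "(\<Sum>l<m. (t(k := a)) l) = (t(k := a)) k + (\<Sum>l\<in>{..<m} - {k}. (t(k := a)) l)"
    using k by (intro sum.remove) auto
  also have "(\<Sum>l\<in>{..<m} - {k}. (t(k := a)) l) = (\<Sum>l\<in>{..<m} - {k}. t l)"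
    by (intro sum.cong) auto
  finally show ?thesis
    using k sum.remove[of "{..<m}" k t] by simp
qed

lemma climb_sum: "climb m w t u \<Longrightarrow> (\<Sum>k<m. u k) = (\<Sum>k<m. t k) + length w"
proof (induction w arbitrary: t)
  case (Cons i w)
  then obtain k where k: "k < m" "t k = i" "climb m w (t(k := i + 1)) u" by auto
  show ?case using Cons.IH[OF k(3)] sum_fun_upd[OF k(1), of t "i + 1"] k(2) by (simp del: fun_upd_apply)
qed simp

text \<open>
  The sum of the slots grows by at most one per letter, with equality only if all moves go up.
\<close>

lemma reach_sum:
  "reach m w t u \<Longrightarrow> (\<Sum>k<m. u k) \<le> (\<Sum>k<m. t k) + length w
     \<and> ((\<Sum>k<m. u k) = (\<Sum>k<m. t k) + length w \<longrightarrow> climb m w t u)"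
proof (induction w arbitrary: t)
  case (Cons i w)
  then obtain k where k: "k < m" "t k = i \<and> reach m w (t(k := i + 1)) u
    \<or> t k = i + 1 \<and> reach m w (t(k := i)) u" by auto
  from k(2) show ?case
  proof
    assume up: "t k = i \<and> reach m w (t(k := i + 1)) u"
    have sum: "(\<Sum>l<m. (t(k := i + 1)) l) = (\<Sum>l<m. t l) + 1"
      using sum_fun_upd[OF k(1), of t "i + 1"] up by (simp del: fun_upd_apply)
    show ?thesis
      using Cons.IH[OF conjunct2[OF up]] k(1) up unfolding sum by (auto simp del: fun_upd_apply)
  next
    assume down: "t k = i + 1 \<and> reach m w (t(k := i)) u"
    have sum: "(\<Sum>l<m. (t(k := i)) l) + 1 = (\<Sum>l<m. t l)"
      using sum_fun_upd[OF k(1), of t i] down by (simp del: fun_upd_apply)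
    show ?thesis
      using Cons.IH[OF conjunct2[OF down]] sum by (auto simp del: fun_upd_apply)
  qed
qed simp

lemma climb_le: "climb m w t u \<Longrightarrow> t k \<le> u k"
proof (induction w arbitrary: t)
  case (Cons i w)
  then obtain l where l: "t l = i" "climb m w (t(l := i + 1)) u" by auto
  show ?case using Cons.IH[OF l(2)] l(1) by (cases "k = l") auto
qed simp

text \<open>The intervals that the slots still have to climb; slots that have arrived are left out.\<close>

definition state_intervals :: "nat \<Rightarrow> (nat \<Rightarrow> nat) \<Rightarrow> (nat \<Rightarrow> nat) \<Rightarrow> (nat \<times> nat) multiset" where
  "state_intervals m t u =
     filter_mset (\<lambda>(c, d). c < d) (image_mset (\<lambda>k. (t k, u k)) (mset_set {..<m}))"

text \<open>
  A shuffle of intervals is at most their decreasing product. The first letter of the shuffle starts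
  one of the intervals. If another interval starts with a larger letter, the product is larger at
  once. Otherwise the rest of the chosen interval becomes the first in the decreasing order, and
  the induction hypothesis compares the rest of the shuffle with the resulting product; it remains to
  see that choosing a shorter interval before a longer one does not pay.
\<close>

lemma climb_le_interval_word:
  assumes "climb m w t u" "mset L = state_intervals m t u" "sorted_wrt interval_ge L"
  shows "w = interval_word L \<or> lex_less w (interval_word L)"
  using assms
proof (induction w arbitrary: t L)
  case Nil
  then have "mset L = {#}" by (auto simp: state_intervals_def simp flip: set_mset_eq_empty_iff)
  then show ?case by simp
next
  case (Cons i w)
  then obtain k where k: "k < m" "t k = i" "climb m w (t(k := i + 1)) u" by auto
  define d where "d = u k"
  have d: "i < d" using climb_le[OF k(3), of k] by (simp add: d_def)
  define R where "R = filter_mset (\<lambda>(c, d). c < d) (image_mset (\<lambda>k. (t k, u k)) (mset_set ({..<m} - {k})))"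
  have split: "mset_set {..<m} = add_mset k (mset_set ({..<m} - {k}))"
    using k(1) by (simp add: mset_set.remove)
  have old: "state_intervals m t u = add_mset (i, d) R"
    using k(2) d by (simp add: state_intervals_def split R_def d_def)
  have "image_mset (\<lambda>l. ((t(k := i + 1)) l, u l)) (mset_set ({..<m} - {k}))
    = image_mset (\<lambda>l. (t l, u l)) (mset_set ({..<m} - {k}))"
    by (intro image_mset_cong) auto
  then have new: "state_intervals m (t(k := i + 1)) u = (if i + 1 < d then {#(i + 1, d)#} else {#}) + R"
    by (simp add: state_intervals_def split R_def d_def)
  have "(i, d) \<in> set L" using Cons.prems(2) old by (metis set_mset_mset union_single_eq_member)
  then obtain L1 L2 where L: "L = L1 @ (i, d) # L2" by (meson split_list)
  have R: "mset (L1 @ L2) = R" using Cons.prems(2) old by (simp add: L)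
  have lt: "c < e" if "(c, e) \<in> set L" for c e
  proof -
    have "(c, e) \<in># state_intervals m t u" using that Cons.prems(2) by (metis set_mset_mset)
    then show ?thesis by (auto simp: state_intervals_def)
  qed
  have sorted: "sorted_wrt interval_ge (L1 @ L2)" "\<And>p. p \<in> set L1 \<Longrightarrow> interval_ge p (i, d)"
    "\<And>p. p \<in> set L2 \<Longrightarrow> interval_ge (i, d) p"
    using Cons.prems(3) by (auto simp: L sorted_wrt_append)
  show ?case
  proof (cases "L1 \<noteq> [] \<and> fst (hd L1) \<noteq> i")
    case True
    then obtain i1 d1 L3 where L1: "L1 = (i1, d1) # L3" "i1 \<noteq> i" by (cases L1) auto
    then have "i < i1" "i1 < d1"
      using sorted(2)[of "(i1, d1)"] lt[of i1 d1] by (auto simp: L interval_ge_def)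
    then show ?thesis by (simp add: L L1 upt_conv_Cons)
  next
    case False
    have le: "fst p \<le> i" if "p \<in> set (L1 @ L2)" for p
    proof (cases L1)
      case Nil
      then show ?thesis using that sorted(3)[of p] by (auto simp: interval_ge_def)
    next
      case (Cons r L3)
      then have "fst r = i" using False by simp
      moreover have "p = r \<or> interval_ge r p" using that sorted(1) Cons by auto
      ultimately show ?thesis by (auto simp: interval_ge_def)
    qed
    let ?L = "(if i + 1 < d then [(i + 1, d)] else []) @ L1 @ L2"
    have "sorted_wrt interval_ge ?L"
      using sorted(1) le by (fastforce simp: interval_ge_def)
    moreover have "mset ?L = state_intervals m (t(k := i + 1)) u"
      unfolding new using R by simp
    ultimately have "w = interval_word ?L \<or> lex_less w (interval_word ?L)"
      using Cons.IH[OF k(3)] by blast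
    moreover have "i # interval_word ?L = [i..<d] @ interval_word (L1 @ L2)"
      using d by (cases "i + 1 < d") (simp_all add: upt_conv_Cons)
    ultimately have IH: "i # w = [i..<d] @ interval_word (L1 @ L2)
        \<or> lex_less (i # w) ([i..<d] @ interval_word (L1 @ L2))"
      by (metis lex_less_Cons)
    have "[i..<d] @ interval_word (L1 @ L2) = interval_word L
        \<or> lex_less ([i..<d] @ interval_word (L1 @ L2)) (interval_word L)"
    proof (cases L1)
      case (Cons r L3)
      then obtain d1 where r: "r = (i, d1)" using False by (cases r) auto
      have "d \<le> d1" using sorted(2)[of r] Cons r by (auto simp: interval_ge_def)
      show ?thesis
      proof (cases "d = d1")
        case True
        have "p = (i, d)" if "p \<in> set L1" for p
        proof -
          have "p = r \<or> interval_ge r p" using that sorted(1) Cons by auto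
          then show ?thesis using sorted(2)[OF that] r True by (cases p) (auto simp: interval_ge_def)
        qed
        then have "L1 = replicate (length L1) (i, d)" by (simp add: replicate_length_same)
        then have "(i, d) # L1 = L1 @ [(i, d)]" by (metis replicate_app_Cons_same append.right_neutral)
        then have "interval_word ((i, d) # L1) = interval_word (L1 @ [(i, d)])" by (rule arg_cong)
        then show ?thesis by (simp add: L)
      next
        case False
        then have "d < d1" using \<open>d \<le> d1\<close> by simp
        then have "[i..<d1] = [i..<d] @ d # [d + 1..<d1]"
          using d upt_add_eq_append[of i d "d1 - d"] by (simp add: upt_conv_Cons)
        then have "interval_word L
            = [i..<d] @ d # ([d + 1..<d1] @ interval_word L3 @ [i..<d] @ interval_word L2)"
          by (simp add: L Cons r)
        moreover have "interval_word (L1 @ L2) = i # ([i + 1..<d1] @ interval_word L3 @ interval_word L2)"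
          using d \<open>d < d1\<close> by (simp add: Cons r upt_conv_Cons)
        ultimately show ?thesis using d by simp
      qed
    qed (simp add: L)
    then show ?thesis using IH lex_less_trans by metis
  qed
qed

lemma climb_interval:
  assumes "k < m" "t k = c" "c \<le> d" "climb m w (t(k := d)) u"
  shows "climb m ([c..<d] @ w) t u"
  using assms(2-4)
proof (induction "d - c" arbitrary: c t)
  case (Suc x)
  then have "climb m ([c + 1..<d] @ w) (t(k := c + 1)) u" by simp
  then show ?case using Suc assms(1) by (auto simp: upt_conv_Cons)
qed auto

lemma climb_interval_word:
  fixes L :: "(nat \<times> nat) list"
  defines "m \<equiv> length L"
  defines "t \<equiv> \<lambda>k. if k < m then fst (L ! k) else 0"
    and "u \<equiv> \<lambda>k. if k < m then snd (L ! k) else 0"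
  assumes le: "\<And>c d. (c, d) \<in> set L \<Longrightarrow> c \<le> d"
  shows "climb m (interval_word L) t u"
proof -
  have "climb m (interval_word (drop j L)) (\<lambda>k. if k < j then u k else t k) u" if "j \<le> m" for j
    using that
  proof (induction "m - j" arbitrary: j)
    case 0
    then have "(\<lambda>k. if k < j then u k else t k) = u" by (auto simp: t_def u_def)
    with 0 show ?case by (simp add: m_def)
  next
    case (Suc x)
    obtain c d where cd: "L ! j = (c, d)" by force
    have j: "j < m" using Suc by simp
    have "drop j L = (c, d) # drop (Suc j) L"
      using j cd by (simp add: m_def Cons_nth_drop_Suc[symmetric])
    moreover have "c \<le> d" using le[of c d] j cd by (metis m_def nth_mem)
    moreover have "(\<lambda>k. if k < Suc j then u k else t k) = (\<lambda>k. if k < j then u k else t k)(j := d)"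
      using j cd by (auto simp: u_def)
    moreover have "climb m (interval_word (drop (Suc j) L)) (\<lambda>k. if k < Suc j then u k else t k) u"
      using Suc by simp
    ultimately show ?case using j cd by (auto intro!: climb_interval simp: t_def)
  qed
  from this[of 0] show ?thesis by simp
qed

text \<open>
  Slot \<open>k\<close> starts at the left end of the \<open>k\<close>-th interval of \<open>h\<close> and has to arrive at its right end.
\<close>

theorem normal_word_separated:
  assumes "h \<in> normal_words n"
  shows "\<exists>m t u. entry m h t u \<noteq> 0 \<and> (\<forall>g. prec g h \<longrightarrow> entry m g t u = 0)"
proof -
  obtain L where L: "h = interval_word L" "normal_intervals n L"
    using assms by (auto simp: normal_words_def)
  define m where "m = length L"
  define t where "t k = (if k < m then fst (L ! k) else 0)" for k
  define u where "u k = (if k < m then snd (L ! k) else 0)" for k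
  have lt: "c < d" if "(c, d) \<in> set L" for c d
    using L(2) that by (auto simp: normal_intervals_def)
  have climb: "climb m h t u"
    unfolding L(1) m_def t_def[abs_def] u_def[abs_def] using lt
    by (intro climb_interval_word) (auto simp: less_imp_le)
  have "image_mset (\<lambda>k. (t k, u k)) (mset_set {..<m}) = image_mset ((!) L) (mset_set {..<m})"
    by (intro image_mset_cong) (auto simp: t_def u_def)
  also have "\<dots> = mset (map ((!) L) [0..<m])"
    by (simp add: atLeast0LessThan)
  also have "\<dots> = mset L" by (simp add: m_def map_nth)
  finally have "image_mset (\<lambda>k. (t k, u k)) (mset_set {..<m}) = mset L" .
  moreover have "filter (\<lambda>(c, d). c < d) L = L"
    using lt by (auto intro: filter_True)
  ultimately have state: "mset L = state_intervals m t u"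
    unfolding state_intervals_def by (metis mset_filter)
  have "entry m h t u \<noteq> 0"
    using entry_sign[of m h t u] climb_reach[OF climb] by auto
  moreover have "entry m g t u = 0" if g: "prec g h" for g
  proof (rule ccontr)
    assume "entry m g t u \<noteq> 0"
    then have "reach m g t u" using entry_sign[of m g t u] by auto
    note reach = reach_sum[OF this]
    have "length h \<le> length g" using reach climb_sum[OF climb] by simp
    then have len: "length g = length h" "lex_less h g" using g by (auto simp: prec_def)
    then have "climb m g t u" using reach climb_sum[OF climb] by simp
    then have "g = h \<or> lex_less g h"
      using climb_le_interval_word[OF _ state] L by (simp add: normal_intervals_def)
    then show False using len(2) lex_less_trans by fastforce
  qed
  ultimately show ?thesis by blast
qed


section \<open>The quotient rings\<close>

definition supported :: "'a set \<Rightarrow> 'a free \<Rightarrow> bool" where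
  "supported A x \<longleftrightarrow> (\<forall>w\<in>keys x. set w \<subseteq> A)"

lemma supported_single: "set w \<subseteq> A \<Longrightarrow> supported A (single w c)"
  by (simp add: supported_def)

lemma supported_0 [simp]: "supported A 0"
  by (simp add: supported_def)

lemma supported_1 [simp]: "supported A 1"
  by (simp add: supported_def zero_list_def)

lemma supported_const [simp]: "supported A (const c)"
  by (simp add: const_def supported_single)

lemma supported_letter [simp]: "a \<in> A \<Longrightarrow> supported A (letter a)"
  by (simp add: letter_def supported_single)

lemma supported_add [simp]: "supported A x \<Longrightarrow> supported A y \<Longrightarrow> supported A (x + y)"
  using keys_add[of x y] by (auto simp: supported_def)

lemma supported_minus [simp]: "supported A x \<Longrightarrow> supported A (- x)"
  by (simp add: supported_def)

lemma supported_diff [simp]: "supported A x \<Longrightarrow> supported A y \<Longrightarrow> supported A (x - y)"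
  using supported_add[of A x "- y"] by simp

lemma supported_mult [simp]: "supported A x \<Longrightarrow> supported A y \<Longrightarrow> supported A (x * y)"
  using keys_mult[of x y] by (fastforce simp: supported_def plus_list_def)

lemma supported_sum: "(\<And>i. i \<in> I \<Longrightarrow> supported A (f i)) \<Longrightarrow> supported A (sum f I)"
  by (induction I rule: infinite_finite_induct) simp_all

lemma supported_prod_list: "(\<And>x. x \<in> set xs \<Longrightarrow> supported A x) \<Longrightarrow> supported A (prod_list xs)"
  by (induction xs) simp_all

lemma free_algebra_simps [simp]:
  "carrier (free_algebra A) = Collect (supported A)"
  "x \<otimes>\<^bsub>free_algebra A\<^esub> y = x * y" "x \<oplus>\<^bsub>free_algebra A\<^esub> y = x + y"
  "\<one>\<^bsub>free_algebra A\<^esub> = 1" "\<zero>\<^bsub>free_algebra A\<^esub> = 0"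
  by (simp_all add: free_algebra_def supported_def[abs_def])

lemma ring_free_algebra: "ring (free_algebra A)"
proof (rule ringI)
  have "\<exists>y. supported A y \<and> y + x = 0" if "supported A x" for x
    using that by (intro exI[of _ "- x"]) simp
  then show "abelian_group (free_algebra A)"
    by (intro abelian_groupI) (auto simp: add.assoc add.commute)
  show "Group.monoid (free_algebra A)"
    by (rule Group.monoidI) (auto simp: algebra_simps)
qed (auto simp: algebra_simps)

lemma free_algebra_minus: "supported A x \<Longrightarrow> supported A y \<Longrightarrow> x \<ominus>\<^bsub>free_algebra A\<^esub> y = x - y"
proof -
  interpret ring "free_algebra A" by (rule ring_free_algebra)
  assume "supported A x" "supported A y"
  then have "\<ominus>\<^bsub>free_algebra A\<^esub> y = - y" by (intro minus_equality) auto
  then show ?thesis by (simp add: a_minus_def)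
qed

lemma ball_Collect1: "(\<forall>x\<in>{f i | i. i \<in> A}. P x) \<longleftrightarrow> (\<forall>i\<in>A. P (f i))"
  and ball_Collect2: "(\<forall>x\<in>{g i j | i j. i \<in> A \<and> j \<in> B}. P x) \<longleftrightarrow> (\<forall>i\<in>A. \<forall>j\<in>B. P (g i j))"
  and ball_Collect3: "(\<forall>x\<in>{g i j | i j. i \<in> A \<and> j \<in> B \<and> Q i j}. P x) \<longleftrightarrow>
    (\<forall>i\<in>A. \<forall>j\<in>B. Q i j \<longrightarrow> P (g i j))"
  by blast+

lemma generators_simps [simp]:
  "GenE i \<in> generators n \<longleftrightarrow> i \<in> {1..n-1}" "GenF i \<in> generators n \<longleftrightarrow> i \<in> {1..n-1}"
  "GenK i \<in> generators n \<longleftrightarrow> i \<in> {1..n-1}" "GenKinv i \<in> generators n \<longleftrightarrow> i \<in> {1..n-1}"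
  by (auto simp: generators_def)

lemma supported_Uq_relations: "r \<in> Uq_relations n \<Longrightarrow> supported (generators n) r"
proof -
  have "\<forall>r\<in>Uq_relations n. supported (generators n) r"
    unfolding Uq_relations_def Let_def ball_Un ball_Collect1 ball_Collect2 ball_Collect3 serre_def
    by simp
  then show "r \<in> Uq_relations n \<Longrightarrow> supported (generators n) r" by blast
qed

lemma ideal_Uq: "ideal (Uq_ideal n) (free_algebra (generators n))"
  unfolding Uq_ideal_def using supported_Uq_relations
  by (intro ring.genideal_ideal ring_free_algebra) auto

lemma Uq_class_eq_iff:
  "supported (generators n) x \<Longrightarrow> supported (generators n) y \<Longrightarrow>
     Uq_class n x = Uq_class n y \<longleftrightarrow> x - y \<in> Uq_ideal n"
  using ring.quotient_eq_iff_same_a_r_cos[OF ring_free_algebra ideal_Uq, of x n y]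
  by (simp add: Uq_class_def free_algebra_minus)

lemma Uq_simps:
  "carrier (Uq n) = Uq_class n ` Collect (supported (generators n))"
  "mult (Uq n) = rcoset_mult (free_algebra (generators n)) (Uq_ideal n)"
  "\<one>\<^bsub>Uq n\<^esub> = Uq_class n 1"
  "\<zero>\<^bsub>Uq n\<^esub> = Uq_ideal n"
  "add (Uq n) = set_add (free_algebra (generators n))"
  by (auto simp: Uq_def Let_def ring.extend_def module.fields_def FactRing_def A_RCOSETS_def' Uq_class_def)

lemma Uq_smult: "c \<odot>\<^bsub>Uq n\<^esub> X = Uq_class n (const c) \<otimes>\<^bsub>Uq n\<^esub> X"
  by (simp add: Uq_def Let_def ring.extend_def module.fields_def)

lemma ring_Uq: "ring (Uq n)"
proof -
  have "ring (free_algebra (generators n) Quot Uq_ideal n)"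
    using ideal.quotient_is_ring[OF ideal_Uq] .
  then interpret Q: ring "free_algebra (generators n) Quot Uq_ideal n" .
  have ops: "carrier (Uq n) = carrier (free_algebra (generators n) Quot Uq_ideal n)"
    "mult (Uq n) = mult (free_algebra (generators n) Quot Uq_ideal n)"
    "add (Uq n) = add (free_algebra (generators n) Quot Uq_ideal n)"
    "\<one>\<^bsub>Uq n\<^esub> = \<one>\<^bsub>free_algebra (generators n) Quot Uq_ideal n\<^esub>"
    "\<zero>\<^bsub>Uq n\<^esub> = \<zero>\<^bsub>free_algebra (generators n) Quot Uq_ideal n\<^esub>"
    by (simp_all add: Uq_def Let_def ring.extend_def module.fields_def)
  show ?thesis
  proof (rule ringI)
    show "abelian_group (Uq n)"
    proof (rule abelian_groupI)
      show "x \<oplus>\<^bsub>Uq n\<^esub> y = y \<oplus>\<^bsub>Uq n\<^esub> x" if "x \<in> carrier (Uq n)" "y \<in> carrier (Uq n)" for x y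
        using that by (simp add: ops Q.a_comm)
    qed (auto simp: ops Q.a_assoc intro: Q.l_neg Q.a_inv_closed)
    show "Group.monoid (Uq n)"
      by (rule Group.monoidI) (auto simp: ops Q.m_assoc)
  qed (auto simp: ops Q.l_distr Q.r_distr)
qed

lemma Uq_class_closed [simp]: "supported (generators n) x \<Longrightarrow> Uq_class n x \<in> carrier (Uq n)"
  by (simp add: Uq_simps)

lemma Uq_class_add: "supported (generators n) x \<Longrightarrow> supported (generators n) y \<Longrightarrow>
    Uq_class n (x + y) = Uq_class n x \<oplus>\<^bsub>Uq n\<^esub> Uq_class n y"
  using ideal.a_rcos_sum[OF ideal_Uq, of x n y] by (simp add: Uq_simps Uq_class_def)

lemma Uq_class_mult: "supported (generators n) x \<Longrightarrow> supported (generators n) y \<Longrightarrow>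
    Uq_class n (x * y) = Uq_class n x \<otimes>\<^bsub>Uq n\<^esub> Uq_class n y"
  using ideal.rcoset_mult_add[OF ideal_Uq, of x n y] by (simp add: Uq_simps Uq_class_def)

lemma Uq_class_1: "Uq_class n 1 = \<one>\<^bsub>Uq n\<^esub>"
  by (simp add: Uq_simps)

lemma Uq_class_0: "Uq_class n 0 = \<zero>\<^bsub>Uq n\<^esub>"
proof -
  interpret U: ring "Uq n" by (rule ring_Uq)
  have "Uq_class n 0 \<oplus>\<^bsub>Uq n\<^esub> Uq_class n 0 = Uq_class n 0"
    using Uq_class_add[of n 0 0] by simp
  then show ?thesis using U.add.r_cancel_one'[of "Uq_class n 0" "Uq_class n 0"] by simp
qed

lemma Uq_class_relation: "r \<in> Uq_relations n \<Longrightarrow> Uq_class n r = \<zero>\<^bsub>Uq n\<^esub>"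
proof -
  assume r: "r \<in> Uq_relations n"
  then have "r \<in> Uq_ideal n"
    unfolding Uq_ideal_def
    using supported_Uq_relations by (intro subsetD[OF ring.genideal_self[OF ring_free_algebra]]) auto
  then show ?thesis
    using Uq_class_eq_iff[of n r 0] supported_Uq_relations[OF r] by (simp add: Uq_class_0)
qed


section \<open>The product of the quantum groups\<close>

text \<open>
  The product of all \<open>Uq n\<close>. Taking the product over \<open>n\<close> yields a type without a parameter, in which
  equations can be calculated with the ordinary ring operations.
\<close>

typedef uprod = "{f. \<forall>n. f n \<in> carrier (Uq n)}"
  morphisms comp Uprod
  by (rule exI[of _ "\<lambda>n. \<zero>\<^bsub>Uq n\<^esub>"]) (simp add: ring.ring_simprules(2)[OF ring_Uq])

lemma comp_closed [simp]: "comp x n \<in> carrier (Uq n)"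
  using comp[of x] by simp

lemma uprod_eqI: "(\<And>n. comp x n = comp y n) \<Longrightarrow> x = y"
  by (metis comp_inject ext)

lemma comp_Uprod: "(\<And>n. f n \<in> carrier (Uq n)) \<Longrightarrow> comp (Uprod f) n = f n"
  by (simp add: Uprod_inverse)

instantiation uprod :: qalg
begin

definition zero_uprod :: uprod where "0 = Uprod (\<lambda>n. \<zero>\<^bsub>Uq n\<^esub>)"
definition one_uprod :: uprod where "1 = Uprod (\<lambda>n. \<one>\<^bsub>Uq n\<^esub>)"
definition plus_uprod :: "uprod \<Rightarrow> uprod \<Rightarrow> uprod" where
  "x + y = Uprod (\<lambda>n. comp x n \<oplus>\<^bsub>Uq n\<^esub> comp y n)"
definition times_uprod :: "uprod \<Rightarrow> uprod \<Rightarrow> uprod" where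
  "x * y = Uprod (\<lambda>n. comp x n \<otimes>\<^bsub>Uq n\<^esub> comp y n)"
definition uminus_uprod :: "uprod \<Rightarrow> uprod" where
  "- x = Uprod (\<lambda>n. \<ominus>\<^bsub>Uq n\<^esub> comp x n)"
definition minus_uprod :: "uprod \<Rightarrow> uprod \<Rightarrow> uprod" where
  "x - y = Uprod (\<lambda>n. comp x n \<ominus>\<^bsub>Uq n\<^esub> comp y n)"
definition scq_uprod :: "rat_q \<Rightarrow> uprod \<Rightarrow> uprod" where
  "c *\<^sub>q x = Uprod (\<lambda>n. c \<odot>\<^bsub>Uq n\<^esub> comp x n)"

lemma comp_simps:
  "comp 0 n = \<zero>\<^bsub>Uq n\<^esub>" "comp 1 n = \<one>\<^bsub>Uq n\<^esub>"
  "comp (x + y) n = comp x n \<oplus>\<^bsub>Uq n\<^esub> comp y n"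
  "comp (x * y) n = comp x n \<otimes>\<^bsub>Uq n\<^esub> comp y n"
  "comp (- x) n = \<ominus>\<^bsub>Uq n\<^esub> comp x n"
  "comp (x - y) n = comp x n \<ominus>\<^bsub>Uq n\<^esub> comp y n"
  "comp (c *\<^sub>q x) n = c \<odot>\<^bsub>Uq n\<^esub> comp x n"
  by (simp_all add: zero_uprod_def one_uprod_def plus_uprod_def times_uprod_def uminus_uprod_def
      minus_uprod_def scq_uprod_def comp_Uprod Uq_smult ring.ring_simprules[OF ring_Uq])

instance
proof
  fix x y z :: uprod and c d :: rat_q
  note rules = ring.ring_simprules[OF ring_Uq] Group.monoid.r_one[OF ring.is_monoid[OF ring_Uq]]
  show "x + y + z = x + (y + z)" "x + y = y + x" "0 + x = x" "- x + x = 0" "x - y = x + - y"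
    "x * y * z = x * (y * z)" "1 * x = x" "x * 1 = x"
    "(x + y) * z = x * z + y * z" "x * (y + z) = x * y + x * z"
    by (rule uprod_eqI; simp add: comp_simps rules a_minus_def)+
  have const: "Uq_class n (const c) \<otimes>\<^bsub>Uq n\<^esub> X = X \<otimes>\<^bsub>Uq n\<^esub> Uq_class n (const c)"
    if "X \<in> carrier (Uq n)" for n X
    using that by (auto simp: Uq_simps(1) const_mult_commute simp flip: Uq_class_mult)
  have const_add: "const (c + d) = const c + (const d :: generator free)"
    and const_mult: "const (c * d) = const c * (const d :: generator free)"
    by (simp_all add: const_def single_add mult_single plus_list_def)
  show "c *\<^sub>q (x + y) = c *\<^sub>q x + c *\<^sub>q y" "c *\<^sub>q x * y = c *\<^sub>q (x * y)"
    by (rule uprod_eqI; simp add: comp_simps rules Uq_smult)+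
  show "(c + d) *\<^sub>q x = c *\<^sub>q x + d *\<^sub>q x" "c *\<^sub>q d *\<^sub>q x = (c * d) *\<^sub>q x"
    by (rule uprod_eqI; simp add: comp_simps rules Uq_smult const_add const_mult Uq_class_add Uq_class_mult)+
  show "1 *\<^sub>q x = x"
    by (rule uprod_eqI) (simp add: comp_simps rules Uq_smult const_def Uq_class_1 flip: zero_list_def)
  show "x * (c *\<^sub>q y) = c *\<^sub>q (x * y)"
  proof (rule uprod_eqI)
    fix n
    have "comp x n \<otimes>\<^bsub>Uq n\<^esub> (Uq_class n (const c) \<otimes>\<^bsub>Uq n\<^esub> comp y n)
      = (comp x n \<otimes>\<^bsub>Uq n\<^esub> Uq_class n (const c)) \<otimes>\<^bsub>Uq n\<^esub> comp y n"
      by (simp add: rules)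
    also have "\<dots> = (Uq_class n (const c) \<otimes>\<^bsub>Uq n\<^esub> comp x n) \<otimes>\<^bsub>Uq n\<^esub> comp y n"
      by (simp add: const)
    finally show "comp (x * (c *\<^sub>q y)) n = comp (c *\<^sub>q (x * y)) n"
      by (simp add: comp_simps Uq_smult rules)
  qed
qed

end

lemma comp_ev_cong:
  assumes "\<And>g. comp (f g) m = comp (f' g) m"
  shows "comp (ev \<sigma> f x) m = comp (ev \<sigma> f' x) m"
proof -
  have word: "comp (prod_list (map f w)) m = comp (prod_list (map f' w)) m" for w
    by (induction w) (simp_all add: comp_simps assms)
  have "comp (\<Sum>w\<in>S. c w *\<^sub>q prod_list (map f w)) m = comp (\<Sum>w\<in>S. c w *\<^sub>q prod_list (map f' w)) m" for S c
    by (induction S rule: infinite_finite_induct) (simp_all add: comp_simps word)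
  then show ?thesis by (simp add: ev_def)
qed

lemma comp_lincomb:
  assumes "finite S"
  shows "comp (\<Sum>w\<in>S. c w *\<^sub>q y w) n = (\<Oplus>\<^bsub>Uq n\<^esub>w\<in>S. c w \<odot>\<^bsub>Uq n\<^esub> comp (y w) n)"
proof -
  interpret U: ring "Uq n" by (rule ring_Uq)
  have closed: "c w \<odot>\<^bsub>Uq n\<^esub> comp (y w) n \<in> carrier (Uq n)" for w
    using comp_closed[of "c w *\<^sub>q y w" n] by (simp add: comp_simps)
  show ?thesis
    using assms by (induction S) (simp_all add: comp_simps closed Pi_def)
qed


subsection \<open>Evaluation of the relations\<close>

context scalar_endo
begin

lemma uq_relations_iff:
  assumes v: "\<sigma> qq = v" "v \<noteq> 0" "v - inverse v \<noteq> 0"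
  shows "(\<forall>r\<in>Uq_relations n. ev \<sigma> f r = 0) \<longleftrightarrow> uq_action n v f"
proof -
  let ?E = "\<lambda>i. f (GenE i)" and ?F = "\<lambda>i. f (GenF i)"
    and ?K = "\<lambda>i. f (GenK i)" and ?K' = "\<lambda>i. f (GenKinv i)"
  have relations:
    "ev \<sigma> f (letter (GenK i) * letter (GenKinv i) - 1) = 0 \<longleftrightarrow> ?K i * ?K' i = 1"
    "ev \<sigma> f (letter (GenKinv i) * letter (GenK i) - 1) = 0 \<longleftrightarrow> ?K' i * ?K i = 1"
    "ev \<sigma> f (letter a * letter b - letter b * letter a) = 0 \<longleftrightarrow> f a * f b = f b * f a"
    "ev \<sigma> f (letter (GenK i) * letter a * letter (GenKinv i) - const (qq powi k) * letter a) = 0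
      \<longleftrightarrow> ?K i * f a * ?K' i = v powi k *\<^sub>q f a"
    "ev \<sigma> f (letter (GenE i) * letter (GenF j) - letter (GenF j) * letter (GenE i)
        - (if i = j then const (inverse (qq - inverse qq)) * (letter (GenK i) - letter (GenKinv i)) else 0)) = 0
      \<longleftrightarrow> ?E i * ?F j - ?F j * ?E i
        = (if i = j then inverse (v - inverse v) *\<^sub>q (?K i - ?K' i) else 0)"
    "ev \<sigma> f (letter a * letter a * letter b - const (qq + inverse qq) * (letter a * letter b * letter a)
        + letter b * letter a * letter a) = 0 \<longleftrightarrow> serre_q v (f a) (f b) = 0" for i j k a b
    subgoal by (simp add: ev_diff ev_mult)
    subgoal by (simp add: ev_diff ev_mult)
    subgoal by (simp add: ev_diff ev_mult)
    subgoal by (simp add: ev_diff ev_mult ev_const endo_powi v(1) scq_mult_left)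
    subgoal by (simp add: ev_diff ev_mult ev_const endo_inverse endo_diff v(1) scq_mult_left)
    subgoal by (simp add: ev_diff ev_add ev_mult ev_const endo_inverse endo_add v(1) serre_q_def scq_mult_left)
    done
  have "uq_action n v f \<longleftrightarrow> (\<forall>i\<in>{1..n-1}. ?K i * ?K' i = 1) \<and> (\<forall>i\<in>{1..n-1}. ?K' i * ?K i = 1)
    \<and> (\<forall>i\<in>{1..n-1}. \<forall>j\<in>{1..n-1}. ?K i * ?K j = ?K j * ?K i)
    \<and> (\<forall>i\<in>{1..n-1}. \<forall>j\<in>{1..n-1}. ?K i * ?E j * ?K' i = v powi root_form i j *\<^sub>q ?E j)
    \<and> (\<forall>i\<in>{1..n-1}. \<forall>j\<in>{1..n-1}. ?K i * ?F j * ?K' i = v powi (- root_form i j) *\<^sub>q ?F j)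
    \<and> (\<forall>i\<in>{1..n-1}. \<forall>j\<in>{1..n-1}. ?E i * ?F j - ?F j * ?E i
        = (if i = j then inverse (v - inverse v) *\<^sub>q (?K i - ?K' i) else 0))
    \<and> (\<forall>i\<in>{1..n-1}. \<forall>j\<in>{1..n-1}. root_form i j = 0 \<longrightarrow> ?E i * ?E j = ?E j * ?E i)
    \<and> (\<forall>i\<in>{1..n-1}. \<forall>j\<in>{1..n-1}. root_form i j = 0 \<longrightarrow> ?F i * ?F j = ?F j * ?F i)
    \<and> (\<forall>i\<in>{1..n-1}. \<forall>j\<in>{1..n-1}. root_form i j = -1 \<longrightarrow> serre_q v (?E i) (?E j) = 0)
    \<and> (\<forall>i\<in>{1..n-1}. \<forall>j\<in>{1..n-1}. root_form i j = -1 \<longrightarrow> serre_q v (?F i) (?F j) = 0)"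
    (is "_ \<longleftrightarrow> ?R")
  proof
    assume "uq_action n v f"
    then interpret uq_action n v f .
    show ?R
      by (intro conjI ballI impI)
        (rule K_inv K_K K_E_conj K_F_conj E_F E_E F_F serre_E serre_F; assumption)+
  next
    assume ?R
    then show "uq_action n v f"
      by (elim conjE, intro uq_action.intro v) (drule bspec, assumption, (drule bspec, assumption)?, (drule mp, assumption)?, assumption)+
  qed
  then show ?thesis
    unfolding Uq_relations_def Let_def ball_Un ball_Collect1 ball_Collect2 ball_Collect3 serre_def relations
    by (simp only: conj_assoc)
qed

text \<open>
  The universal property: elements supported on the generators that evaluate to zero form an ideal.
\<close>

lemma Uq_class_eqD:
  assumes f: "\<forall>r\<in>Uq_relations n. ev \<sigma> f r = 0"
    and x: "supported (generators n) x" "supported (generators n) y" "Uq_class n x = Uq_class n y"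
  shows "ev \<sigma> f x = ev \<sigma> f y"
proof -
  let ?A = "free_algebra (generators n)"
  let ?J = "{x. supported (generators n) x \<and> ev \<sigma> f x = 0}"
  interpret A: ring ?A by (rule ring_free_algebra)
  have "ideal ?J ?A"
  proof (rule idealI)
    show "subgroup ?J (add_monoid ?A)"
    proof (rule A.add.subgroupI)
      show "\<ominus>\<^bsub>?A\<^esub> x \<in> ?J" if "x \<in> ?J" for x
      proof -
        have "\<ominus>\<^bsub>?A\<^esub> x = - x" using that by (intro A.minus_equality) auto
        with that show ?thesis by (simp add: ev_minus)
      qed
    qed (auto simp: ev_add intro: exI[of _ 0])
  qed (auto simp: ring_free_algebra ev_mult)
  moreover have "Uq_relations n \<subseteq> ?J"
    using f supported_Uq_relations by auto
  ultimately have "Uq_ideal n \<subseteq> ?J"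
    unfolding Uq_ideal_def by (rule A.genideal_minimal)
  then have "ev \<sigma> f (x - y) = 0"
    using x Uq_class_eq_iff by blast
  then show ?thesis by (simp add: ev_diff)
qed

end


subsection \<open>The generators as families\<close>

text \<open>
  The generators of \<open>Uq n\<close> as elements of the product. In the other components the counit takes their
  place, so that the defining relations hold in every component.
\<close>

definition gen :: "nat \<Rightarrow> generator \<Rightarrow> uprod" where
  "gen n g = Uprod (\<lambda>m. if m = n \<and> g \<in> generators n then Uq_class n (letter g) else comp (counit g) m)"

lemma comp_gen: "comp (gen n g) m =
    (if m = n \<and> g \<in> generators n then Uq_class n (letter g) else comp (counit g) m)"
  unfolding gen_def by (subst comp_Uprod) auto

lemma comp_ev_gen:
  assumes "supported (generators n) x"
  shows "comp (ev (\<lambda>x. x) (gen n) x) n = Uq_class n x"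
proof -
  have letter: "single (g # w) 1 = letter g * single w (1 :: rat_q)" for g w
    by (simp add: letter_def mult_single plus_list_def)
  have word: "comp (prod_list (map (gen n) w)) n = Uq_class n (single w 1)"
    if "set w \<subseteq> generators n" for w
    using that
  proof (induction w)
    case Nil
    then show ?case by (simp add: comp_simps Uq_class_1 single_Nil)
  next
    case (Cons g w)
    then show ?case by (simp add: comp_simps comp_gen letter Uq_class_mult supported_single)
  qed
  have "supported (generators n) (\<Sum>w\<in>S. single w (c w))
      \<and> comp (\<Sum>w\<in>S. c w *\<^sub>q prod_list (map (gen n) w)) n = Uq_class n (\<Sum>w\<in>S. single w (c w))"
    if "\<forall>w\<in>S. set w \<subseteq> generators n" "finite S" for S c
    using that(2,1)
  proof (induction S)
    case (insert w S)
    then have "comp (c w *\<^sub>q prod_list (map (gen n) w)) n = Uq_class n (single w (c w))"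
      by (subst single_eq_const_mult) (simp add: comp_simps word Uq_smult Uq_class_mult supported_single)
    then show ?case using insert by (simp add: comp_simps Uq_class_add supported_single)
  qed (simp add: comp_simps Uq_class_0)
  from this[of "keys x" "lookup x"] show ?thesis
    using assms by (simp add: ev_def supported_def poly_mapping_sum_single)
qed

lemma qq_inverse_facts: "qq \<noteq> 0" "qq - inverse qq \<noteq> 0" "inverse qq \<noteq> 0"
    "inverse qq - inverse (inverse qq) \<noteq> 0"
  by (simp_all add: qq_neq_inverse[symmetric])

lemma gen_action: "uq_action n qq (gen n)"
proof -
  have "ev (\<lambda>x. x) (gen n) r = 0" if r: "r \<in> Uq_relations n" for r
  proof (rule uprod_eqI)
    fix m
    show "comp (ev (\<lambda>x. x) (gen n) r) m = comp 0 m"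
    proof (cases "m = n")
      case True
      then show ?thesis
        using comp_ev_gen[OF supported_Uq_relations[OF r]] Uq_class_relation[OF r] by (simp add: comp_simps)
    next
      case False
      then have "comp (ev (\<lambda>x. x) (gen n) r) m = comp (ev (\<lambda>x. x) counit r) m"
        by (intro comp_ev_cong) (simp add: comp_gen)
      also have "ev (\<lambda>x. x) counit r = (0 :: uprod)"
        using scalar_id.uq_relations_iff[of qq n counit] counit_action[of qq n] qq_inverse_facts r by blast
      finally show ?thesis .
    qed
  qed
  then show ?thesis
    using scalar_id.uq_relations_iff[of qq n "gen n"] qq_inverse_facts by blast
qed


section \<open>The i-quantum group inside the product\<close>

definition B_free :: "nat \<Rightarrow> generator free" where
  "B_free i = letter (GenF i) + const (inverse qq) * letter (GenE i) * letter (GenKinv i)"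

definition B_subst :: "nat free \<Rightarrow> generator free" where
  "B_subst x = (\<Sum>w\<in>keys x. const (lookup x w) * prod_list (map B_free w))"

definition bgen :: "nat \<Rightarrow> nat \<Rightarrow> uprod" where
  "bgen n i = ev (\<lambda>x. x) (gen n) (B_free i)"

text \<open>
  The image in \<open>Uq n\<close> of a combination of words in the \<open>B\<^sub>i\<close>. It agrees with \<open>B_lin\<close> on the words
  over the alphabet, but it is defined and additive and multiplicative on the whole free algebra.
\<close>

definition val :: "nat \<Rightarrow> nat free \<Rightarrow> generator free set" where
  "val n x = comp (ev (\<lambda>x. x) (bgen n) x) n"

abbreviation over :: "word set \<Rightarrow> nat free \<Rightarrow> bool" where
  "over S x \<equiv> keys x \<subseteq> S"

lemma bgen_eq: "bgen n i = uq_action.B qq (gen n) i"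
  by (simp add: bgen_def B_free_def uq_action.B_def[OF gen_action] scalar_id.ev_simps scq_mult_left)

lemma iserre_algebra_bgen: "iserre_algebra n (bgen n)"
  unfolding bgen_eq[abs_def]
  by standard (erule (2) uq_action.B_commute[OF gen_action], erule (2) uq_action.B_serre[OF gen_action])

lemma (in scalar_endo) ev_B_subst: "ev \<sigma> f (B_subst x) = ev \<sigma> (\<lambda>i. ev \<sigma> f (B_free i)) x"
  by (simp add: B_subst_def ev_sum ev_const_mult ev_prod_list o_def) (simp add: ev_def)

lemma supported_B_free: "i \<in> {1..n-1} \<Longrightarrow> supported (generators n) (B_free i)"
  by (simp add: B_free_def)

lemma supported_B_subst: "over (words n) x \<Longrightarrow> supported (generators n) (B_subst x)"
  unfolding B_subst_def
  by (intro supported_sum supported_mult supported_const supported_prod_list)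
    (auto simp: words_def supported_B_free)

lemma val_eq_class: "over (words n) x \<Longrightarrow> val n x = Uq_class n (B_subst x)"
  by (simp add: val_def bgen_def[abs_def] comp_ev_gen[OF supported_B_subst] flip: scalar_id.ev_B_subst)

text \<open>
  Every linear relation between words in the \<open>B\<^sub>i\<close> persists in every algebra that satisfies the
  relations of the quantum group. This is applied to the tensor powers and to the bar involution.
\<close>

lemma ev_eqI_of_val_eq:
  assumes \<sigma>: "scalar_endo \<sigma>" and f: "uq_action n (\<sigma> qq) f"
    and x: "over (words n) x" "over (words n) y" "val n x = val n y"
  shows "ev \<sigma> (\<lambda>i. ev \<sigma> f (B_free i)) x = ev \<sigma> (\<lambda>i. ev \<sigma> f (B_free i)) y"
proof -
  interpret scalar_endo \<sigma> by (fact \<sigma>)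
  have "\<forall>r\<in>Uq_relations n. ev \<sigma> f r = 0"
    using uq_relations_iff[OF refl uq_action.v[OF f]] f by (rule iffD2)
  moreover have "Uq_class n (B_subst x) = Uq_class n (B_subst y)"
    using x(3) by (simp only: val_eq_class[OF x(1)] val_eq_class[OF x(2)])
  ultimately have "ev \<sigma> f (B_subst x) = ev \<sigma> f (B_subst y)"
    by (rule Uq_class_eqD[OF _ supported_B_subst[OF x(1)] supported_B_subst[OF x(2)]])
  then show ?thesis by (simp only: ev_B_subst)
qed

lemma B_gen_eq: "i \<in> {1..n-1} \<Longrightarrow> B_gen n i = comp (bgen n i) n"
  using comp_ev_gen[OF supported_B_free] by (simp add: bgen_def B_gen_def B_free_def)

lemma B_word_eq: "w \<in> words n \<Longrightarrow> B_word n w = val n (single w 1)"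
proof (induction w)
  case Nil
  then show ?case by (simp add: B_word_def val_def scalar_id.ev_single comp_simps)
next
  case (Cons i w)
  then have "i \<in> {1..n-1}" by auto
  then show ?case
    using Cons by (simp add: B_word_def val_def scalar_id.ev_single comp_simps B_gen_eq)
qed

lemma val_closed [simp]: "val n x \<in> carrier (Uq n)"
  by (simp add: val_def)

lemma val_simps:
  "val n (x + y) = val n x \<oplus>\<^bsub>Uq n\<^esub> val n y" "val n (x * y) = val n x \<otimes>\<^bsub>Uq n\<^esub> val n y"
  "val n (x - y) = val n x \<ominus>\<^bsub>Uq n\<^esub> val n y" "val n (- x) = \<ominus>\<^bsub>Uq n\<^esub> val n x"
  "val n 0 = \<zero>\<^bsub>Uq n\<^esub>" "val n 1 = \<one>\<^bsub>Uq n\<^esub>"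
  "val n (const c * x) = c \<odot>\<^bsub>Uq n\<^esub> val n x"
  "val n (const c) = c \<odot>\<^bsub>Uq n\<^esub> \<one>\<^bsub>Uq n\<^esub>"
  unfolding val_def by (simp_all add: scalar_id.ev_simps comp_simps scq_mult_left)

lemma val_eq_iff: "val n x = val n y \<longleftrightarrow> val n (x - y) = \<zero>\<^bsub>Uq n\<^esub>"
proof -
  interpret ring "Uq n" by (rule ring_Uq)
  show ?thesis by (simp add: val_simps)
qed

text \<open>Linear combinations in \<open>Uq n\<close> are values of linear combinations in the free algebra.\<close>

lemma finsum_eq_val:
  assumes "finite S" "\<And>g. g \<in> S \<Longrightarrow> X g = val n (y g)"
  shows "(\<Oplus>\<^bsub>Uq n\<^esub>g\<in>S. c g \<odot>\<^bsub>Uq n\<^esub> X g) = val n (\<Sum>g\<in>S. const (c g) * y g)"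
proof -
  interpret ring "Uq n" by (rule ring_Uq)
  have "val n (\<Sum>g\<in>S. const (c g) * y g) = (\<Oplus>\<^bsub>Uq n\<^esub>g\<in>S. c g \<odot>\<^bsub>Uq n\<^esub> val n (y g))"
    unfolding val_def using assms(1)
    by (simp add: scalar_id.ev_sum scalar_id.ev_const_mult comp_lincomb)
  also have "\<dots> = (\<Oplus>\<^bsub>Uq n\<^esub>g\<in>S. c g \<odot>\<^bsub>Uq n\<^esub> X g)"
  proof (rule finsum_cong')
    show "(\<lambda>g. c g \<odot>\<^bsub>Uq n\<^esub> X g) \<in> S \<rightarrow> carrier (Uq n)"
      using assms(2) val_closed by (auto simp flip: val_simps(7))
  qed (use assms(2) in auto)
  finally show ?thesis ..
qed

lemma B_lin_eq: "over (words n) x \<Longrightarrow> B_lin n x = val n x"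
  unfolding B_lin_def using B_word_eq
  by (subst finsum_eq_val[where y = "\<lambda>w. single w 1"])
    (auto simp flip: single_eq_const_mult simp: poly_mapping_sum_single)


subsection \<open>Good words are the normal words\<close>

lemma app_sum: "app (\<Sum>w\<in>S. c w *\<^sub>q T w) x t = (\<Sum>w\<in>S. c w * app (T w) x t)"
  by (induction S rule: infinite_finite_induct) simp_all

lemma val_0_entry:
  assumes "over (words n) x" "val n x = \<zero>\<^bsub>Uq n\<^esub>"
  shows "(\<Sum>w\<in>keys x. lookup x w * entry m w t u) = 0"
proof -
  have B: "ev (\<lambda>x. x) (rep m) (B_free i) = rep_B m i" for i
    by (simp add: B_free_def rep_B_def scalar_id.ev_simps scq_mult_left)
  have "ev (\<lambda>x. x) (rep_B m) x = ev (\<lambda>x. x) (rep_B m) 0"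
    using ev_eqI_of_val_eq[OF scalar_id.scalar_endo_axioms rep_action assms(1), of 0 m] assms(2)
    by (simp add: val_simps B)
  then have "(\<Sum>w\<in>keys x. lookup x w *\<^sub>q prod_list (map (rep_B m) w)) = 0"
    by (simp add: ev_def)
  from arg_cong[OF this, of "\<lambda>T. app T (\<lambda>s. if s = u then 1 else 0) t"]
  show ?thesis by (simp add: app_sum entry_def)
qed

lemma prec_maximal:
  assumes "finite S" "S \<noteq> {}"
  obtains h where "h \<in> S" "\<And>g. g \<in> S \<Longrightarrow> prec_eq g h"
proof -
  have "\<exists>h\<in>S. \<forall>g\<in>S. prec_eq g h"
    using assms
  proof (induction rule: finite_ne_induct)
    case (insert x S)
    then obtain h where "h \<in> S" "\<forall>g\<in>S. prec_eq g h" by blast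
    then show ?case using prec_linear[of x h] prec_trans by (metis insert_iff)
  qed auto
  then show ?thesis using that by blast
qed

text \<open>
  The matrix entry that detects \<open>h\<close> vanishes on all other words that occur.
\<close>

lemma val_leading_nonzero:
  assumes "h \<in> normal_words n" "lookup x h \<noteq> 0"
    and "\<And>g. g \<in> keys x \<Longrightarrow> g \<in> words n \<and> prec_eq g h"
  shows "val n x \<noteq> \<zero>\<^bsub>Uq n\<^esub>"
proof
  assume 0: "val n x = \<zero>\<^bsub>Uq n\<^esub>"
  obtain m t u where sep: "entry m h t u \<noteq> 0" "\<And>g. prec g h \<Longrightarrow> entry m g t u = 0"
    using normal_word_separated[OF assms(1)] by blast
  have "(\<Sum>w\<in>keys x. lookup x w * entry m w t u)
    = (\<Sum>w\<in>{h}. lookup x w * entry m w t u)"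
    using assms(2,3) sep(2) by (intro sum.mono_neutral_right) (auto simp: in_keys_iff)
  moreover have "over (words n) x" using assms(3) by blast
  ultimately show False
    using val_0_entry[OF _ 0] sep(1) assms(2) by simp
qed

lemma val_inj_normal:
  assumes "over (normal_words n) x" "over (normal_words n) y" "val n x = val n y"
  shows "x = y"
proof (rule ccontr)
  assume "x \<noteq> y"
  then have "keys (x - y) \<noteq> {}" by simp
  then obtain h where h: "h \<in> keys (x - y)"
    "\<And>g. g \<in> keys (x - y) \<Longrightarrow> prec_eq g h"
    using prec_maximal by (metis finite_keys)
  have "over (normal_words n) (x - y)" using assms keys_diff[of x y] by blast
  then have "val n (x - y) \<noteq> \<zero>\<^bsub>Uq n\<^esub>"
    using h normal_in_words by (intro val_leading_nonzero[of h]) (auto simp: in_keys_iff)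
  then show False using assms(3) val_eq_iff by blast
qed

lemma below_words: "w \<in> below n g \<Longrightarrow> w \<in> words n"
  by (simp add: below_def)

lemma over_add: "over S x \<Longrightarrow> over S y \<Longrightarrow> over S (x + y)"
  using keys_add[of x y] by blast

lemma over_const_mult: "over S x \<Longrightarrow> over S (const c * x)"
  using keys_const_mult[of c x] by blast

lemma over_sum: "(\<And>i. i \<in> I \<Longrightarrow> over S (f i)) \<Longrightarrow> over S (sum f I)"
  using Poly_Mapping.keys_sum[of f I] by blast

lemma over_const: "over (words n) (const c)"
  by (simp add: const_def)

lemma over_mult: "over (words n) x \<Longrightarrow> over (words n) y \<Longrightarrow> over (words n) (x * y)"
  using keys_mult[of x y] by (fastforce simp: plus_list_def)

lemma over_comb: "(\<And>i. i \<in> keys x \<Longrightarrow> over S (c i)) \<Longrightarrow> over S (comb c x)"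
  unfolding comb_def by (intro over_sum over_const_mult)

lemma val_comb_cong:
  assumes "\<And>i. i \<in> keys x \<Longrightarrow> val n (c i) = val n (d i)"
  shows "val n (comb c x) = val n (comb d x)"
  unfolding comb_def
  by (subst (1 2) finsum_eq_val[where X = "\<lambda>i. val n (d i)", symmetric]) (simp_all add: assms)

text \<open>
  A word that is not normal is reducible, hence not good. A normal word is good because its
  separating matrix entry vanishes on all smaller words.
\<close>

lemma good_eq_normal: "good n = normal_words n"
proof (intro equalityI subsetI)
  fix g assume g: "g \<in> good n"
  show "g \<in> normal_words n"
  proof (rule ccontr)
    assume not_normal: "g \<notin> normal_words n"
    interpret iserre_algebra n "bgen n" by (rule iserre_algebra_bgen)
    have "g \<in> words n" using g by (simp add: good_def)
    then obtain x where x: "x \<in> intspan (below n g)"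
      "\<Lambda> (single g 1) = \<Lambda> x"
      using normal_or_reducible[of g] not_normal by (auto simp: reducible_def)
    let ?c = "lookup x"
    have "(\<Sum>w\<in>below n g. const (?c w) * single w 1) = x"
    proof -
      have "(\<Sum>w\<in>below n g. single w (?c w)) = (\<Sum>w\<in>keys x. single w (?c w))"
        using intspan_keys[OF x(1)] by (intro sum.mono_neutral_right) (auto simp: in_keys_iff)
      then show ?thesis by (simp add: poly_mapping_sum_single flip: single_eq_const_mult)
    qed
    then have "(\<Oplus>\<^bsub>Uq n\<^esub>w\<in>below n g. ?c w \<odot>\<^bsub>Uq n\<^esub> B_word n w) = val n x"
      by (subst finsum_eq_val[where y = "\<lambda>w. single w 1"]) (simp_all add: B_word_eq below_words)
    also have "\<dots> = B_word n g"
      using x(2) B_word_eq[OF \<open>g \<in> words n\<close>] by (simp add: val_def)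
    finally have "g = []" using g unfolding good_def below_def by blast
    then show False using not_normal by simp
  qed
next
  fix g assume g: "g \<in> normal_words n"
  have "B_word n g \<noteq> (\<Oplus>\<^bsub>Uq n\<^esub>w\<in>below n g. c w \<odot>\<^bsub>Uq n\<^esub> B_word n w)" for c
  proof
    let ?s = "\<Sum>w\<in>below n g. const (c w) * single w 1"
    assume "B_word n g = (\<Oplus>\<^bsub>Uq n\<^esub>w\<in>below n g. c w \<odot>\<^bsub>Uq n\<^esub> B_word n w)"
    also have "\<dots> = val n ?s"
      by (rule finsum_eq_val) (simp_all add: B_word_eq below_words)
    finally have "val n (single g 1) = val n ?s"
      by (simp only: B_word_eq[OF normal_in_words[OF g]])
    then have "val n (single g 1 - ?s) = \<zero>\<^bsub>Uq n\<^esub>"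
      by (rule val_eq_iff[THEN iffD1])
    moreover have keys: "keys ?s \<subseteq> below n g"
      by (intro over_sum over_const_mult) simp
    then have "g \<notin> keys ?s"
      by (metis (no_types, lifting) below_def mem_Collect_eq prec_irrefl subsetD)
    then have "lookup (single g 1 - ?s) g \<noteq> 0"
      by (simp add: lookup_minus in_keys_iff)
    moreover have "w \<in> words n \<and> prec_eq w g" if "w \<in> keys (single g 1 - ?s)" for w
    proof -
      have "w \<in> {g} \<union> below n g"
        using that keys keys_diff[of "single g 1" ?s] by (metis (no_types, lifting) Un_iff keys_single subset_iff empty_iff)
      then show ?thesis using normal_in_words[OF g] unfolding below_def by blast
    qed
    ultimately show False
      using val_leading_nonzero[OF g] by blast
  qed
  then show "g \<in> good n"
    using normal_in_words[OF g] unfolding good_def below_def by blast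
qed

lemma normal_span_word:
  assumes "w \<in> words n"
  shows "\<exists>x\<in>intspan {g \<in> normal_words n. prec_eq g w}. B_word n w = val n x"
  using iserre_algebra.normal_span[OF iserre_algebra_bgen assms] B_word_eq[OF assms]
  by (auto simp: val_def)

lemma val_normal:
  assumes "over (words n) x"
  shows "\<exists>y. over (normal_words n) y \<and> val n x = val n y"
proof -
  have "\<forall>w\<in>words n. \<exists>y. over (normal_words n) y \<and> B_word n w = val n y"
  proof
    fix w assume "w \<in> words n"
    then obtain x where "x \<in> intspan {g \<in> normal_words n. prec_eq g w}" "B_word n w = val n x"
      using normal_span_word by blast
    then show "\<exists>y. over (normal_words n) y \<and> B_word n w = val n y"
      using intspan_keys[of x] by (intro exI[of _ x]) auto
  qed
  from bchoice[OF this] obtain y where y: "\<And>w. w \<in> words n \<Longrightarrow> over (normal_words n) (y w)"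
    "\<And>w. w \<in> words n \<Longrightarrow> B_word n w = val n (y w)"
    by blast
  have "val n (comb (\<lambda>w. single w 1) x) = val n (comb y x)"
    using assms y(2) B_word_eq by (intro val_comb_cong) auto
  then have "val n x = val n (comb y x)" by (simp only: comb_words)
  moreover have "over (normal_words n) (comb y x)"
    using assms y(1) by (intro over_comb) blast
  ultimately show ?thesis by blast
qed


subsection \<open>The subalgebra and its bar involution\<close>

lemma Ui_eq: "Ui n = val n ` {x. over (words n) x}"
proof (intro equalityI subsetI)
  fix X assume "X \<in> Ui n"
  then show "X \<in> val n ` {x. over (words n) x}"
    unfolding Ui_def
  proof (induction rule: generate_ring.induct)
    case one
    show ?case by (rule image_eqI[of _ _ 1]) (auto simp: val_simps zero_list_def)
  next
    case (incl h)
    then consider c where "h = c \<odot>\<^bsub>Uq n\<^esub> \<one>\<^bsub>Uq n\<^esub>" | i where "i \<in> {1..n-1}" "h = B_gen n i"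
      by auto
    then show ?case
    proof cases
      case 1
      then show ?thesis
        by (intro image_eqI[of _ _ "const c"]) (simp_all add: val_simps(8) over_const)
    next
      case 2
      then show ?thesis
        by (intro image_eqI[of _ _ "letter i"]) (auto simp: val_def letter_def scalar_id.ev_single B_gen_eq)
    qed
  next
    case (a_inv h)
    then obtain x where "h = val n x" "over (words n) x" by auto
    then show ?case by (intro image_eqI[of _ _ "- x"]) (auto simp: val_simps)
  next
    case (eng_add h k)
    then obtain x y where "h = val n x" "over (words n) x" "k = val n y" "over (words n) y" by auto
    then show ?case by (intro image_eqI[of _ _ "x + y"]) (auto simp: val_simps over_add)
  next
    case (eng_mult h k)
    then obtain x y where "h = val n x" "over (words n) x" "k = val n y" "over (words n) y" by auto
    then show ?case by (intro image_eqI[of _ _ "x * y"]) (auto simp: val_simps over_mult)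
  qed
next
  fix X assume "X \<in> val n ` {x. over (words n) x}"
  then obtain x where x: "X = val n x" "over (words n) x" by auto
  interpret ring "Uq n" by (rule ring_Uq)
  have scalar: "c \<odot>\<^bsub>Uq n\<^esub> \<one>\<^bsub>Uq n\<^esub> \<in> Ui n" for c
    unfolding Ui_def by (intro generate_ring.incl) auto
  have mult: "Y \<otimes>\<^bsub>Uq n\<^esub> Z \<in> Ui n" and add: "Y \<oplus>\<^bsub>Uq n\<^esub> Z \<in> Ui n" if "Y \<in> Ui n" "Z \<in> Ui n" for Y Z
    using that unfolding Ui_def by (auto intro: generate_ring.intros)
  have word: "val n (single w 1) \<in> Ui n" if "w \<in> words n" for w
    using that
  proof (induction w)
    case Nil
    then show ?case using generate_ring.one by (simp add: single_Nil val_simps Ui_def)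
  next
    case (Cons i w)
    then have i: "i \<in> {1..n-1}" by auto
    have "B_gen n i \<in> Ui n" using Cons.prems unfolding Ui_def by (intro generate_ring.incl) auto
    moreover have "val n (single (i # w) 1) = B_gen n i \<otimes>\<^bsub>Uq n\<^esub> val n (single w 1)"
      by (simp add: val_def scalar_id.ev_single comp_simps B_gen_eq[OF i])
    ultimately show ?case using Cons mult by simp
  qed
  have "val n (\<Sum>w\<in>S. single w (c w)) \<in> Ui n" if "finite S" "S \<subseteq> words n" for S c
    using that
  proof (induction S)
    case empty
    then show ?case using zero_in_generate by (simp add: val_simps Ui_def)
  next
    case (insert w S)
    have "val n (single w (c w)) = (c w \<odot>\<^bsub>Uq n\<^esub> \<one>\<^bsub>Uq n\<^esub>) \<otimes>\<^bsub>Uq n\<^esub> val n (single w 1)"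
      by (subst single_eq_const_mult) (simp flip: val_simps)
    then show ?case using insert scalar word mult add by (simp add: val_simps)
  qed
  from this[of "keys x" "lookup x"] show "X \<in> Ui n"
    using x by (simp add: poly_mapping_sum_single)
qed

lemma Ui_carrier: "X \<in> Ui n \<Longrightarrow> X \<in> carrier (Uq n)"
  by (auto simp: Ui_eq)

definition coeff_bar :: "'a free \<Rightarrow> 'a free" where
  "coeff_bar x = Poly_Mapping.map qbar x"

lemma lookup_coeff_bar [simp]: "lookup (coeff_bar x) w = qbar (lookup x w)"
  by (simp add: coeff_bar_def Poly_Mapping.map.rep_eq when_def)

lemma coeff_bar_coeff_bar [simp]: "coeff_bar (coeff_bar x) = x"
  by (rule poly_mapping_eqI) simp

lemma qbar_eq_0_iff [simp]: "qbar x = 0 \<longleftrightarrow> x = 0"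
  by (metis qbar_0 qbar_qbar)

lemma keys_coeff_bar [simp]: "keys (coeff_bar x) = keys x"
  by (auto simp: in_keys_iff)

lemma coeff_bar_0 [simp]: "coeff_bar 0 = 0"
  by (rule poly_mapping_eqI) simp

lemma coeff_bar_single: "coeff_bar (single w c) = single w (qbar c)"
  by (rule poly_mapping_eqI) (simp add: lookup_single when_def)

lemma coeff_bar_add: "coeff_bar (x + y) = coeff_bar x + coeff_bar y"
  by (rule poly_mapping_eqI) (simp add: lookup_add qbar_add)

lemma coeff_bar_sum: "coeff_bar (sum f S) = (\<Sum>i\<in>S. coeff_bar (f i))"
  by (rule poly_mapping_eqI) (simp add: lookup_sum qbar_sum)

lemma coeff_bar_diff: "coeff_bar (x - y) = coeff_bar x - coeff_bar y"
  by (rule poly_mapping_eqI) (simp add: lookup_minus qbar_diff)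

lemma coeff_bar_mult: "coeff_bar (x * y) = coeff_bar x * coeff_bar y"
proof -
  let ?s = "\<lambda>x w. single w (lookup x w)"
  have "coeff_bar (sum (?s x) (keys x) * sum (?s y) (keys y))
    = coeff_bar (sum (?s x) (keys x)) * coeff_bar (sum (?s y) (keys y))"
    by (simp add: sum_product coeff_bar_sum coeff_bar_single mult_single qbar_mult)
  then show ?thesis by (simp add: poly_mapping_sum_single)
qed

text \<open>
  The semilinear exchange of \<open>E\<close> and \<open>F\<close> fixes every \<open>B\<^sub>i\<close>, so it acts on combinations of words
  through their coefficients.
\<close>

lemma val_coeff_bar_cong:
  assumes x: "over (words n) x" "over (words n) y" "val n x = val n y"
  shows "val n (coeff_bar x) = val n (coeff_bar y)"
proof -
  define f where "f = uq_action.swap qq (gen n)"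
  have f: "uq_action n (qbar qq) f"
    unfolding f_def using uq_action.swap_action[OF gen_action] by simp
  have B: "ev qbar f (B_free i) = bgen n i" if "i \<in> {1..n-1}" for i
    using that uq_action.K_inv[OF gen_action, of i n]
    by (simp add: B_free_def bgen_def scalar_id.ev_simps scalar_bar.ev_simps f_def
        uq_action.swap_def[OF gen_action] qbar_inverse scq_simps mult.assoc add.commute)
  have ev: "ev (\<lambda>x. x) (bgen n) (coeff_bar z) = ev qbar (\<lambda>i. ev qbar f (B_free i)) z" if "over (words n) z" for z
    unfolding ev_def[of _ _ z] ev_def[of _ _ "coeff_bar z"]
  proof (rule sum.cong)
    fix w assume "w \<in> keys z"
    then have "set w \<subseteq> {1..n-1}" using that by (auto simp: words_def)
    then have "map (\<lambda>i. ev qbar f (B_free i)) w = map (bgen n) w" using B by auto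
    then show "lookup (coeff_bar z) w *\<^sub>q prod_list (map (bgen n) w)
      = qbar (lookup z w) *\<^sub>q prod_list (map (\<lambda>i. ev qbar f (B_free i)) w)"
      by (simp only: lookup_coeff_bar)
  qed simp
  show ?thesis
    using ev_eqI_of_val_eq[OF scalar_bar.scalar_endo_axioms f x] x by (simp add: val_def ev)
qed

lemma scalar_hom_eq_qbar:
  assumes h: "\<psi> \<in> ring_iso ((Uq n)\<lparr>carrier := Ui n\<rparr>) ((Uq n)\<lparr>carrier := Ui n\<rparr>)"
    and q: "\<psi> (val n (const qq)) = val n (const (inverse qq))"
  shows "\<psi> (val n (const c)) = val n (const (qbar c))"
proof -
  interpret ring "Uq n" by (rule ring_Uq)
  have Ui: "val n (const c) \<in> Ui n" for c
    unfolding Ui_eq by (rule imageI) (simp add: const_def)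
  note hom = ring_iso_memE[OF h, simplified]
  have const: "const (c + d) = const c + (const d :: nat free)" "const (c * d) = const c * (const d :: nat free)"
    "const (c - d) = const c - (const d :: nat free)" "const 1 = (1 :: nat free)" for c d
    by (simp_all add: const_def single_add single_diff mult_single plus_list_def single_Nil)
  have one: "\<psi> (val n (const 1)) = val n (const 1)" using hom(4) by (simp add: const val_simps(6))
  show ?thesis
  proof (induction c rule: rat_q_induct)
    case one
    show ?case using \<open>\<psi> (val n (const 1)) = val n (const 1)\<close> by simp
  next
    case qq
    show ?case using q by simp
  next
    case (diff x y)
    have "\<psi> (val n (const (x - y)) \<oplus>\<^bsub>Uq n\<^esub> val n (const y)) = \<psi> (val n (const (x - y))) \<oplus>\<^bsub>Uq n\<^esub> \<psi> (val n (const y))"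
      by (rule hom(3)[OF Ui Ui])
    then have "val n (const (qbar x)) = \<psi> (val n (const (x - y))) \<oplus>\<^bsub>Uq n\<^esub> val n (const (qbar y))"
      using diff by (simp flip: val_simps const)
    moreover have "\<psi> (val n (const (x - y))) \<in> carrier (Uq n)"
      using hom(1)[OF Ui] by (rule Ui_carrier)
    ultimately show ?case
      by (simp add: qbar_diff const(3) val_simps(3)) (metis a_minus_def add.inv_solve_right val_closed)
  next
    case (mult x y)
    then show ?case using hom(2)[OF Ui[of x] Ui[of y]] by (simp add: qbar_mult const(2) val_simps(2))
  next
    case (inverse x)
    show ?case
    proof (cases "x = 0")
      case True
      have "\<psi> (val n (const 0) \<oplus>\<^bsub>Uq n\<^esub> val n (const 0)) = \<psi> (val n (const 0)) \<oplus>\<^bsub>Uq n\<^esub> \<psi> (val n (const 0))"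
        by (rule hom(3)[OF Ui Ui])
      then show ?thesis using True inverse by simp
    next
      case False
      then have "val n (const (inverse x)) \<otimes>\<^bsub>Uq n\<^esub> val n (const x) = val n (const 1)"
        by (simp flip: val_simps const(2))
      then have inv: "\<psi> (val n (const (inverse x))) \<otimes>\<^bsub>Uq n\<^esub> val n (const (qbar x)) = val n (const 1)"
        using hom(2)[OF Ui[of "inverse x"] Ui[of x]] one inverse by simp
      have "val n (const (qbar x)) \<otimes>\<^bsub>Uq n\<^esub> val n (const (inverse (qbar x))) = val n (const 1)"
        using False by (simp flip: val_simps const(2))
      moreover have "\<psi> (val n (const (inverse x))) \<in> carrier (Uq n)"
        using hom(1)[OF Ui] by (rule Ui_carrier)
      ultimately show ?thesis
        using inv by (simp add: qbar_inverse const(4) val_simps(6)) (metis m_assoc r_one l_one val_closed)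
    qed
  qed
qed

text \<open>
  The definition of \<open>bar\<close> asks for a unique automorphism. Conjugating the coefficients is well defined
  and has the required properties, and any other candidate agrees with it on scalars, hence on
  words, hence everywhere.
\<close>

lemma bar_val:
  assumes "over (words n) x"
  shows "bar n (val n x) = val n (coeff_bar x)"
proof -
  let ?U = "(Uq n)\<lparr>carrier := Ui n\<rparr>"
  \<comment> \<open>The value does not depend on the chosen preimage, by \<open>val_coeff_bar_cong\<close>.\<close>
  define \<beta> where "\<beta> X = (if X \<in> Ui n then val n (coeff_bar (SOME x. over (words n) x \<and> val n x = X)) else undefined)" for X
  have \<beta>: "\<beta> (val n x) = val n (coeff_bar x)" if "over (words n) x" for x
  proof -
    have "\<exists>y. over (words n) y \<and> val n y = val n x" using that by blast
    from someI_ex[OF this] have "val n (coeff_bar (SOME y. over (words n) y \<and> val n y = val n x)) = val n (coeff_bar x)"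
      using val_coeff_bar_cong that by blast
    then show ?thesis using that by (auto simp: \<beta>_def Ui_eq)
  qed
  let ?P = "\<lambda>\<psi>. \<psi> \<in> ring_iso ?U ?U \<and> \<psi> \<in> extensional (Ui n) \<and>
     (\<forall>i \<in> {1..n-1}. \<psi> (B_gen n i) = B_gen n i) \<and>
     \<psi> (qq \<odot>\<^bsub>Uq n\<^esub> \<one>\<^bsub>Uq n\<^esub>) = inverse qq \<odot>\<^bsub>Uq n\<^esub> \<one>\<^bsub>Uq n\<^esub>"
  have B: "B_gen n i = val n (letter i)" "over (words n) (letter i)" if "i \<in> {1..n-1}" for i
    using that by (auto simp: val_def letter_def scalar_id.ev_single B_gen_eq)
  have const: "over (words n) (const c)" for c by (simp add: const_def)
  have P: "?P \<beta>"
  proof (intro conjI ballI)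
    show "\<beta> \<in> extensional (Ui n)" by (simp add: \<beta>_def extensional_def)
    show "\<beta> (B_gen n i) = B_gen n i" if "i \<in> {1..n-1}" for i
      using B[OF that] by (simp add: \<beta>) (simp add: letter_def coeff_bar_single)
    show "\<beta> (qq \<odot>\<^bsub>Uq n\<^esub> \<one>\<^bsub>Uq n\<^esub>) = inverse qq \<odot>\<^bsub>Uq n\<^esub> \<one>\<^bsub>Uq n\<^esub>"
      using \<beta>[OF const] by (simp flip: val_simps(8)) (simp add: const_def coeff_bar_single)
    show "\<beta> \<in> ring_iso ?U ?U"
    proof (rule ring_iso_memI)
      show "\<beta> X \<in> carrier ?U" if "X \<in> carrier ?U" for X
        using that by (auto simp: Ui_eq \<beta>)
      show "\<beta> (X \<otimes>\<^bsub>?U\<^esub> Y) = \<beta> X \<otimes>\<^bsub>?U\<^esub> \<beta> Y" "\<beta> (X \<oplus>\<^bsub>?U\<^esub> Y) = \<beta> X \<oplus>\<^bsub>?U\<^esub> \<beta> Y"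
        if XY: "X \<in> carrier ?U" "Y \<in> carrier ?U" for X Y
      proof -
        obtain x y where "X = val n x" "over (words n) x" "Y = val n y" "over (words n) y"
          using XY by (auto simp: Ui_eq)
        then show "\<beta> (X \<otimes>\<^bsub>?U\<^esub> Y) = \<beta> X \<otimes>\<^bsub>?U\<^esub> \<beta> Y" "\<beta> (X \<oplus>\<^bsub>?U\<^esub> Y) = \<beta> X \<oplus>\<^bsub>?U\<^esub> \<beta> Y"
          by (simp_all add: \<beta> over_mult over_add coeff_bar_mult coeff_bar_add flip: val_simps)
      qed
      have "coeff_bar 1 = (1 :: nat free)"
        using coeff_bar_single[of "[]" 1] by (simp add: single_Nil)
      then show "\<beta> \<one>\<^bsub>?U\<^esub> = \<one>\<^bsub>?U\<^esub>"
        using \<beta>[of 1] by (simp add: val_simps zero_list_def)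
      have "\<beta> X \<in> Ui n \<and> \<beta> (\<beta> X) = X" if "X \<in> Ui n" for X
        using that by (auto simp: Ui_eq \<beta>)
      then show "bij_betw \<beta> (carrier ?U) (carrier ?U)"
        by (intro bij_betwI[of _ _ _ \<beta>]) auto
    qed
  qed
  have unique: "\<psi> = \<beta>" if "?P \<psi>" for \<psi>
  proof (rule extensionalityI[of _ "Ui n"])
    interpret ring "Uq n" by (rule ring_Uq)
    show "\<psi> \<in> extensional (Ui n)" "\<beta> \<in> extensional (Ui n)" using that P by auto
    have iso: "\<psi> \<in> ring_iso ?U ?U" using that by simp
    note hom = ring_iso_memE[OF iso, simplified]
    have Ui: "val n x \<in> Ui n" if "over (words n) x" for x using that by (auto simp: Ui_eq)
    have scalar: "\<psi> (val n (const c)) = val n (const (qbar c))" for c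
      using scalar_hom_eq_qbar[OF iso] that by (simp add: val_simps(8))
    have word: "\<psi> (val n (single w 1)) = val n (single w 1)" if "w \<in> words n" for w
      using that
    proof (induction w)
      case Nil
      then show ?case using hom(4) by (simp add: single_Nil val_simps)
    next
      case (Cons i w)
      have "single (i # w) 1 = letter i * single w (1 :: rat_q)"
        by (simp add: letter_def mult_single plus_list_def)
      moreover have i: "i \<in> {1..n-1}" using Cons.prems by auto
      then have "\<psi> (val n (letter i)) = val n (letter i)"
        using \<open>?P \<psi>\<close> unfolding B(1)[OF i, symmetric] by blast
      ultimately show ?case
        using Cons hom(2)[OF Ui Ui, of "letter i" "single w 1"] B(2)[OF i] by (simp add: val_simps)
    qed
    have sum: "\<psi> (val n (\<Sum>w\<in>S. single w (c w))) = val n (coeff_bar (\<Sum>w\<in>S. single w (c w)))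
       \<and> over (words n) (\<Sum>w\<in>S. single w (c w))"
      if "finite S" "S \<subseteq> words n" for S c
      using that
    proof (induction S)
      case empty
      have "(0 :: nat free) = const 0" by (simp add: const_def)
      then show ?case using scalar[of 0] by simp
    next
      case (insert w S)
      have w: "over (words n) (single w d)" for d :: rat_q using insert.prems by simp
      have "\<psi> (val n (single w (c w))) = val n (coeff_bar (single w (c w)))"
        using hom(2)[OF Ui[OF const] Ui[OF w], of "c w" 1] scalar word[of w] insert.prems
        unfolding coeff_bar_single by (subst (1 2) single_eq_const_mult) (simp flip: val_simps(2))
      then show ?case
        using insert hom(3)[OF Ui[OF w[of "c w"]] Ui, of "\<Sum>w\<in>S. single w (c w)"]
        by (simp add: val_simps(1) coeff_bar_add over_add)
    qed
    show "\<psi> X = \<beta> X" if X: "X \<in> Ui n" for X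
    proof -
      obtain x where x: "X = val n x" "over (words n) x" using X by (auto simp: Ui_eq)
      show ?thesis
        using sum[of "keys x" "lookup x"] x by (simp add: poly_mapping_sum_single \<beta>)
    qed
  qed
  have "bar n = \<beta>"
    unfolding bar_def using P unique by (intro the_equality) blast+
  then show ?thesis using \<beta>[OF assms] by simp
qed


section \<open>Brackets of normal words\<close>

lemma lex_less_prefix: "z \<noteq> [] \<Longrightarrow> lex_less x (x @ z)"
  using lex_less_append_left[of x "[]" z] by simp

lemma prefix_of_concat:
  assumes "p @ r = concat ls" "p \<noteq> []"
  shows "\<exists>y x z. p = y @ x \<and> x \<noteq> [] \<and> x @ z \<in> set ls"
  using assms
proof (induction ls arbitrary: p)
  case (Cons a ls)
  then consider z where "a = p @ z" | p' where "p = a @ p'" "p' @ r = concat ls"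
    by (auto simp: append_eq_append_conv2)
  then show ?case
  proof cases
    case 1
    then show ?thesis using Cons.prems by (intro exI[of _ "[]"] exI[of _ p] exI[of _ z]) simp
  next
    case 2
    show ?thesis
    proof (cases "p' = []")
      case True
      then show ?thesis using 2 Cons.prems by (intro exI[of _ "[]"] exI[of _ p]) auto
    next
      case False
      then obtain y x z where "p' = y @ x" "x \<noteq> []" "x @ z \<in> set ls" using Cons.IH[OF 2(2)] by blast
      then show ?thesis using 2 by (intro exI[of _ "a @ y"] exI[of _ x] exI[of _ z]) simp
    qed
  qed
qed simp

text \<open>
  If a Lyndon word \<open>m\<close> were longer than \<open>l\<close>, it would end in a nonempty prefix \<open>x\<close> of one of the later
  factors. Then \<open>m < x\<close> since \<open>m\<close> is Lyndon, and \<open>x\<close> is at most that factor, which is at most \<open>l\<close>, and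
  \<open>l < m\<close> as a proper prefix. So the first factor of a decreasing factorization is the longest
  Lyndon prefix, which makes the factorization unique.
\<close>

lemma lyndon_prefix_length:
  assumes m: "lyndon m" and l: "lyndon l"
    and sorted: "\<And>x. x \<in> set ls \<Longrightarrow> x = l \<or> lex_less x l"
    and eq: "m @ r = l @ concat ls"
  shows "length m \<le> length l"
proof (rule ccontr)
  assume "\<not> length m \<le> length l"
  then obtain p where p: "m = l @ p" "p @ r = concat ls" "p \<noteq> []"
    using eq by (auto simp: append_eq_append_conv2)
  then obtain y x z where x: "p = y @ x" "x \<noteq> []" "x @ z \<in> set ls"
    using prefix_of_concat by blast
  have "l \<noteq> []" using l by (simp add: lyndon_def)
  have "lex_less m x"
    using m x \<open>l \<noteq> []\<close> p(1) unfolding lyndon_def by (metis append.assoc append_is_Nil_conv)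
  moreover have "x = x @ z \<or> lex_less x (x @ z)"
    using lex_less_prefix[of z x] by auto
  moreover have "lex_less l m" using lex_less_prefix p by blast
  ultimately have "lex_less m m"
    using sorted[OF x(3)] lex_less_trans by metis
  then show False by simp
qed

lemma lyndon_factorization_unique:
  assumes "concat ls = concat ms" "\<forall>l\<in>set ls. lyndon l" "\<forall>l\<in>set ms. lyndon l"
    and "sorted_wrt (\<lambda>x y. x = y \<or> lex_less y x) ls" "sorted_wrt (\<lambda>x y. x = y \<or> lex_less y x) ms"
  shows "ls = ms"
  using assms
proof (induction ls arbitrary: ms)
  case Nil
  then show ?case by (cases ms) (auto simp: lyndon_def)
next
  case (Cons l ls)
  have "l \<noteq> []" using Cons.prems(2) by (simp add: lyndon_def)
  then have "ms \<noteq> []" using Cons.prems(1) by fastforce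
  then obtain m ms' where ms: "ms = m # ms'" by (cases ms) auto
  have eq: "l @ concat ls = m @ concat ms'" and l: "lyndon l" and m: "lyndon m"
    using Cons.prems ms by simp_all
  have below: "x = l \<or> lex_less x l" if "x \<in> set ls" for x
    using Cons.prems(4) that by auto
  have below': "x = m \<or> lex_less x m" if "x \<in> set ms'" for x
    using Cons.prems(5) that by (auto simp: ms)
  have "length m \<le> length l"
    using lyndon_prefix_length[OF m l below eq[symmetric]] .
  moreover have "length l \<le> length m"
    using lyndon_prefix_length[OF l m below' eq] .
  ultimately have "l = m" "concat ls = concat ms'"
    using Cons.prems(1) ms by auto
  then show ?case using Cons ms by auto
qed

lemma lyndon_upt: "i < j \<Longrightarrow> lyndon [i..<j]"
  unfolding lyndon_def
proof (intro conjI allI impI)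
  fix u v assume ij: "i < j" and uv: "[i..<j] = u @ v \<and> u \<noteq> [] \<and> v \<noteq> []"
  then have "v = drop (length u) [i..<j]" by simp
  then have v: "v = [i + length u..<j]" by (simp add: drop_upt)
  then have "i + length u < j" using uv by (metis leI upt_conv_Nil)
  then have "v = (i + length u) # [i + length u + 1..<j]" using v by (simp add: upt_conv_Cons)
  moreover have "[i..<j] = i # [i + 1..<j]" using ij by (simp add: upt_conv_Cons)
  moreover have "length u > 0" using uv by simp
  ultimately show "lex_less [i..<j] v" by (metis lex_less_Cons less_add_same_cancel1)
qed simp

lemma lyndon_factors_interval_word:
  assumes "normal_intervals n L"
  shows "lyndon_factors (interval_word L) = map (\<lambda>(i, j). [i..<j]) L"
  unfolding lyndon_factors_def
proof (rule the_equality)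
  let ?ls = "map (\<lambda>(i, j). [i..<j]) L"
  have mem: "i < j" if "(i, j) \<in> set L" for i j
    using assms that by (auto simp: normal_intervals_def)
  have "[fst r..<snd r] = [fst p..<snd p] \<or> lex_less [fst r..<snd r] [fst p..<snd p]"
    if pr: "p \<in> set L" "r \<in> set L" "interval_ge p r" for p r
  proof -
    obtain i j k l where p: "p = (i, j)" "r = (k, l)" by (metis surj_pair)
    then have "i < j" "k < l" using mem pr by auto
    consider "k < i" | "k = i" "l \<le> j" using pr p by (auto simp: interval_ge_def)
    then show ?thesis
    proof cases
      case 1
      then show ?thesis using \<open>i < j\<close> \<open>k < l\<close> p by (simp add: upt_conv_Cons)
    next
      case 2
      then have "[i..<j] = [k..<l] @ [l..<j]"
        using \<open>k < l\<close> upt_add_eq_append[of k l "j - l"] by simp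
      then show ?thesis using lex_less_prefix[of "[l..<j]" "[k..<l]"] p by (cases "l = j") auto
    qed
  qed
  moreover have "sorted_wrt interval_ge L" using assms by (simp add: normal_intervals_def)
  ultimately have sorted: "sorted_wrt (\<lambda>x y. x = y \<or> lex_less y x) ?ls"
    unfolding sorted_wrt_map case_prod_beta by (elim sorted_wrt_mono_rel[rotated]) metis
  have lyndon: "\<forall>l\<in>set ?ls. lyndon l" using lyndon_upt mem by auto
  show P: "concat ?ls = interval_word L \<and> (\<forall>l\<in>set ?ls. lyndon l)
      \<and> sorted_wrt (\<lambda>x y. x = y \<or> lex_less y x) ?ls"
    using sorted lyndon by (simp add: interval_word_def)
  show "ls = ?ls" if "concat ls = interval_word L \<and> (\<forall>l\<in>set ls. lyndon l)
      \<and> sorted_wrt (\<lambda>x y. x = y \<or> lex_less y x) ls" for ls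
    by (rule lyndon_factorization_unique) (use P that in auto)
qed

lemma split_length_upt: "split_length [i..<i + k + 2] = k + 1"
proof -
  have "lyndon (take m [i..<i + k + 2])" if "0 < m" "m < k + 2" for m
    using that lyndon_upt[of i "i + m"] by (simp add: take_upt del: upt_Suc)
  then have set: "{m. 0 < m \<and> m < length [i..<i + k + 2] \<and> lyndon (take m [i..<i + k + 2])} = {1..k + 1}"
    by (auto simp del: upt_Suc)
  show ?thesis
    unfolding split_length_def set by (rule Max_eqI) auto
qed

lemma qbracket_letter:
  "qbracket x (letter c) = x * letter c
    - (\<Sum>u\<in>keys x. const (lookup x u * qq powi (- weight_form u [c]))
        * single (c # u) 1)"
proof -
  let ?l = "lookup x"
  have "qbracket x (letter c) = (\<Sum>u\<in>keys x.
      single u (?l u) * letter c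
      - const (?l u * qq powi (- weight_form u [c])) * single (c # u) 1)"
    unfolding qbracket_def letter_def
    by (intro sum.cong) (simp_all add: right_diff_distrib const_def mult_single plus_list_def)
  then show ?thesis
    by (simp add: sum_subtractf poly_mapping_sum_single flip: sum_distrib_right)
qed

text \<open>
  The longest proper Lyndon prefix of an interval omits its last letter \<open>c\<close>. In the bracket with
  \<open>c\<close>, the words that begin with \<open>c\<close> are lexicographically larger than the interval.
\<close>

lemma leading_lyndon_bracket:
  assumes "1 \<le> i" "i + k < n"
  shows "leading n [i..<i + k + 1] (lyndon_bracket [i..<i + k + 1])"
  using assms(2)
proof (induction k)
  case 0
  then show ?case by (subst lyndon_bracket.simps) (simp add: leading_single)
next
  case (Suc k)
  let ?w = "[i..<i + k + 1]" and ?c = "i + k + 1"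
  define x where "x = lyndon_bracket ?w"
  have IH: "leading n ?w x" using Suc unfolding x_def by simp
  have w: "?w \<in> words n" "[?c] \<in> words n" using assms Suc.prems by auto
  have split: "take (k + 1) [i..<i + k + 2] = ?w" "drop (k + 1) [i..<i + k + 2] = [?c]"
    by (simp_all add: take_upt drop_upt del: upt_Suc) simp
  have "lyndon_bracket [?c] = letter ?c"
    by (subst lyndon_bracket.simps) (simp add: letter_def)
  then have "lyndon_bracket [i..<i + k + 2] = qbracket x (letter ?c)"
    by (subst lyndon_bracket.simps) (simp only: split_length_upt split x_def, simp)
  moreover have "leading n (?w @ [?c]) (qbracket x (letter ?c))"
    unfolding qbracket_letter
  proof (intro leading_diff leading_mult IH leading_letter w intspan_sum intspan_const_mult laurent_mult laurent_powi)
    fix u assume "u \<in> keys x"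
    then have "u \<in> {?w} \<union> below n ?w"
      using keys_add[of "x - single ?w 1" "single ?w 1"]
        intspan_keys[OF IH[unfolded leading_def]] by (auto simp del: upt_Suc)
    then have u: "u \<in> words n" "prec_eq u ?w" using w by (auto simp: below_def simp del: upt_Suc)
    have "prec ([?c] @ ?w) (?w @ [?c])"
      by (simp add: prec_def upt_conv_Cons del: upt_Suc)
    then have "prec (?c # u) (?w @ [?c])"
      using u(2) prec_append_left[of u ?w "[?c]"] prec_trans by auto
    then show "single (?c # u) 1 \<in> intspan (below n (?w @ [?c]))"
      using u w by (intro intspan_single) (auto simp: below_def)
    have "lookup (x - single ?w 1) u \<in> Z_q_qinv"
      using IH unfolding leading_def by (rule intspan_lookup)
    then have "lookup (x - single ?w 1) u + lookup (single ?w 1) u \<in> Z_q_qinv"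
      by (intro laurent_add) (auto simp: lookup_single when_def)
    then show "lookup x u \<in> Z_q_qinv"
      by (simp add: lookup_minus)
  qed
  ultimately show ?case by simp
qed

lemma leading_bracket:
  assumes "g \<in> normal_words n"
  shows "leading n g (bracket g)"
proof -
  obtain L where L: "g = interval_word L" "normal_intervals n L"
    using assms by (auto simp: normal_words_def)
  have "leading n (interval_word L) (prod_list (map lyndon_bracket (map (\<lambda>(i, j). [i..<j]) L)))"
    using L(2)
  proof (induction L)
    case Nil
    then show ?case using leading_single[of n "[]"] by (simp add: single_Nil)
  next
    case (Cons p L)
    obtain i j where p: "p = (i, j)" by force
    have ij: "1 \<le> i" "i < j" "j \<le> n" and L: "normal_intervals n L"
      using Cons.prems by (auto simp: p normal_intervals_Cons)
    obtain k where k: "j = i + k + 1" using ij(2) less_iff_Suc_add by auto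
    have "leading n [i..<j] (lyndon_bracket [i..<j])"
      using leading_lyndon_bracket[of i k n] ij unfolding k by simp
    moreover have "interval_word L \<in> words n"
      using L by (intro normal_in_words) (auto simp: normal_words_def)
    ultimately show ?case
      using leading_mult[OF _ Cons.IH[OF L]] ij by (simp add: p)
  qed
  then show ?thesis
    unfolding bracket_def L(1) lyndon_factors_interval_word[OF L(2)] .
qed

lemma leading_over: "leading n w x \<Longrightarrow> w \<in> words n \<Longrightarrow> over (words n) x"
proof -
  assume "leading n w x" "w \<in> words n"
  then have "over (words n) (x - single w 1)"
    using intspan_keys below_words unfolding leading_def by blast
  then have "over (words n) ((x - single w 1) + single w 1)"
    using \<open>w \<in> words n\<close> by (intro over_add) auto
  then show ?thesis by simp
qed

lemma B_bracket_eq: "g \<in> normal_words n \<Longrightarrow> B_bracket n g = val n (bracket g)"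
  unfolding B_bracket_def using leading_over[OF leading_bracket normal_in_words] by (intro B_lin_eq)


section \<open>Unitriangular families and the canonical basis\<close>

definition nbelow :: "nat \<Rightarrow> word \<Rightarrow> word set" where
  "nbelow n g = {h \<in> normal_words n. prec h g}"

lemma finite_nbelow [simp]: "finite (nbelow n g)"
  by (rule finite_subset[OF _ finite_below[of n g]]) (auto simp: nbelow_def below_def normal_in_words)

lemma nbelow_mono: "h \<in> nbelow n g \<Longrightarrow> nbelow n h \<subseteq> nbelow n g"
  unfolding nbelow_def using prec_trans by blast

definition unitriangular :: "nat \<Rightarrow> word \<Rightarrow> nat free \<Rightarrow> bool" where
  "unitriangular n g x \<longleftrightarrow> x - single g 1 \<in> intspan (nbelow n g)"

lemma const_sum: "const (sum f S) = (\<Sum>i\<in>S. const (f i) :: 'a free)"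
  by (induction S rule: infinite_finite_induct) (simp_all add: const_simps)

lemma unitriangular_lookup:
  assumes "unitriangular n g x"
  shows "lookup x g = 1" "lookup x h \<noteq> 0 \<Longrightarrow> h = g \<or> h \<in> nbelow n g"
proof -
  have keys: "keys (x - single g 1) \<subseteq> nbelow n g"
    using assms intspan_keys by (auto simp: unitriangular_def)
  then have "g \<notin> keys (x - single g 1)"
    by (auto simp: nbelow_def)
  then show "lookup x g = 1"
    by (simp add: in_keys_iff lookup_minus)
  show "h = g \<or> h \<in> nbelow n g" if "lookup x h \<noteq> 0"
  proof (rule disjCI)
    assume "h \<notin> nbelow n g"
    then have "h \<notin> keys (x - single g 1)" using keys by blast
    then show "h = g" using that by (auto simp: in_keys_iff lookup_minus lookup_single when_def split: if_splits)
  qed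
qed

lemma unitriangular_over:
  assumes "unitriangular n g x" "g \<in> normal_words n"
  shows "over (normal_words n) x"
  using unitriangular_lookup(2)[OF assms(1)] assms(2) by (auto simp: in_keys_iff nbelow_def)

lemma comb_lookup_maximal:
  assumes c: "\<And>g. g \<in> keys x \<Longrightarrow> unitriangular n g (c g)"
    and h: "h \<in> keys x" "\<And>g. g \<in> keys x \<Longrightarrow> prec_eq g h"
  shows "lookup (comb c x) h = lookup x h"
proof -
  have "lookup (c g) h = 0" if g: "g \<in> keys x" "g \<noteq> h" for g
  proof (rule ccontr)
    assume "lookup (c g) h \<noteq> 0"
    then have "prec h g" using unitriangular_lookup(2)[OF c[OF g(1)]] g(2) by (auto simp: nbelow_def)
    then have "prec h h" using h(2)[OF g(1)] g(2) prec_trans by blast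
    then show False by simp
  qed
  then have "(\<Sum>g\<in>keys x. lookup x g * lookup (c g) h)
    = (\<Sum>g\<in>{h}. lookup x g * lookup (c g) h)"
    using h(1) by (intro sum.mono_neutral_right) auto
  then show ?thesis
    using unitriangular_lookup(1)[OF c[OF h(1)]] by (simp add: comb_def lookup_sum lookup_const_mult)
qed

lemma comb_inj:
  assumes c: "\<And>g. g \<in> normal_words n \<Longrightarrow> unitriangular n g (c g)"
    and xy: "over (normal_words n) x" "over (normal_words n) y" "comb c x = comb c y"
  shows "x = y"
proof (rule ccontr)
  assume "x \<noteq> y"
  then have "keys (x - y) \<noteq> {}" by simp
  then obtain h where h: "h \<in> keys (x - y)"
    "\<And>g. g \<in> keys (x - y) \<Longrightarrow> prec_eq g h"
    using prec_maximal[OF finite_keys] by metis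
  have "over (normal_words n) (x - y)" using xy keys_diff[of x y] by blast
  then have "lookup (comb c (x - y)) h = lookup (x - y) h"
    using c h by (intro comb_lookup_maximal) blast+
  then show False using h(1) xy(3) by (simp add: comb_diff in_keys_iff)
qed

text \<open>
  Unitriangular families over \<open>\<int>[q, q\<^sup>-\<^sup>1]\<close> are inverted integrally, by induction along \<open>prec\<close>.
\<close>

lemma comb_invert:
  assumes "g \<in> words n" "y \<in> intspan (nbelow n g)"
    and c: "\<And>h. h \<in> normal_words n \<Longrightarrow> prec h g \<Longrightarrow> unitriangular n h (c h)"
  shows "\<exists>x\<in>intspan (nbelow n g). comb c x = y"
  using assms
proof (induction g arbitrary: y rule: prec_induct)
  case (less g)
  have "\<forall>h\<in>nbelow n g. \<exists>x. x \<in> intspan (nbelow n g) \<and> comb c x = single h 1"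
  proof
    fix h assume h_below: "h \<in> nbelow n g"
    then have h: "h \<in> normal_words n" "prec h g" by (auto simp: nbelow_def)
    have "unitriangular n h (c h)" using less.prems(2) h by blast
    moreover have "\<And>u. u \<in> normal_words n \<Longrightarrow> prec u h \<Longrightarrow> unitriangular n u (c u)"
      using less.prems(2) prec_trans h(2) by blast
    ultimately obtain x where x: "x \<in> intspan (nbelow n h)" "comb c x = c h - single h 1"
      using less.IH[OF normal_in_words[OF h(1)] h(2)] unfolding unitriangular_def by blast
    have "comb c (single h 1 - x) = single h 1"
      by (simp add: comb_diff comb_single const_simps x(2))
    moreover have "single h 1 - x \<in> intspan (nbelow n g)"
      using intspan_mono[OF x(1) nbelow_mono[OF h_below]] h_below by (intro intspan_diff intspan_single) auto
    ultimately show "\<exists>x. x \<in> intspan (nbelow n g) \<and> comb c x = single h 1" by blast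
  qed
  from bchoice[OF this] obtain x where x: "\<And>h. h \<in> nbelow n g \<Longrightarrow> x h \<in> intspan (nbelow n g)"
    "\<And>h. h \<in> nbelow n g \<Longrightarrow> comb c (x h) = single h 1"
    by blast
  have "comb x y \<in> intspan (nbelow n g)"
    using less.prems(1) x(1) by (rule intspan_comb)
  moreover have "comb c (comb x y) = comb (\<lambda>h. single h 1) y"
    unfolding comb_comb using intspan_keys[OF less.prems(1)] x(2) by (intro comb_cong) blast
  then have "comb c (comb x y) = y" by (simp only: comb_words)
  ultimately show ?case by blast
qed

lemma coeff_bar_const_mult: "coeff_bar (const a * x) = const (qbar a) * coeff_bar x"
  by (rule poly_mapping_eqI) (simp add: lookup_const_mult qbar_mult)

text \<open>
  The conditions on a canonical basis element in coordinates with respect to the good words; \<open>m g\<close> are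
  the coordinates of the bracketed word \<open>g\<close>.
\<close>

definition canonical :: "nat \<Rightarrow> (word \<Rightarrow> nat free) \<Rightarrow> word \<Rightarrow> nat free \<Rightarrow> bool" where
  "canonical n m g c \<longleftrightarrow> coeff_bar c = c \<and>
     (\<exists>p. (\<forall>h\<in>nbelow n g. p h \<in> q_Z_q) \<and> c = m g + (\<Sum>h\<in>nbelow n g. const (p h) * m h))"

text \<open>
  The difference of two candidates is bar invariant, and its coordinate at the largest word that
  occurs lies in \<open>q\<int>[q]\<close>.
\<close>

lemma canonical_unique:
  assumes m: "\<And>g. g \<in> normal_words n \<Longrightarrow> unitriangular n g (m g)"
    and c: "canonical n m g c" "canonical n m g c'"
  shows "c = c'"
proof -
  let ?N = "nbelow n g"
  obtain p where p: "\<forall>h\<in>?N. p h \<in> q_Z_q" "c = m g + (\<Sum>h\<in>?N. const (p h) * m h)"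
    using c(1) unfolding canonical_def by (elim conjE exE)
  obtain p' where p': "\<forall>h\<in>?N. p' h \<in> q_Z_q" "c' = m g + (\<Sum>h\<in>?N. const (p' h) * m h)"
    using c(2) unfolding canonical_def by (elim conjE exE)
  define x where "x = (\<Sum>h\<in>?N. single h (p h - p' h))"
  have x: "comb m x = c - c'"
    unfolding x_def p(2) p'(2)
    by (simp add: comb_sum comb_single const_simps left_diff_distrib sum_subtractf)
  have look: "lookup x h = (if h \<in> ?N then p h - p' h else 0)" for h
    by (simp add: x_def lookup_sum lookup_single when_def)
  have keys: "keys x \<subseteq> ?N"
    by (auto simp: in_keys_iff look split: if_splits)
  have "x = 0"
  proof (rule ccontr)
    assume "x \<noteq> 0"
    then have "keys x \<noteq> {}" by simp
    then obtain h where h: "h \<in> keys x" "\<And>g. g \<in> keys x \<Longrightarrow> prec_eq g h"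
      using prec_maximal[OF finite_keys] by metis
    have "unitriangular n h (m h)" if "h \<in> keys x" for h
      using that keys m by (auto simp: nbelow_def)
    then have max: "lookup (comb m x) h = lookup x h"
      using h by (rule comb_lookup_maximal)
    have "coeff_bar (comb m x) = comb m x"
      using c by (simp add: x coeff_bar_diff canonical_def)
    then have "qbar (lookup x h) = lookup x h"
      using max by (metis lookup_coeff_bar)
    moreover have "lookup x h \<in> q_Z_q"
      using q_Z_q_add[OF bspec[OF p(1)] q_Z_q_minus[OF bspec[OF p'(1)]], of h h] by (simp add: look)
    ultimately have "lookup x h = 0" by (rule q_Z_q_qbar_fixed[rotated])
    then show False using h(1) by (simp add: in_keys_iff)
  qed
  then have "comb m x = 0" by (simp add: comb_def)
  then show ?thesis by (simp add: x)
qed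

text \<open>
  The word \<open>g\<close> itself is bar invariant. Written as \<open>m g + \<Sum> a h c h\<close> with the canonical elements
  \<open>c h\<close> of smaller words, it becomes canonical when the bar invariant parts of the \<open>a h\<close> are
  subtracted.
\<close>

lemma canonical_exists:
  assumes m: "\<And>g. g \<in> normal_words n \<Longrightarrow> unitriangular n g (m g)" and g: "g \<in> normal_words n"
  shows "\<exists>c. canonical n m g c \<and> unitriangular n g c"
  using normal_in_words[OF g] g
proof (induction g rule: prec_induct)
  case (less g)
  let ?N = "nbelow n g" and ?g = "single g 1"
  have "\<forall>h\<in>?N. \<exists>c. canonical n m h c \<and> unitriangular n h c"
    using less.IH normal_in_words unfolding nbelow_def by blast
  from bchoice[OF this] obtain c where c: "\<And>h. h \<in> ?N \<Longrightarrow> canonical n m h (c h)"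
    "\<And>h. h \<in> ?N \<Longrightarrow> unitriangular n h (c h)"
    by blast
  have "- (m g - ?g) \<in> intspan ?N"
    using m[OF less.prems] unfolding unitriangular_def by (rule intspan_minus)
  moreover have "\<And>h. h \<in> normal_words n \<Longrightarrow> prec h g \<Longrightarrow> unitriangular n h (c h)"
    using c(2) by (simp add: nbelow_def)
  ultimately obtain a where a: "a \<in> intspan ?N" "comb c a = ?g - m g"
    using comb_invert[OF less.hyps, of "- (m g - ?g)" c] by auto
  have "\<forall>h. \<exists>s p. lookup a h = s + p \<and> s \<in> Z_q_qinv \<and> qbar s = s \<and> p \<in> q_Z_q"
    using laurent_decompose[OF intspan_lookup[OF a(1)]] by metis
  then obtain s p where sp: "\<And>h. lookup a h = s h + p h" "\<And>h. s h \<in> Z_q_qinv"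
    "\<And>h. qbar (s h) = s h" "\<And>h. p h \<in> q_Z_q"
    by metis
  have comb_a: "comb c a = (\<Sum>h\<in>?N. const (s h) * c h) + (\<Sum>h\<in>?N. const (p h) * c h)"
    using intspan_keys[OF a(1)] by (simp add: comb_superset[of ?N] sp(1) const_simps distrib_right sum.distrib)
  define d where "d = ?g - (\<Sum>h\<in>?N. const (s h) * c h)"
  have d: "d = m g + (\<Sum>h\<in>?N. const (p h) * c h)"
    using a(2) comb_a by (simp add: d_def algebra_simps)
  have "\<forall>h\<in>?N. \<exists>P. (\<forall>u\<in>nbelow n h. P u \<in> q_Z_q) \<and> c h = m h + (\<Sum>u\<in>nbelow n h. const (P u) * m u)"
    using c(1) unfolding canonical_def by blast
  from bchoice[OF this] obtain P where P: "\<And>h u. h \<in> ?N \<Longrightarrow> u \<in> nbelow n h \<Longrightarrow> P h u \<in> q_Z_q"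
    "\<And>h. h \<in> ?N \<Longrightarrow> c h = m h + (\<Sum>u\<in>nbelow n h. const (P h u) * m u)"
    by blast
  \<comment> \<open>The coordinates of \<open>c h\<close> with respect to the family \<open>m\<close>.\<close>
  define R where "R h u = (if u = h then 1 else if u \<in> nbelow n h then P h u else 0)" for h u
  have c_m: "c h = (\<Sum>u\<in>?N. const (R h u) * m u)" if h: "h \<in> ?N" for h
  proof -
    have "h \<notin> nbelow n h" by (simp add: nbelow_def)
    then have "(\<Sum>u\<in>insert h (nbelow n h). const (R h u) * m u) = m h + (\<Sum>u\<in>nbelow n h. const (P h u) * m u)"
      by (subst sum.insert) (auto simp: R_def const_simps intro!: sum.cong)
    moreover have "(\<Sum>u\<in>insert h (nbelow n h). const (R h u) * m u) = (\<Sum>u\<in>?N. const (R h u) * m u)"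
      using h nbelow_mono[OF h] by (intro sum.mono_neutral_left) (auto simp: R_def const_simps)
    ultimately show ?thesis using P(2)[OF h] by simp
  qed
  have "(\<Sum>h\<in>?N. const (p h) * c h) = (\<Sum>h\<in>?N. \<Sum>u\<in>?N. const (p h * R h u) * m u)"
    by (rule sum.cong) (simp_all add: c_m sum_distrib_left const_simps mult.assoc)
  also have "\<dots> = (\<Sum>u\<in>?N. const (\<Sum>h\<in>?N. p h * R h u) * m u)"
    by (subst sum.swap) (simp add: const_sum sum_distrib_right)
  finally have d': "d = m g + (\<Sum>u\<in>?N. const (\<Sum>h\<in>?N. p h * R h u) * m u)" using d by simp
  have "R h u \<in> Z_q" if "h \<in> ?N" for h u
    using P(1)[OF that] q_Z_q_Z_q Z_q_of_int[of 1] Z_q_of_int[of 0] by (auto simp: R_def)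
  then have "\<forall>u\<in>?N. (\<Sum>h\<in>?N. p h * R h u) \<in> q_Z_q"
    by (intro ballI q_Z_q_sum q_Z_q_mult sp(4))
  moreover have "coeff_bar d = d"
    using c(1) sp(3) by (simp add: d_def coeff_bar_diff coeff_bar_sum coeff_bar_single coeff_bar_const_mult canonical_def)
  ultimately have "canonical n m g d"
    unfolding canonical_def using d' by (intro conjI exI[of _ "\<lambda>u. \<Sum>h\<in>?N. p h * R h u"])
  moreover have "(\<Sum>h\<in>?N. const (s h) * c h) \<in> intspan ?N"
  proof (intro intspan_sum intspan_const_mult sp(2))
    fix h assume h: "h \<in> ?N"
    have "(c h - single h 1) + single h 1 \<in> intspan ?N"
      using c(2)[OF h] nbelow_mono[OF h] h unfolding unitriangular_def
      by (intro intspan_add intspan_single) (auto elim: intspan_mono)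
    then show "c h \<in> intspan ?N" by simp
  qed
  then have "unitriangular n g d"
    unfolding unitriangular_def d_def by (simp add: intspan_minus)
  ultimately show ?case by blast
qed


section \<open>The theorem\<close>

text \<open>
  The smaller words in the bracket need not be good; rewriting them changes the combination of words,
  but not its value.
\<close>

lemma bracket_unitriangular:
  assumes g: "g \<in> normal_words n"
  shows "\<exists>m. unitriangular n g m \<and> val n m = val n (bracket g)"
proof -
  let ?y = "bracket g - single g 1"
  have y: "?y \<in> intspan (below n g)"
    using leading_bracket[OF g] by (simp add: leading_def)
  have "\<forall>w\<in>below n g. \<exists>x. x \<in> intspan (nbelow n g) \<and> val n (single w 1) = val n x"
  proof
    fix w assume "w \<in> below n g"
    then have w: "w \<in> words n" "prec w g" by (auto simp: below_def)
    have sub: "{h \<in> normal_words n. prec_eq h w} \<subseteq> nbelow n g"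
      using w(2) prec_trans unfolding nbelow_def by blast
    obtain x where "x \<in> intspan {h \<in> normal_words n. prec_eq h w}" "B_word n w = val n x"
      using normal_span_word[OF w(1)] by blast
    then show "\<exists>x. x \<in> intspan (nbelow n g) \<and> val n (single w 1) = val n x"
      using intspan_mono[OF _ sub] B_word_eq[OF w(1)] by auto
  qed
  from bchoice[OF this] obtain x where x: "\<And>w. w \<in> below n g \<Longrightarrow> x w \<in> intspan (nbelow n g)"
    "\<And>w. w \<in> below n g \<Longrightarrow> val n (single w 1) = val n (x w)"
    by blast
  define z where "z = comb x ?y"
  have z: "z \<in> intspan (nbelow n g)"
    unfolding z_def using y x(1) by (rule intspan_comb)
  have "val n z = val n (comb (\<lambda>w. single w 1) ?y)"
    unfolding z_def using intspan_keys[OF y] x(2) by (intro val_comb_cong) auto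
  also have "\<dots> = val n ?y" by (simp only: comb_words)
  finally have "val n (single g 1 + z) = val n (single g 1 + ?y)"
    by (simp only: val_simps(1))
  then have "val n (single g 1 + z) = val n (bracket g)" by simp
  moreover have "unitriangular n g (single g 1 + z)"
    using z by (simp add: unitriangular_def)
  ultimately show ?thesis by blast
qed

theorem integrality:
  assumes w: "w \<in> words n"
  shows "\<exists>c. (\<forall>g \<in> good n. prec_eq g w \<longrightarrow> c g \<in> Z_q_qinv) \<and>
        B_word n w = (\<Oplus>\<^bsub>Uq n\<^esub>g \<in> {g \<in> good n. prec_eq g w}. c g \<odot>\<^bsub>Uq n\<^esub> B_word n g)"
proof -
  let ?S = "{g \<in> normal_words n. prec_eq g w}"
  obtain x where x: "x \<in> intspan ?S" "B_word n w = val n x"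
    using normal_span_word[OF w] by blast
  have fin: "finite ?S"
    by (rule finite_subset[OF _ finite.insertI[OF finite_below[of n w], of w]]) (auto simp: below_def normal_in_words)
  have "(\<Oplus>\<^bsub>Uq n\<^esub>g\<in>?S. lookup x g \<odot>\<^bsub>Uq n\<^esub> B_word n g)
      = val n (\<Sum>g\<in>?S. const (lookup x g) * single g 1)"
    using fin by (rule finsum_eq_val) (auto simp: B_word_eq normal_in_words)
  also have "(\<Sum>g\<in>?S. const (lookup x g) * single g 1) = x"
  proof -
    have "(\<Sum>g\<in>?S. single g (lookup x g))
      = (\<Sum>g\<in>keys x. single g (lookup x g))"
      using fin intspan_keys[OF x(1)] by (intro sum.mono_neutral_right) (auto simp: in_keys_iff)
    then show ?thesis by (simp add: poly_mapping_sum_single flip: single_eq_const_mult)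
  qed
  finally show ?thesis
    using x intspan_lookup[OF x(1)] unfolding good_eq_normal
    by (intro exI[of _ "lookup x"]) auto
qed

lemma is_basis_unitriangular:
  assumes c: "\<And>g. g \<in> normal_words n \<Longrightarrow> unitriangular n g (c g)"
    and C: "\<And>g. g \<in> normal_words n \<Longrightarrow> C g = val n (c g)"
  shows "is_basis (Uq n) (Ui n) (normal_words n) C"
  unfolding is_basis_def
proof (intro conjI ballI)
  have over_words: "over (words n) x" if "over (normal_words n) x" for x
    using that normal_in_words by blast
  show "C g \<in> Ui n" if "g \<in> normal_words n" for g
    using that C unitriangular_over[OF c[OF that] that] over_words by (auto simp: Ui_eq)
  have lin: "(\<Oplus>\<^bsub>Uq n\<^esub>i\<in>keys x. lookup x i \<odot>\<^bsub>Uq n\<^esub> C i) = val n (comb c x)"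
    if "over (normal_words n) x" for x
    unfolding comb_def using that C by (intro finsum_eq_val) auto
  have over_c: "over (normal_words n) (comb c x)" if "over (normal_words n) x" for x
    using that unitriangular_over[OF c] by (intro over_comb) blast
  fix X assume "X \<in> Ui n"
  then obtain y where y: "over (normal_words n) y" "X = val n y"
    unfolding Ui_eq using val_normal by blast
  have "\<forall>g\<in>normal_words n. \<exists>x. over (normal_words n) x \<and> comb c x = single g 1"
  proof
    fix g assume g: "g \<in> normal_words n"
    obtain x where x: "x \<in> intspan (nbelow n g)" "comb c x = c g - single g 1"
      using comb_invert[OF normal_in_words[OF g] c[OF g, unfolded unitriangular_def], of c] c by blast
    have "comb c (single g 1 - x) = single g 1"
      by (simp add: comb_diff comb_single const_simps x(2))
    moreover have "over (normal_words n) (single g 1 - x)"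
      using keys_diff[of "single g 1" x] intspan_keys[OF x(1)] g by (auto simp: nbelow_def)
    ultimately show "\<exists>x. over (normal_words n) x \<and> comb c x = single g 1" by blast
  qed
  from bchoice[OF this] obtain x where x: "\<And>g. g \<in> normal_words n \<Longrightarrow> over (normal_words n) (x g)"
    "\<And>g. g \<in> normal_words n \<Longrightarrow> comb c (x g) = single g 1"
    by blast
  define z where "z = comb x y"
  have z: "over (normal_words n) z"
    unfolding z_def using y(1) x(1) by (intro over_comb) blast
  have "comb c z = comb (\<lambda>g. single g 1) y"
    unfolding z_def comb_comb using y(1) x(2) by (intro comb_cong) blast
  then have "comb c z = y" by (simp only: comb_words)
  show "\<exists>!x. keys x \<subseteq> normal_words n \<and>
      X = (\<Oplus>\<^bsub>Uq n\<^esub>i\<in>keys x. lookup x i \<odot>\<^bsub>Uq n\<^esub> C i)"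
  proof (rule ex1I[of _ z])
    show "over (normal_words n) z \<and> X = (\<Oplus>\<^bsub>Uq n\<^esub>i\<in>keys z. lookup z i \<odot>\<^bsub>Uq n\<^esub> C i)"
      using z lin[OF z] y(2) \<open>comb c z = y\<close> by simp
    fix z' assume z': "over (normal_words n) z' \<and>
      X = (\<Oplus>\<^bsub>Uq n\<^esub>i\<in>keys z'. lookup z' i \<odot>\<^bsub>Uq n\<^esub> C i)"
    then have "val n (comb c z') = val n (comb c z)"
      using lin[of z'] y(2) \<open>comb c z = y\<close> by simp
    then have "comb c z' = comb c z"
      using z z' over_c by (intro val_inj_normal) blast+
    then show "z' = z" using z z' by (intro comb_inj[of n c z' z] c conjunct1[OF z'])
  qed
qed

theorem canonical_basis:
  "\<exists>!C. C \<in> extensional (good n) \<and> is_basis (Uq n) (Ui n) (good n) C \<and>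
     (\<forall>g \<in> good n. bar n (C g) = C g \<and>
        (\<exists>p. (\<forall>w \<in> good n. prec w g \<longrightarrow> p w \<in> q_Z_q) \<and>
           C g = B_bracket n g \<oplus>\<^bsub>Uq n\<^esub>
             (\<Oplus>\<^bsub>Uq n\<^esub>w \<in> {w \<in> good n. prec w g}. p w \<odot>\<^bsub>Uq n\<^esub> B_bracket n w)))"
  (is "\<exists>!C. ?P C")
proof -
  have "\<forall>g\<in>normal_words n. \<exists>m. unitriangular n g m \<and> val n m = val n (bracket g)"
    using bracket_unitriangular by (intro ballI)
  from bchoice[OF this] obtain m where
    "\<forall>g\<in>normal_words n. unitriangular n g (m g) \<and> val n (m g) = val n (bracket g)"
    by (elim exE)
  then have m: "\<And>g. g \<in> normal_words n \<Longrightarrow> unitriangular n g (m g)"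
    "\<And>g. g \<in> normal_words n \<Longrightarrow> B_bracket n g = val n (m g)"
    by (simp_all add: B_bracket_eq)
  have "\<forall>g\<in>normal_words n. \<exists>c. canonical n m g c \<and> unitriangular n g c"
    using canonical_exists[OF m(1)] by (intro ballI)
  from bchoice[OF this] obtain c where c: "\<And>g. g \<in> normal_words n \<Longrightarrow> canonical n m g (c g)"
    "\<And>g. g \<in> normal_words n \<Longrightarrow> unitriangular n g (c g)"
    by blast
  have over_words: "over (words n) x" if "over (normal_words n) x" for x
    using that normal_in_words by blast
  have expand: "B_bracket n g \<oplus>\<^bsub>Uq n\<^esub> (\<Oplus>\<^bsub>Uq n\<^esub>w \<in> {w \<in> normal_words n. prec w g}. p w \<odot>\<^bsub>Uq n\<^esub> B_bracket n w)
      = val n (m g + (\<Sum>h\<in>nbelow n g. const (p h) * m h))" if "g \<in> normal_words n" for g p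
    using that finsum_eq_val[OF finite_nbelow, of n g "B_bracket n" n m p] m(2)
    by (simp add: val_simps(1) nbelow_def)
  define C where "C = restrict (\<lambda>g. val n (c g)) (normal_words n)"
  have "?P C"
    unfolding good_eq_normal
  proof (intro conjI ballI)
    show "C \<in> extensional (normal_words n)" by (simp add: C_def)
    show "is_basis (Uq n) (Ui n) (normal_words n) C"
      using c(2) by (rule is_basis_unitriangular) (simp_all add: C_def)
  next
    fix g assume g: "g \<in> normal_words n"
    then have "over (words n) (c g)" using unitriangular_over[OF c(2)] over_words by blast
    then show "bar n (C g) = C g"
      using c(1)[OF g] g by (simp add: C_def bar_val canonical_def)
    obtain p where p: "\<forall>h\<in>nbelow n g. p h \<in> q_Z_q" "c g = m g + (\<Sum>h\<in>nbelow n g. const (p h) * m h)"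
      using c(1)[OF g] unfolding canonical_def by blast
    then show "\<exists>p. (\<forall>w \<in> normal_words n. prec w g \<longrightarrow> p w \<in> q_Z_q) \<and>
              C g = B_bracket n g \<oplus>\<^bsub>Uq n\<^esub>
                (\<Oplus>\<^bsub>Uq n\<^esub>w \<in> {w \<in> normal_words n. prec w g}. p w \<odot>\<^bsub>Uq n\<^esub> B_bracket n w)"
      using g by (intro exI[of _ p]) (simp add: expand C_def nbelow_def)
  qed
  moreover have "C' = C" if P: "?P C'" for C'
  proof (rule extensionalityI[of _ "normal_words n"])
    note C' = P[unfolded good_eq_normal]
    show "C' \<in> extensional (normal_words n)" "C \<in> extensional (normal_words n)"
      using C' by (simp_all add: C_def)
    fix g assume g: "g \<in> normal_words n"
    then obtain p where p: "\<forall>w \<in> normal_words n. prec w g \<longrightarrow> p w \<in> q_Z_q"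
      "C' g = val n (m g + (\<Sum>h\<in>nbelow n g. const (p h) * m h))"
      using C' unfolding expand[OF g, symmetric] by blast
    define x where "x = m g + (\<Sum>h\<in>nbelow n g. const (p h) * m h)"
    have over: "over (normal_words n) x"
      unfolding x_def using unitriangular_over[OF m(1)] g
      by (intro over_add over_sum over_const_mult) (auto simp: nbelow_def)
    have "bar n (C' g) = C' g" using C' g by blast
    then have "val n (coeff_bar x) = val n x"
      using p(2) over_words[OF over] by (simp add: bar_val flip: x_def)
    then have "coeff_bar x = x"
      using over by (intro val_inj_normal) auto
    then have "canonical n m g x"
      unfolding canonical_def using p(1) x_def by (auto simp: nbelow_def)
    then have "x = c g" using canonical_unique[OF m(1) _ c(1)[OF g]] by blast
    then show "C' g = C g" using p(2) g by (simp add: C_def x_def)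
  qed
  ultimately show ?thesis by (rule ex1I)
qed

theorem theorem5p2p3:
  fixes n :: nat
  assumes "n \<ge> 2"
  shows
    "(\<forall>w \<in> words n. \<exists>c :: word \<Rightarrow> rat_q.
        (\<forall>g \<in> good n. prec_eq g w \<longrightarrow> c g \<in> Z_q_qinv) \<and>
        B_word n w =
          (\<Oplus>\<^bsub>Uq n\<^esub>g \<in> {g \<in> good n. prec_eq g w}. c g \<odot>\<^bsub>Uq n\<^esub> B_word n g)) \<and>
     (\<exists>!C :: word \<Rightarrow> generator free set.
        C \<in> extensional (good n) \<and>
        is_basis (Uq n) (Ui n) (good n) C \<and>
        (\<forall>g \<in> good n.
           bar n (C g) = C g \<and>
           (\<exists>p :: word \<Rightarrow> rat_q.
              (\<forall>w \<in> good n. prec w g \<longrightarrow> p w \<in> q_Z_q) \<and>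
              C g = B_bracket n g \<oplus>\<^bsub>Uq n\<^esub>
                (\<Oplus>\<^bsub>Uq n\<^esub>w \<in> {w \<in> good n. prec w g}. p w \<odot>\<^bsub>Uq n\<^esub> B_bracket n w))))"
  by (intro conjI ballI integrality canonical_basis)

end
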